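(* Fix a prime $p_0\equiv1\bmod 4$. Let $I\subseteq\mathbb{R}$ be a fixed interval. Then $$\limsup_{\max(p_1,p)\to\infty}\left|\frac{1}{\dim_{\mathbb{C}}F_{(p_0,p_1),p}}\big|\{i : \lambda_{(p_0,p_1),p,i}\in I\}\big|-\int_I\frac{(p_0+1)\sqrt{4p_0-\lambda^2}}{2\pi\big((p_0+1)^2-\lambda^2\big)}\mathbb{1}_{[-2\sqrt{p_0},2\sqrt{p_0}]\cap I}(\lambda)\,d\lambda\right|=0,$$ meaning that the supremum of the absolute value over all primes $p_1\equiv1\bmod4$, $p_1\neq p_0$, and all $p\in\mathbb{N}$ with $\max(p_1,p)\geqslant k$ tends to $0$ as $k\to\infty$.
   Context: Let $p_0,p_1$ be distinct primes with $p_0,p_1\equiv1\bmod4$. Let $A$ be the set of $a=(a_0,a_1,a_2,a_3)\in\mathbb{Z}^4$ with $a_0^2+a_1^2+a_2^2+a_3^2=p_0$, $a_0$ positive and odd, $a_1,a_2,a_3$ even; $|A|=p_0+1$. Fix $b\in\mathbb{Z}$ with $b^2\equiv-1\bmod p_1$. For $a\in A$ let $a_{\mathbb{Z}/p_1\mathbb{Z}}$ be the class in $\mathrm{PGL}_2(\mathbb{Z}/p_1\mathbb{Z})$ of $\begin{pmatrix}a_0+ba_1&a_2+ba_3\\-a_2+ba_3&a_0-ba_1\end{pmatrix}$; if the Legendre symbol $\left(\frac{p_0}{p_1}\right)=1$ this class lies in $\mathrm{PSL}_2(\mathbb{Z}/p_1\mathbb{Z})\subset \mathrm{PGL}_2(\mathbb{Z}/p_1\mathbb{Z})$.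 Let $$a_{\mathbb{R}}=\frac{1}{\sqrt{p_0}}\begin{pmatrix}a_0+\sqrt{-1}a_1&a_2+\sqrt{-1}a_3\\-a_2+\sqrt{-1}a_3&a_0-\sqrt{-1}a_1\end{pmatrix}\in\mathrm{SU}_2(\mathbb{C}).$$ $X_{(p_0,p_1)}$ is the Cayley graph, with respect to $\{a_{\mathbb{Z}/p_1\mathbb{Z}}: a\in A\}$, of $\mathrm{PGL}_2(\mathbb{Z}/p_1\mathbb{Z})$ if $\left(\frac{p_0}{p_1}\right)=-1$ and of $\mathrm{PSL}_2(\mathbb{Z}/p_1\mathbb{Z})$ if $\left(\frac{p_0}{p_1}\right)=1$; $|X_{(p_0,p_1)}|$ is $p_1(p_1^2-1)$, respectively $\frac12p_1(p_1^2-1)$. For $p\in\mathbb{N}$, $\mathrm{Sym}^p(\mathbb{C}^2)$ is the space of homogeneous polynomials of degree $p$ in $(z_0,z_1)$, with $g\in\mathrm{SU}_2(\mathbb{C})$ acting by $(gs)(z)=s(g^{-1}z)$ and with the $\mathrm{SU}_2(\mathbb{C})$-invariant inner product $\int_{\mathbb{CP}^1}s\,\overline{s'}\,\omega_{\mathrm{FS}}$ (polynomials restricted to the unit sphere; $\omega_{\mathrm{FS}}=c_1(\mathcal{O}_{\mathbb{CP}^1}(1))$ of total mass $1$). The Laplacian acts on functions $u:X_{(p_0,p_1)}\to\mathrm{Sym}^p(\mathbb{C}^2)$ by $$(\Delta^{F_{(p_0,p_1),p}}u)(x)=\sum_{a\in A}a_{\mathbb{R}}\cdot u\big(a_{\mathbb{Z}/p_1\mathbb{Z}}^{-1}\cdot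 x\big).$$ It is self-adjoint; $\dim_{\mathbb{C}}F_{(p_0,p_1),p}=|X_{(p_0,p_1)}|(p+1)$, and $\lambda_{(p_0,p_1),p,i}$, $1\leqslant i\leqslant\dim_{\mathbb{C}}F_{(p_0,p_1),p}$, are its eigenvalues with multiplicity. *)

theory Defs
  imports
    "HOL-Analysis.Analysis"
    "HOL-Number_Theory.Number_Theory"
    "HOL-Library.Function_Algebras"
    "HOL-Library.Multiset"
begin

text \<open>A tuple \<open>(a, b, c, d)\<close> stands for the matrix with rows \<open>(a, b)\<close> and \<open>(c, d)\<close>. The matrix
  groups are defined over an arbitrary HOL-Algebra ring, since the modulus varies inside the theorem.\<close>

type_synonym 'r mat2 = "'r \<times> 'r \<times> 'r \<times> 'r"

definition Mat2 :: "('r, 'm) ring_scheme \<Rightarrow> 'r mat2 monoid" where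
  "Mat2 R =
    \<lparr>carrier = carrier R \<times> carrier R \<times> carrier R \<times> carrier R,
     monoid.mult = (\<lambda>(a, b, c, d) (a', b', c', d').
       (a \<otimes>\<^bsub>R\<^esub> a' \<oplus>\<^bsub>R\<^esub> b \<otimes>\<^bsub>R\<^esub> c', a \<otimes>\<^bsub>R\<^esub> b' \<oplus>\<^bsub>R\<^esub> b \<otimes>\<^bsub>R\<^esub> d',
        c \<otimes>\<^bsub>R\<^esub> a' \<oplus>\<^bsub>R\<^esub> d \<otimes>\<^bsub>R\<^esub> c', c \<otimes>\<^bsub>R\<^esub> b' \<oplus>\<^bsub>R\<^esub> d \<otimes>\<^bsub>R\<^esub> d')),
     one = (\<one>\<^bsub>R\<^esub>, \<zero>\<^bsub>R\<^esub>, \<zero>\<^bsub>R\<^esub>, \<one>\<^bsub>R\<^esub>)\<rparr>"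

definition det2 :: "('r, 'm) ring_scheme \<Rightarrow> 'r mat2 \<Rightarrow> 'r" where
  "det2 R = (\<lambda>(a, b, c, d). a \<otimes>\<^bsub>R\<^esub> d \<ominus>\<^bsub>R\<^esub> b \<otimes>\<^bsub>R\<^esub> c)"

definition GL2 :: "('r, 'm) ring_scheme \<Rightarrow> 'r mat2 monoid" where
  "GL2 R = units_of (Mat2 R)"

definition SL2 :: "('r, 'm) ring_scheme \<Rightarrow> 'r mat2 set" where
  "SL2 R = {M \<in> carrier (GL2 R). det2 R M = \<one>\<^bsub>R\<^esub>}"

definition scalars2 :: "('r, 'm) ring_scheme \<Rightarrow> 'r mat2 set" where
  "scalars2 R = {(c, \<zero>\<^bsub>R\<^esub>, \<zero>\<^bsub>R\<^esub>, c) | c. c \<in> Units R}"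

definition PGL2 :: "('r, 'm) ring_scheme \<Rightarrow> 'r mat2 set monoid" where
  "PGL2 R = GL2 R Mod scalars2 R"

definition PGL2_class :: "('r, 'm) ring_scheme \<Rightarrow> 'r mat2 \<Rightarrow> 'r mat2 set" where
  "PGL2_class R M = scalars2 R #>\<^bsub>GL2 R\<^esub> M"

text \<open>\<open>PSL\<^sub>2\<close> is used as a subset of \<open>PGL\<^sub>2\<close>, namely the image of \<open>SL\<^sub>2\<close>.\<close>

definition PSL2 :: "('r, 'm) ring_scheme \<Rightarrow> 'r mat2 set set" where
  "PSL2 R = PGL2_class R ` SL2 R"

type_synonym quat = "int \<times> int \<times> int \<times> int"

definition quat_set :: "nat \<Rightarrow> quat set" where
  "quat_set p0 = {(a0, a1, a2, a3).
     a0\<^sup>2 + a1\<^sup>2 + a2\<^sup>2 + a3\<^sup>2 = int p0 \<and> a0 > 0 \<and> odd a0 \<and> even a1 \<and> even a2 \<and> even a3}"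

text \<open>In the following definitions \<open>\<beta>\<close> is a square root of \<open>-1\<close> modulo \<open>p1\<close>.\<close>

definition quat_mod :: "nat \<Rightarrow> int \<Rightarrow> quat \<Rightarrow> int mat2 set" where
  "quat_mod p1 \<beta> = (\<lambda>(a0, a1, a2, a3). PGL2_class (residue_ring (int p1))
     ((a0 + \<beta> * a1) mod int p1, (a2 + \<beta> * a3) mod int p1,
      (- a2 + \<beta> * a3) mod int p1, (a0 - \<beta> * a1) mod int p1))"

definition quat_SU2 :: "nat \<Rightarrow> quat \<Rightarrow> complex^2^2" where
  "quat_SU2 p0 = (\<lambda>(a0, a1, a2, a3). (1 / sqrt (real p0)) *\<^sub>R
     vector [vector [of_int a0 + \<i> * of_int a1, of_int a2 + \<i> * of_int a3],
             vector [- of_int a2 + \<i> * of_int a3, of_int a0 - \<i> * of_int a1]])"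

definition cayley_vertices :: "nat \<Rightarrow> nat \<Rightarrow> int mat2 set set" where
  "cayley_vertices p0 p1 =
    (if Legendre (int p0) (int p1) = 1 then PSL2 (residue_ring (int p1))
     else carrier (PGL2 (residue_ring (int p1))))"

text \<open>Homogeneous polynomials of degree \<open>p\<close> in two complex variables, as polynomial functions.\<close>

definition Sym_poly :: "nat \<Rightarrow> (complex^2 \<Rightarrow> complex) set" where
  "Sym_poly p = {s. \<exists>c :: nat \<Rightarrow> complex. \<forall>z. s z = (\<Sum>j\<le>p. c j * (z $ 1) ^ (p - j) * (z $ 2) ^ j)}"

definition poly_action :: "complex^2^2 \<Rightarrow> (complex^2 \<Rightarrow> complex) \<Rightarrow> (complex^2 \<Rightarrow> complex)" where
  "poly_action g s = (\<lambda>z. s (matrix_inv g *v z))"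

type_synonym sym_section = "int mat2 set \<Rightarrow> complex^2 \<Rightarrow> complex"

text \<open>Functions on the vertex set are represented by total functions vanishing off the vertex set.\<close>

definition section_space :: "nat \<Rightarrow> nat \<Rightarrow> nat \<Rightarrow> sym_section set" where
  "section_space p0 p1 p =
    {u. (\<forall>x \<in> cayley_vertices p0 p1. u x \<in> Sym_poly p) \<and> (\<forall>x. x \<notin> cayley_vertices p0 p1 \<longrightarrow> u x = 0)}"

definition section_scale :: "complex \<Rightarrow> sym_section \<Rightarrow> sym_section" where
  "section_scale c u = (\<lambda>x z. c * u x z)"

lemma vector_space_section_scale: "vector_space section_scale"
  by unfold_locales (auto simp: section_scale_def fun_eq_iff algebra_simps)

abbreviation section_dim :: "sym_section set \<Rightarrow> nat" where
  "section_dim \<equiv> vector_space.dim section_scale"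

definition laplacian :: "nat \<Rightarrow> nat \<Rightarrow> int \<Rightarrow> sym_section \<Rightarrow> sym_section" where
  "laplacian p0 p1 \<beta> u = (\<lambda>x.
     if x \<in> cayley_vertices p0 p1
     then \<Sum>a \<in> quat_set p0. poly_action (quat_SU2 p0 a)
       (u (inv\<^bsub>PGL2 (residue_ring (int p1))\<^esub> (quat_mod p1 \<beta> a)
           \<otimes>\<^bsub>PGL2 (residue_ring (int p1))\<^esub> x))
     else 0)"

definition laplacian_eigenspace :: "nat \<Rightarrow> nat \<Rightarrow> int \<Rightarrow> nat \<Rightarrow> real \<Rightarrow> sym_section set" where
  "laplacian_eigenspace p0 p1 \<beta> p \<mu> =
    {u \<in> section_space p0 p1 p. laplacian p0 p1 \<beta> u = section_scale (of_real \<mu>) u}"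

text \<open>The Laplacian is self-adjoint for the inner product induced by the \<open>SU(2)\<close>-invariant one on
  homogeneous polynomials (integration over the projective line), so its eigenvalues are real and the multiplicity of an eigenvalue
  is the dimension of its eigenspace; only finitely many eigenspaces are nonzero, so that
  \<open>Abs_multiset\<close> is applied to a function of finite support.\<close>

definition laplacian_spectrum :: "nat \<Rightarrow> nat \<Rightarrow> int \<Rightarrow> nat \<Rightarrow> real multiset" where
  "laplacian_spectrum p0 p1 \<beta> p =
    Abs_multiset (\<lambda>\<mu>. section_dim (laplacian_eigenspace p0 p1 \<beta> p \<mu>))"

text \<open>The eigenvalues \<open>\<lambda>\<^sub>i\<close> for \<open>1 \<le> i \<le> dim\<close>, listed in increasing order.\<close>

definition laplacian_eigenvalue :: "nat \<Rightarrow> nat \<Rightarrow> int \<Rightarrow> nat \<Rightarrow> nat \<Rightarrow> real" where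
  "laplacian_eigenvalue p0 p1 \<beta> p i = sorted_list_of_multiset (laplacian_spectrum p0 p1 \<beta> p) ! (i - 1)"

end

theory Submission
  imports Defs
    "HOL-Computational_Algebra.Fundamental_Theorem_Algebra"
    "HOL-Probability.Weak_Convergence"
    "HOL-Probability.Probability_Mass_Function"
begin

text \<open>A quaternion of norm \<open>p\<^sub>0\<close> acts on sections by a permutation of the Cayley graph twisted by an
  element of \<open>SU\<^sub>2\<close>, and the Laplacian is the sum of these actions. The sum over all reduced words of
  length \<open>k\<close> is a polynomial \<open>P\<^sub>k\<close> in the Laplacian, because there are \<open>p\<^sub>0 + 1\<close> quaternions and conjugation
  inverts them. A nonempty reduced word is never a scalar quaternion (it is not divisible by \<open>p\<^sub>0\<close>),
  so either \<open>p\<^sub>1\<close> is large and it acts without fixed points, or its trace on \<open>Sym\<^sup>p\<close> is bounded in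
  terms of \<open>k\<close> alone while the dimension grows like \<open>p\<close>. Hence the normalised trace of \<open>P\<^sub>k\<close>
  tends to \<open>0\<close> for \<open>k > 0\<close>. These are the moments of the Kesten--McKay distribution; the eigenvalues
  are bounded and the limit has a density, so the convergence passes from polynomials to intervals.\<close>

section \<open>Integer quaternions modulo a prime\<close>

text \<open>The estimate has to be uniform in two parameters that may grow in any combination. For a
  fixed word length \<open>k\<close> only constants depending on \<open>p0\<close> and
  \<open>k\<close> occur: a nonempty reduced word of length \<open>k\<close> with trivial class
  forces \<open>p1 \<le> p0 ^ k\<close>, and every other such word has trace exactly zero. If
  \<open>p1\<close> stays that small, then \<open>p\<close> must be large, and the character of the
  symmetric power at the word is at most \<open>sqrt p0 ^ k\<close>, because the imaginary part of a
  nonscalar integral quaternion has length at least 1. Uniformity is then tested along arbitrary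
  sequences of pairs. Reduction modulo \<open>p0\<close> gives both the number of generators, a case
  of Jacobi's four-square theorem, and the absence of relations among reduced words: a quaternion of
  norm \<open>p0\<close> becomes a rank-one matrix, its kernel is a point of a projective line with
  \<open>p0 + 1\<close> points, and that point determines the generator. The moments of the limit
  density reduce to Fourier coefficients of a Poisson kernel, found from a recurrence and
  boundedness instead of residues.\<close>

definition qmul :: "quat \<Rightarrow> quat \<Rightarrow> quat" where
  "qmul = (\<lambda>(a0, a1, a2, a3) (b0, b1, b2, b3).
     (a0 * b0 - a1 * b1 - a2 * b2 - a3 * b3, a0 * b1 + a1 * b0 + a2 * b3 - a3 * b2,
      a0 * b2 - a1 * b3 + a2 * b0 + a3 * b1, a0 * b3 + a1 * b2 - a2 * b1 + a3 * b0))"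

definition qconj :: "quat \<Rightarrow> quat" where
  "qconj = (\<lambda>(a0, a1, a2, a3). (a0, - a1, - a2, - a3))"

definition qnorm :: "quat \<Rightarrow> int" where
  "qnorm = (\<lambda>(a0, a1, a2, a3). a0\<^sup>2 + a1\<^sup>2 + a2\<^sup>2 + a3\<^sup>2)"

definition qscale :: "int \<Rightarrow> quat \<Rightarrow> quat" where
  "qscale c = (\<lambda>(a0, a1, a2, a3). (c * a0, c * a1, c * a2, c * a3))"

definition qdvd :: "int \<Rightarrow> quat \<Rightarrow> bool" where
  "qdvd m = (\<lambda>(a0, a1, a2, a3). m dvd a0 \<and> m dvd a1 \<and> m dvd a2 \<and> m dvd a3)"

lemma qmul_assoc: "qmul (qmul a b) c = qmul a (qmul b c)"
  by (cases a; cases b; cases c) (simp add: qmul_def algebra_simps)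

lemma qnorm_qmul: "qnorm (qmul a b) = qnorm a * qnorm b"
  by (cases a; cases b) (simp add: qmul_def qnorm_def power2_eq_square algebra_simps)

lemma qnorm_qconj [simp]: "qnorm (qconj a) = qnorm a"
  by (cases a) (simp add: qconj_def qnorm_def)

lemma qconj_qconj [simp]: "qconj (qconj a) = a"
  by (cases a) (simp add: qconj_def)

lemma qconj_qmul: "qconj (qmul a b) = qmul (qconj b) (qconj a)"
  by (cases a; cases b) (simp add: qmul_def qconj_def algebra_simps)

lemma qmul_qconj: "qmul a (qconj a) = (qnorm a, 0, 0, 0)"
  by (cases a) (simp add: qmul_def qconj_def qnorm_def power2_eq_square algebra_simps)

lemma qmul_scalar_left: "qmul (c, 0, 0, 0) a = qscale c a"
  by (cases a) (simp add: qmul_def qscale_def)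

lemma qmul_scalar_right: "qmul a (c, 0, 0, 0) = qscale c a"
  by (cases a) (simp add: qmul_def qscale_def mult.commute)

lemma qdvd_iff: "qdvd m a \<longleftrightarrow> (\<exists>b. a = qscale m b)"
  by (cases a) (force simp: qdvd_def qscale_def dvd_def)

lemma qmul_qscale: "qmul (qscale c a) b = qscale c (qmul a b)" "qmul a (qscale c b) = qscale c (qmul a b)"
  by (cases a; cases b; simp add: qmul_def qscale_def algebra_simps)+

lemma qnorm_qscale: "qnorm (qscale c a) = c\<^sup>2 * qnorm a"
  by (cases a) (simp add: qnorm_def qscale_def power_mult_distrib algebra_simps)

lemma qnorm_nonneg [simp]: "qnorm a \<ge> 0"
  by (cases a) (simp add: qnorm_def)

text \<open>A square root \<open>i\<close> of \<open>-1\<close> modulo \<open>p\<close> identifies quaternions modulo \<open>p\<close> with \<open>2 \<times> 2\<close> matrices;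
  a quaternion of norm \<open>p\<close> becomes a matrix of rank one, and \<open>annih\<close> says that the row \<open>(r, s)\<close>
  is in its left kernel.\<close>

definition annih :: "int \<Rightarrow> int \<Rightarrow> int \<Rightarrow> int \<Rightarrow> quat \<Rightarrow> bool" where
  "annih p i r s = (\<lambda>(a0, a1, a2, a3).
     p dvd r * (a0 + i * a1) + s * (- a2 + i * a3) \<and> p dvd r * (a2 + i * a3) + s * (a0 - i * a1))"

text \<open>Used for both primes: at \<open>p0\<close>, to classify the generators, and at
  \<open>p1\<close>, where \<open>i\<close> is the \<open>\<beta>\<close> of the Cayley
  graph.\<close>

locale split_prime =
  fixes p i :: int
  assumes prime_p: "prime p" and odd_p: "odd p" and i_square: "p dvd i\<^sup>2 + 1"
begin

lemma p_not_dvd_i: "\<not> p dvd i"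
proof
  assume "p dvd i"
  then have "p dvd i\<^sup>2" by (simp add: power2_eq_square)
  with i_square have "p dvd 1" using dvd_add_right_iff by blast
  with prime_p show False using not_prime_unit by blast
qed

lemma p_dvd_double: "p dvd 2 * x \<longleftrightarrow> p dvd x"
proof -
  have "coprime p 2" using odd_p by simp
  then show ?thesis by (simp add: coprime_dvd_mult_right_iff)
qed

lemma p_dvd_i_mult: "p dvd i * x \<longleftrightarrow> p dvd x"
  using prime_dvd_mult_iff[OF prime_p] p_not_dvd_i by blast

text \<open>Reduction to matrices is injective modulo \<open>p\<close>: sums and differences of the
  entries give twice the coordinates, up to a factor \<open>i\<close>, and both 2 and
  \<open>i\<close> are units.\<close>

lemma qdvd_if_matrix_zero:
  assumes "p dvd a0 + i * a1" "p dvd a0 - i * a1" "p dvd a2 + i * a3" "p dvd - a2 + i * a3"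
  shows "qdvd p (a0, a1, a2, a3)"
proof -
  have "p dvd (a0 + i * a1) + (a0 - i * a1)" "p dvd (a0 + i * a1) - (a0 - i * a1)"
    "p dvd (a2 + i * a3) - (- a2 + i * a3)" "p dvd (a2 + i * a3) + (- a2 + i * a3)"
    using assms dvd_add dvd_diff by blast+
  moreover have "(a0 + i * a1) + (a0 - i * a1) = 2 * a0" "(a0 + i * a1) - (a0 - i * a1) = 2 * (i * a1)"
    "(a2 + i * a3) - (- a2 + i * a3) = 2 * a2" "(a2 + i * a3) + (- a2 + i * a3) = 2 * (i * a3)"
    by auto
  ultimately show ?thesis by (simp only: p_dvd_double p_dvd_i_mult qdvd_def case_prod_conv simp_thms)
qed

text \<open>A row killed by the matrix of \<open>a\<close> is killed by the matrix of
  \<open>a\<close> times that of \<open>b\<close>, and matrices multiply like quaternions up to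
  multiples of \<open>i^2 + 1\<close>.\<close>

lemma annih_qmul:
  assumes "annih p i r s a" shows "annih p i r s (qmul a b)"
proof -
  obtain a0 a1 a2 a3 b0 b1 b2 b3 where [simp]: "a = (a0, a1, a2, a3)" "b = (b0, b1, b2, b3)"
    by (cases a; cases b) auto
  \<comment> \<open>The row \<open>(r, s)\<close> times the matrix of \<open>a\<close> is
    \<open>(?X, ?Y)\<close>. The next two facts multiply it by the matrix of \<open>b\<close> and
    replace \<open>i^2\<close> by \<open>-1\<close>.\<close>
  let ?X = "r * (a0 + i * a1) + s * (- a2 + i * a3)" and ?Y = "r * (a2 + i * a3) + s * (a0 - i * a1)"
  have XY: "p dvd ?X" "p dvd ?Y" using assms by (auto simp: annih_def)
  have 1: "p dvd ?X * (b0 + i * b1) + ?Y * (- b2 + i * b3)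
      - (i\<^sup>2 + 1) * (r * (a1 * b1 + a3 * b3) + s * (a3 * b1 - a1 * b3))"
    by (rule dvd_diff[OF dvd_add[OF dvd_mult2[OF XY(1)] dvd_mult2[OF XY(2)]] dvd_mult2[OF i_square]])
  have 2: "p dvd ?X * (b2 + i * b3) + ?Y * (b0 - i * b1)
      - (i\<^sup>2 + 1) * (r * (a1 * b3 - a3 * b1) + s * (a1 * b1 + a3 * b3))"
    by (rule dvd_diff[OF dvd_add[OF dvd_mult2[OF XY(1)] dvd_mult2[OF XY(2)]] dvd_mult2[OF i_square]])
  show ?thesis using 1 2
    by (simp add: annih_def qmul_def algebra_simps power2_eq_square)
qed

text \<open>Over the field with \<open>p\<close> elements, two vectors orthogonal to the same
  nonzero row are proportional.\<close>

lemma dvd_cross: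
  assumes "p dvd r * x + s * y" "p dvd r * x' + s * y'" "\<not> (p dvd r \<and> p dvd s)"
  shows "p dvd x * y' - y * x'"
proof -
  have "p dvd (r * x + s * y) * y' - (r * x' + s * y') * y"
    "p dvd (r * x' + s * y') * x - (r * x + s * y) * x'"
    using assms by (intro dvd_diff dvd_mult2; simp)+
  then have "p dvd r * (x * y' - y * x')" "p dvd s * (x * y' - y * x')"
    by (simp_all add: algebra_simps)
  with assms(3) show ?thesis using prime_dvd_mult_iff[OF prime_p] by blast
qed

text \<open>A common left kernel puts all columns of both matrices on one line. The conjugate of
  \<open>a\<close> has the adjugate matrix, so the entries of the product are, up to sign,
  determinants of a column of \<open>a\<close> against a column of \<open>b\<close>, and all of them
  vanish.\<close>

lemma qdvd_qmul_qconj: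
  assumes "annih p i r s a" "annih p i r s b" "\<not> (p dvd r \<and> p dvd s)"
  shows "qdvd p (qmul (qconj a) b)"
proof -
  obtain a0 a1 a2 a3 b0 b1 b2 b3 where [simp]: "a = (a0, a1, a2, a3)" "b = (b0, b1, b2, b3)"
    by (cases a; cases b) auto
  have a: "p dvd r * (a0 + i * a1) + s * (- a2 + i * a3)" "p dvd r * (a2 + i * a3) + s * (a0 - i * a1)"
    and b: "p dvd r * (b0 + i * b1) + s * (- b2 + i * b3)" "p dvd r * (b2 + i * b3) + s * (b0 - i * b1)"
    using assms by (auto simp: annih_def)
  note c = dvd_cross[OF a(1) b(1) assms(3)] dvd_cross[OF a(1) b(2) assms(3)]
     dvd_cross[OF a(2) b(1) assms(3)] dvd_cross[OF a(2) b(2) assms(3)]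
  note d = dvd_mult2[OF i_square]
  have "p dvd ((b0 + i * b1) * (a0 - i * a1) - (- b2 + i * b3) * (a2 + i * a3)) + (i\<^sup>2 + 1) * (a1 * b1 + a3 * b3)"
    "p dvd ((a0 + i * a1) * (b0 - i * b1) - (- a2 + i * a3) * (b2 + i * b3)) + (i\<^sup>2 + 1) * (a1 * b1 + a3 * b3)"
    "p dvd - ((a2 + i * a3) * (b0 - i * b1) - (a0 - i * a1) * (b2 + i * b3)) + (i\<^sup>2 + 1) * (a1 * b3 - a3 * b1)"
    "p dvd ((a0 + i * a1) * (- b2 + i * b3) - (- a2 + i * a3) * (b0 + i * b1)) + (i\<^sup>2 + 1) * (a3 * b1 - a1 * b3)"
    using c d dvd_cross[OF b(1) a(2) assms(3)] by (intro dvd_add dvd_minus_iff[THEN iffD2]; blast)+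
  then have "qdvd p (a0 * b0 + a1 * b1 + a2 * b2 + a3 * b3, a0 * b1 - a1 * b0 - a2 * b3 + a3 * b2,
     a0 * b2 + a1 * b3 - a2 * b0 - a3 * b1, a0 * b3 - a1 * b2 + a2 * b1 - a3 * b0)"
    by (intro qdvd_if_matrix_zero) (simp_all add: algebra_simps power2_eq_square)
  then show ?thesis by (simp add: qmul_def qconj_def algebra_simps)
qed

lemma annih_qscale_iff:
  assumes "coprime p m" shows "annih p i r s (qscale m a) \<longleftrightarrow> annih p i r s a"
proof (cases a)
  case (fields a0 a1 a2 a3)
  have *: "r * (m * a0 + i * (m * a1)) + s * (- (m * a2) + i * (m * a3))
      = m * (r * (a0 + i * a1) + s * (- a2 + i * a3))"
    "r * (m * a2 + i * (m * a3)) + s * (m * a0 - i * (m * a1))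
      = m * (r * (a2 + i * a3) + s * (a0 - i * a1))" by (auto simp: algebra_simps)
  show ?thesis unfolding fields annih_def qscale_def case_prod_conv *
    by (simp only: coprime_dvd_mult_right_iff[OF assms])
qed


lemma annih_cong:
  assumes "qdvd p (a0 - b0, a1 - b1, a2 - b2, a3 - b3)" "annih p i r s (a0, a1, a2, a3)"
  shows "annih p i r s (b0, b1, b2, b3)"
proof -
  obtain e0 e1 e2 e3 where "a0 - b0 = p * e0" "a1 - b1 = p * e1" "a2 - b2 = p * e2" "a3 - b3 = p * e3"
    using assms(1) by (auto simp: qdvd_def dvd_def)
  then have e: "b0 = a0 - p * e0" "b1 = a1 - p * e1" "b2 = a2 - p * e2" "b3 = a3 - p * e3"
    by auto
  have a: "p dvd r * (a0 + i * a1) + s * (- a2 + i * a3)" "p dvd r * (a2 + i * a3) + s * (a0 - i * a1)"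
    using assms by (auto simp: annih_def)
  have "p dvd r * (a0 + i * a1) + s * (- a2 + i * a3) - p * (r * (e0 + i * e1) + s * (- e2 + i * e3))"
    "p dvd r * (a2 + i * a3) + s * (a0 - i * a1) - p * (r * (e2 + i * e3) + s * (e0 - i * e1))"
    using a by (intro dvd_diff dvd_triv_left; simp)+
  then show ?thesis by (simp add: annih_def e algebra_simps)
qed

lemma not_qdvd_if_qnorm: "qnorm a = p \<Longrightarrow> \<not> qdvd p a"
proof
  assume a: "qnorm a = p" "qdvd p a"
  then obtain b where "a = qscale p b" by (auto simp: qdvd_iff)
  with a have "p * (p * qnorm b) = p * 1" by (simp add: qnorm_qscale power2_eq_square)
  then have "p dvd 1" using prime_p by (metis dvd_triv_left mult_cancel_left not_prime_0)
  then show False using prime_p not_prime_unit by blast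
qed

text \<open>The conjugate of \<open>a\<close> times \<open>b\<close> is \<open>p\<close> times a
  quaternion \<open>c\<close> of norm 1. The parity conditions make the imaginary coordinates of
  \<open>c\<close> even, hence zero, so \<open>b\<close> is \<open>a\<close> or its negative, and
  the positive real parts decide the sign.\<close>

lemma quat_set_eq_if_annih:
  assumes p: "p = int p0" and a: "a \<in> quat_set p0" and b: "b \<in> quat_set p0"
    and an: "annih p i r s a" "annih p i r s b" "\<not> (p dvd r \<and> p dvd s)"
  shows "a = b"
proof -
  obtain a0 a1 a2 a3 where a': "a = (a0, a1, a2, a3)" by (cases a)
  obtain b0 b1 b2 b3 where b': "b = (b0, b1, b2, b3)" by (cases b)
  have na: "qnorm a = p" and nb: "qnorm b = p" using a b a' b' by (auto simp: quat_set_def qnorm_def p)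
  have p0: "p \<noteq> 0" using prime_p by auto
  obtain c where c: "qmul (qconj a) b = qscale p c"
    using qdvd_qmul_qconj[OF an] by (auto simp: qdvd_iff)
  obtain c0 c1 c2 c3 where c': "c = (c0, c1, c2, c3)" by (cases c)
  have "p * p = p\<^sup>2 * qnorm c"
    using arg_cong[OF c, of qnorm] by (simp add: qnorm_qmul qnorm_qscale na nb)
  then have "qnorm c = 1" using p0 by (simp add: power2_eq_square)
  then have n1: "c0\<^sup>2 + c1\<^sup>2 + c2\<^sup>2 + c3\<^sup>2 = 1" by (simp add: c' qnorm_def)
  have pc: "p * c1 = a0 * b1 - a1 * b0 - a2 * b3 + a3 * b2"
    "p * c2 = a0 * b2 + a1 * b3 - a2 * b0 - a3 * b1"
    "p * c3 = a0 * b3 - a1 * b2 + a2 * b1 - a3 * b0"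
    using c by (auto simp: a' b' c' qmul_def qconj_def qscale_def)
  have ev: "even a1" "even a2" "even a3" "even b1" "even b2" "even b3" "a0 > 0" "b0 > 0"
    using a b a' b' by (auto simp: quat_set_def)
  have "even (p * c1)" "even (p * c2)" "even (p * c3)" unfolding pc using ev by simp_all
  then have evc: "even c1" "even c2" "even c3" using odd_p by auto
  have z: "x = 0" if "even x" "x\<^sup>2 \<le> 1" for x :: int
  proof -
    have "\<bar>x\<bar> \<le> 1" using that(2) abs_le_square_iff[of x 1] by simp
    then show ?thesis using that(1) by presburger
  qed
  have sq: "c0\<^sup>2 \<ge> 0" "c1\<^sup>2 \<ge> 0" "c2\<^sup>2 \<ge> 0" "c3\<^sup>2 \<ge> 0" by auto
  have c123: "c1 = 0" "c2 = 0" "c3 = 0" using evc n1 sq by (intro z; linarith)+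
  then have c0: "c0 = 1 \<or> c0 = -1" using n1 by (simp add: power2_eq_1_iff)
  have "qscale p b = qmul a (qmul (qconj a) b)"
    by (simp add: qmul_assoc[symmetric] qmul_qconj qmul_scalar_left na)
  also have "\<dots> = qscale p (qscale c0 a)"
    by (simp add: c c' c123 qmul_qscale qmul_scalar_right)
  finally have "b0 = c0 * a0" "b1 = c0 * a1" "b2 = c0 * a2" "b3 = c0 * a3"
    using p0 by (auto simp: a' b' qscale_def)
  then show ?thesis using c0 ev by (auto simp: a' b')
qed

text \<open>\<open>(lineR t, lineS t)\<close> runs through the points of the projective line over
  the field with \<open>p\<close> elements: \<open>(1 : t)\<close> for \<open>t < p\<close>, and the
  point at infinity \<open>(0 : 1)\<close> for \<open>t = p\<close>.\<close>

definition lineR :: "int \<Rightarrow> int" where "lineR t = (if t < p then 1 else 0)"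
definition lineS :: "int \<Rightarrow> int" where "lineS t = (if t < p then t else 1)"

lemma p_not_dvd_1: "\<not> p dvd 1"
  using prime_p not_prime_unit by blast

lemma line_nonzero: "\<not> (p dvd lineR t \<and> p dvd lineS t)"
  using p_not_dvd_1 by (auto simp: lineR_def lineS_def)

lemma p_gt_1: "p > 1"
  using prime_p by (simp add: prime_gt_1_int)

text \<open>If \<open>r\<close> is a unit with inverse \<open>u\<close>, the row is rescaled to
  \<open>(1, s * u)\<close>; otherwise it is a multiple of \<open>(0, 1)\<close>. The conclusion is
  an implication between orthogonality conditions because \<open>annih\<close> consists of two of
  these.\<close>

lemma normalise_line:
  assumes "\<not> (p dvd r \<and> p dvd s)"
  obtains t where "t \<in> {0..p}" "\<And>x y. p dvd r * x + s * y \<Longrightarrow> p dvd lineR t * x + lineS t * y"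
proof (cases "p dvd r")
  case True
  then have s: "\<not> p dvd s" using assms by simp
  have H: "p dvd y" if "p dvd r * x + s * y" for x y
  proof -
    have "p dvd s * y" using that dvd_mult2[OF True, of x] by (simp only: dvd_add_right_iff)
    with s show ?thesis by (simp only: prime_dvd_mult_iff[OF prime_p] simp_thms)
  qed
  show ?thesis
  proof (rule that[of p])
    fix x y assume "p dvd r * x + s * y"
    then have "p dvd y" by (rule H)
    then show "p dvd lineR p * x + lineS p * y" by (simp add: lineR_def lineS_def)
  qed (use p_gt_1 in simp)
next
  case False
  then have "coprime r p" using prime_p by (simp add: prime_imp_coprime coprime_commute)
  then obtain u where "[r * u = 1] (mod p)" using cong_solve_coprime_int by blast
  then have u: "p dvd r * u - 1" by (simp add: cong_iff_dvd_diff)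
  define t where "t = (s * u) mod p"
  have t: "p dvd t - s * u" unfolding t_def by (metis dvd_minus_mod dvd_diff_commute)
  have tr: "0 \<le> t" "t < p" using p_gt_1 by (auto simp: t_def)
  have H: "p dvd x + t * y" if "p dvd r * x + s * y" for x y
  proof -
    have "p dvd (r * x + s * y) * u - (r * u - 1) * x + (t - s * u) * y"
      by (rule dvd_add[OF dvd_diff[OF dvd_mult2[OF that] dvd_mult2[OF u]] dvd_mult2[OF t]])
    then show ?thesis by (simp add: algebra_simps)
  qed
  show ?thesis
  proof (rule that[of t])
    fix x y assume "p dvd r * x + s * y"
    then have "p dvd x + t * y" by (rule H)
    then show "p dvd lineR t * x + lineS t * y" using tr by (simp add: lineR_def lineS_def)
  qed (use tr in simp)
qed

lemma exists_annih_line: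
  assumes "qnorm a = p" shows "\<exists>t\<in>{0..p}. annih p i (lineR t) (lineS t) a"
proof -
  obtain a0 a1 a2 a3 where a: "a = (a0, a1, a2, a3)" by (cases a)
  have det: "p dvd (a0 + i * a1) * (a0 - i * a1) - (- a2 + i * a3) * (a2 + i * a3)"
  proof -
    have "p dvd qnorm a - (i\<^sup>2 + 1) * (a1\<^sup>2 + a3\<^sup>2)"
      using assms by (intro dvd_diff dvd_mult2 i_square) simp
    then show ?thesis by (simp add: a qnorm_def algebra_simps power2_eq_square)
  qed
  \<comment> \<open>Up to sign the two candidates are the rows of the adjugate matrix, which kill a
    singular matrix. One of them is nonzero because \<open>a\<close> is not divisible by
    \<open>p\<close>.\<close>
  have "\<exists>r s. \<not> (p dvd r \<and> p dvd s) \<and> annih p i r s a"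
  proof (cases "p dvd a0 + i * a1 \<and> p dvd - a2 + i * a3")
    case False
    have "annih p i (- a2 + i * a3) (- (a0 + i * a1)) a"
      using dvd_minus_iff[THEN iffD2, OF det] by (simp add: annih_def a algebra_simps)
    moreover have "\<not> (p dvd - a2 + i * a3 \<and> p dvd - (a0 + i * a1))" using False dvd_minus_iff[of p] by blast
    ultimately show ?thesis by blast
  next
    case True
    have "annih p i (a0 - i * a1) (- (a2 + i * a3)) a"
      using det by (simp add: annih_def a algebra_simps)
    moreover have "\<not> (p dvd a0 - i * a1 \<and> p dvd - (a2 + i * a3))"
      using True qdvd_if_matrix_zero[of a0 a1 a2 a3] not_qdvd_if_qnorm[OF assms] dvd_minus_iff[of p] a by blast
    ultimately show ?thesis by blast
  qed
  then obtain r s where rs: "\<not> (p dvd r \<and> p dvd s)" "annih p i r s a" by blast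
  obtain t where t: "t \<in> {0..p}" "\<And>x y. p dvd r * x + s * y \<Longrightarrow> p dvd lineR t * x + lineS t * y"
    using normalise_line[OF rs(1)] by blast
  have "annih p i (lineR t) (lineS t) a"
    using rs(2) t(2) unfolding a annih_def case_prod_conv by blast
  with t(1) show ?thesis by blast
qed

text \<open>Two different points of the projective line are independent rows. A matrix killed by
  both is zero, which would make \<open>a\<close> divisible by \<open>p\<close>, impossible for norm
  \<open>p\<close>.\<close>

lemma annih_line_unique:
  assumes "qnorm a = p" "annih p i (lineR t) (lineS t) a" "annih p i (lineR u) (lineS u) a"
    "t \<in> {0..p}" "u \<in> {0..p}"
  shows "t = u"
proof (rule ccontr)
  assume tu: "t \<noteq> u"
  obtain a0 a1 a2 a3 where a: "a = (a0, a1, a2, a3)" by (cases a)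
  have d: "\<not> p dvd lineR t * lineS u - lineS t * lineR u"
  proof
    assume *: "p dvd lineR t * lineS u - lineS t * lineR u"
    consider "t < p" "u < p" | "t = p" "u < p" | "t < p" "u = p" using assms(4,5) tu by force
    then show False
    proof cases
      case 1
      then have "p dvd u - t" using * by (simp add: lineR_def lineS_def)
      moreover have "u - t \<noteq> 0" "\<bar>u - t\<bar> < \<bar>p\<bar>" using 1 assms(4,5) tu by auto
      ultimately show False using dvd_imp_le_int[of "u - t" p] by linarith
    qed (use * p_not_dvd_1 in \<open>auto simp: lineR_def lineS_def\<close>)
  qed
  have *: "p dvd x \<and> p dvd y" if "p dvd lineR t * x + lineS t * y" "p dvd lineR u * x + lineS u * y" for x y
  proof (rule ccontr)
    assume "\<not> (p dvd x \<and> p dvd y)"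
    then have "p dvd lineR t * lineS u - lineS t * lineR u"
      using that by (intro dvd_cross[of x _ y]) (simp_all add: mult.commute)
    with d show False ..
  qed
  have "p dvd a0 + i * a1 \<and> p dvd - a2 + i * a3" "p dvd a2 + i * a3 \<and> p dvd a0 - i * a1"
    using assms(2,3) unfolding annih_def a case_prod_conv by (intro *; blast)+
  then have "qdvd p a" unfolding a by (intro qdvd_if_matrix_zero) simp_all
  then show False using not_qdvd_if_qnorm[OF assms(1)] by blast
qed

end

section \<open>Reduced words in quaternions of norm \<open>p0\<close>\<close>

definition qprod :: "quat list \<Rightarrow> quat" where
  "qprod l = foldr qmul l (1, 0, 0, 0)"

lemma qprod_Nil [simp]: "qprod [] = (1, 0, 0, 0)"
  and qprod_Cons [simp]: "qprod (a # l) = qmul a (qprod l)"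
  by (simp_all add: qprod_def)

lemma qnorm_qprod: "(\<And>a. a \<in> set l \<Longrightarrow> qnorm a = n) \<Longrightarrow> qnorm (qprod l) = n ^ length l"
  by (induction l) (auto simp: qnorm_qmul, simp add: qnorm_def)

abbreviation reduced :: "quat list \<Rightarrow> bool" where
  "reduced \<equiv> successively (\<lambda>a b. b \<noteq> qconj a)"

lemma qnorm_quat_set: "a \<in> quat_set n \<Longrightarrow> qnorm a = int n"
  by (auto simp: quat_set_def qnorm_def)

lemma qconj_quat_set: "a \<in> quat_set n \<Longrightarrow> qconj a \<in> quat_set n"
  by (auto simp: quat_set_def qconj_def)

lemma finite_quat_set: "finite (quat_set n)"
proof (rule finite_subset)
  have "\<bar>x\<bar> \<le> int n" if "x\<^sup>2 \<le> int n" for x :: int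
  proof -
    have "\<bar>x\<bar> \<le> \<bar>x\<bar> * \<bar>x\<bar>"
      using mult_left_mono[of 1 "\<bar>x\<bar>" "\<bar>x\<bar>"] by (cases "x = 0") auto
    then show ?thesis using that by (simp add: power2_eq_square abs_mult_self_eq)
  qed
  moreover have "0 \<le> x\<^sup>2" for x :: int by simp
  ultimately have *: "x \<in> {- int n..int n}" if "x\<^sup>2 + y = int n" "y \<ge> 0" for x y :: int
    using that by (smt (verit) atLeastAtMost_iff)
  show "quat_set n \<subseteq> {- int n..int n} \<times> {- int n..int n} \<times> {- int n..int n} \<times> {- int n..int n}"
  proof
    fix a assume "a \<in> quat_set n"
    then obtain a0 a1 a2 a3 where a: "a = (a0, a1, a2, a3)" "a0\<^sup>2 + a1\<^sup>2 + a2\<^sup>2 + a3\<^sup>2 = int n"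
      by (auto simp: quat_set_def)
    have "a0 \<in> {- int n..int n}" by (rule *[of a0 "a1\<^sup>2 + a2\<^sup>2 + a3\<^sup>2"]) (use a in auto)
    moreover have "a1 \<in> {- int n..int n}" by (rule *[of a1 "a0\<^sup>2 + a2\<^sup>2 + a3\<^sup>2"]) (use a in auto)
    moreover have "a2 \<in> {- int n..int n}" by (rule *[of a2 "a0\<^sup>2 + a1\<^sup>2 + a3\<^sup>2"]) (use a in auto)
    moreover have "a3 \<in> {- int n..int n}" by (rule *[of a3 "a0\<^sup>2 + a1\<^sup>2 + a2\<^sup>2"]) (use a in auto)
    ultimately show "a \<in> {- int n..int n} \<times> {- int n..int n} \<times> {- int n..int n} \<times> {- int n..int n}"
      by (simp add: a)
  qed
qed simp

context split_prime
begin

text \<open>Modulo \<open>p\<close> the matrices of \<open>a\<close> and \<open>b\<close> have rank one, so \<open>a b W = 0\<close> with \<open>b W \<noteq> 0\<close> forces the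
  image of \<open>b\<close> to be the kernel of \<open>a\<close>, which is the image of the conjugate of \<open>a\<close>.\<close>

lemma qconj_eq_if_not_primitive:
  assumes p: "p = int p0" and a: "a \<in> quat_set p0" and b: "b \<in> quat_set p0"
    and W: "\<not> qdvd p (qmul b W)" and aW: "qdvd p (qmul a (qmul b W))"
  shows "b = qconj a"
proof -
  obtain t where t: "annih p i (lineR t) (lineS t) b"
    using exists_annih_line[of b] qnorm_quat_set[OF b] p by auto
  define r s where "r = lineR t" and "s = lineS t"
  have rs: "annih p i r s b" "\<not> (p dvd r \<and> p dvd s)" using t line_nonzero by (auto simp: r_def s_def)
  obtain a0 a1 a2 a3 where a': "a = (a0, a1, a2, a3)" by (cases a)
  obtain w0 w1 w2 w3 where w: "qmul b W = (w0, w1, w2, w3)" by (cases "qmul b W")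
  have anw: "p dvd r * (w0 + i * w1) + s * (- w2 + i * w3)" "p dvd r * (w2 + i * w3) + s * (w0 - i * w1)"
    using annih_qmul[OF rs(1), of W] by (auto simp: w annih_def)
  obtain z0 z1 z2 z3 where z: "qmul a (qmul b W) = (p * z0, p * z1, p * z2, p * z3)"
    using aW by (auto simp: qdvd_iff qscale_def)
  have z': "a0 * w0 - a1 * w1 - a2 * w2 - a3 * w3 = p * z0" "a0 * w1 + a1 * w0 + a2 * w3 - a3 * w2 = p * z1"
      "a0 * w2 - a1 * w3 + a2 * w0 + a3 * w1 = p * z2" "a0 * w3 + a1 * w2 - a2 * w1 + a3 * w0 = p * z3"
    using z unfolding w a' by (simp_all add: qmul_def)
  obtain k where k: "i\<^sup>2 + 1 = p * k" using i_square by (auto simp: dvd_def)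
  \<comment> \<open>These are the four entries of the matrix of \<open>a\<close> times the matrix of
    \<open>qmul b W\<close>. Each is a combination of the coordinates of the quaternion product,
    which are multiples of \<open>p\<close>, and of \<open>i^2 + 1\<close>.\<close>
  have prod: "p dvd (w0 + i * w1) * (a0 + i * a1) + (- w2 + i * w3) * (a2 + i * a3)"
    "p dvd (w0 + i * w1) * (- a2 + i * a3) + (- w2 + i * w3) * (a0 - i * a1)"
    "p dvd (w2 + i * w3) * (a0 + i * a1) + (w0 - i * w1) * (a2 + i * a3)"
    "p dvd (w2 + i * w3) * (- a2 + i * a3) + (w0 - i * w1) * (a0 - i * a1)"
  proof -
    have "(w0 + i * w1) * (a0 + i * a1) + (- w2 + i * w3) * (a2 + i * a3) =
        (a0 * w0 - a1 * w1 - a2 * w2 - a3 * w3) + i * (a0 * w1 + a1 * w0 + a2 * w3 - a3 * w2) + (i\<^sup>2 + 1) * (a1 * w1 + a3 * w3)"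
      by (simp add: algebra_simps power2_eq_square)
    also have "\<dots> = p * (z0 + i * z1 + k * (a1 * w1 + a3 * w3))"
      unfolding z' k by (simp add: algebra_simps)
    finally show "p dvd (w0 + i * w1) * (a0 + i * a1) + (- w2 + i * w3) * (a2 + i * a3)" by simp
    have "(w0 + i * w1) * (- a2 + i * a3) + (- w2 + i * w3) * (a0 - i * a1) =
        - (a0 * w2 - a1 * w3 + a2 * w0 + a3 * w1) + i * (a0 * w3 + a1 * w2 - a2 * w1 + a3 * w0) + (i\<^sup>2 + 1) * (a3 * w1 - a1 * w3)"
      by (simp add: algebra_simps power2_eq_square)
    also have "\<dots> = p * (- z2 + i * z3 + k * (a3 * w1 - a1 * w3))"
      unfolding z' k by (simp add: algebra_simps)
    finally show "p dvd (w0 + i * w1) * (- a2 + i * a3) + (- w2 + i * w3) * (a0 - i * a1)" by simp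
    have "(w2 + i * w3) * (a0 + i * a1) + (w0 - i * w1) * (a2 + i * a3) =
        (a0 * w2 - a1 * w3 + a2 * w0 + a3 * w1) + i * (a0 * w3 + a1 * w2 - a2 * w1 + a3 * w0) + (i\<^sup>2 + 1) * (a1 * w3 - a3 * w1)"
      by (simp add: algebra_simps power2_eq_square)
    also have "\<dots> = p * (z2 + i * z3 + k * (a1 * w3 - a3 * w1))"
      unfolding z' k by (simp add: algebra_simps)
    finally show "p dvd (w2 + i * w3) * (a0 + i * a1) + (w0 - i * w1) * (a2 + i * a3)" by simp
    have "(w2 + i * w3) * (- a2 + i * a3) + (w0 - i * w1) * (a0 - i * a1) =
        (a0 * w0 - a1 * w1 - a2 * w2 - a3 * w3) - i * (a0 * w1 + a1 * w0 + a2 * w3 - a3 * w2) + (i\<^sup>2 + 1) * (a1 * w1 + a3 * w3)"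
      by (simp add: algebra_simps power2_eq_square)
    also have "\<dots> = p * (z0 - i * z1 + k * (a1 * w1 + a3 * w3))"
      unfolding z' k by (simp add: algebra_simps)
    finally show "p dvd (w2 + i * w3) * (- a2 + i * a3) + (w0 - i * w1) * (a0 - i * a1)" by simp
  qed
  \<comment> \<open>A nonzero column \<open>(c1, c2)\<close> orthogonal to \<open>(r, s)\<close> and
    to both rows of \<open>a\<close> makes these rows proportional to \<open>(r, s)\<close>. Hence
    \<open>(r, s)\<close> kills the adjugate, which is the matrix of the conjugate of
    \<open>a\<close>.\<close>
  have col: "annih p i r s (qconj a)"
    if c: "\<not> (p dvd c1 \<and> p dvd c2)" "p dvd c1 * r + c2 * s"
      "p dvd c1 * (a0 + i * a1) + c2 * (a2 + i * a3)" "p dvd c1 * (- a2 + i * a3) + c2 * (a0 - i * a1)"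
    for c1 c2
  proof -
    have "p dvd r * (a2 + i * a3) - s * (a0 + i * a1)" "p dvd r * (a0 - i * a1) - s * (- a2 + i * a3)"
      using dvd_cross[OF c(2,3,1)] dvd_cross[OF c(2,4,1)] .
    then have "p dvd - (r * (a2 + i * a3) - s * (a0 + i * a1))" "p dvd r * (a0 - i * a1) - s * (- a2 + i * a3)"
      by (simp_all only: dvd_minus_iff)
    then show ?thesis by (simp add: annih_def qconj_def a' algebra_simps)
  qed
  have "\<not> (p dvd w0 + i * w1 \<and> p dvd - w2 + i * w3) \<or> \<not> (p dvd w2 + i * w3 \<and> p dvd w0 - i * w1)"
    using qdvd_if_matrix_zero[of w0 w1 w2 w3] W w by auto
  then have "annih p i r s (qconj a)"
  proof
    assume "\<not> (p dvd w0 + i * w1 \<and> p dvd - w2 + i * w3)"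
    then show ?thesis by (rule col) (use anw prod in \<open>simp_all only: mult.commute[of _ r] mult.commute[of _ s]\<close>)
  next
    assume "\<not> (p dvd w2 + i * w3 \<and> p dvd w0 - i * w1)"
    then show ?thesis by (rule col) (use anw prod in \<open>simp_all only: mult.commute[of _ r] mult.commute[of _ s]\<close>)
  qed
  then show ?thesis
    using quat_set_eq_if_annih[OF p b qconj_quat_set[OF a] rs(1) _ rs(2)] by blast
qed

text \<open>With the tail primitive by induction, prepending a letter can create a factor
  \<open>p\<close> only by cancelling against the next letter.\<close>

lemma reduced_primitive:
  assumes p: "p = int p0"
  shows "set l \<subseteq> quat_set p0 \<Longrightarrow> reduced l \<Longrightarrow> \<not> qdvd p (qprod l)"
proof (induction l rule: induct_list012)
  case 1
  then show ?case using p_not_dvd_1 by (simp add: qdvd_def)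
next
  case (2 a)
  then have "qmul a (1, 0, 0, 0) = a" by (cases a) (simp add: qmul_def)
  then show ?case using 2 not_qdvd_if_qnorm[of a] qnorm_quat_set[of a p0] p by simp
next
  case (3 a b l)
  then have "\<not> qdvd p (qmul b (qprod l))" by simp
  then show ?case using qconj_eq_if_not_primitive[OF p, of a b "qprod l"] 3 by auto
qed

text \<open>A real quaternion \<open>w0\<close> would satisfy \<open>w0^2 = p ^ length l\<close>
  with positive exponent, so \<open>p\<close> would divide \<open>w0\<close> and with it the whole
  product, contrary to primitivity.\<close>

lemma reduced_imaginary_part:
  assumes p: "p = int p0" and l: "set l \<subseteq> quat_set p0" "reduced l" "l \<noteq> []"
    and w: "qprod l = (w0, w1, w2, w3)"
  shows "w1\<^sup>2 + w2\<^sup>2 + w3\<^sup>2 > 0"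
proof (rule ccontr)
  assume "\<not> ?thesis"
  moreover have "w1\<^sup>2 \<ge> 0" "w2\<^sup>2 \<ge> 0" "w3\<^sup>2 \<ge> 0" by auto
  ultimately have "w1\<^sup>2 = 0" "w2\<^sup>2 = 0" "w3\<^sup>2 = 0" by linarith+
  then have z: "w1 = 0" "w2 = 0" "w3 = 0" by auto
  have "qnorm (qprod l) = p ^ length l"
    using l(1) qnorm_quat_set p by (intro qnorm_qprod) auto
  then have "w0\<^sup>2 = p ^ length l" by (simp add: w z qnorm_def)
  then have "p dvd w0\<^sup>2" using l(3) by (cases l) auto
  then have "p dvd w0" using prime_p prime_dvd_power by blast
  then have "qdvd p (qprod l)" by (simp add: w z qdvd_def)
  then show False using reduced_primitive[OF p l(1,2)] by blast
qed

end

section \<open>The number of quaternions of norm \<open>p\<close>\<close>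

text \<open>An odd modulus makes the bound strict, so that a descent step really lowers the
  multiplier. Even multipliers are halved by \<open>even_norm_divisible\<close> instead.\<close>

lemma balanced_residue:
  fixes m x :: int
  assumes "odd m" "m > 0"
  obtains y where "m dvd x - y" "4 * y\<^sup>2 < m\<^sup>2"
proof -
  define r where "r = x mod m"
  define y where "y = (if 2 * r < m then r else r - m)"
  have "0 \<le> r" "r < m" using assms(2) by (auto simp: r_def)
  then have "\<bar>2 * y\<bar> < m" using assms unfolding y_def by presburger
  then have "(2 * y)\<^sup>2 < m\<^sup>2" by (intro power2_strict_mono) auto
  moreover have "m dvd x - y"
  proof -
    have "m dvd x - x mod m" by (simp add: minus_mod_eq_mult_div)
    then have "m dvd x - x mod m + m" by simp
    then show ?thesis using \<open>m dvd x - x mod m\<close> by (auto simp: y_def r_def algebra_simps)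
  qed
  ultimately show ?thesis using that by (simp add: power_mult_distrib)
qed

lemma balanced_quaternion:
  fixes m :: int
  assumes "odd m" "m > 0"
  obtains b0 b1 b2 b3 where "qdvd m (a0 - b0, a1 - b1, a2 - b2, a3 - b3)" "qnorm (b0, b1, b2, b3) < m\<^sup>2"
proof -
  obtain b0 b1 b2 b3 where "m dvd a0 - b0" "m dvd a1 - b1" "m dvd a2 - b2" "m dvd a3 - b3"
    and "4 * b0\<^sup>2 < m\<^sup>2" "4 * b1\<^sup>2 < m\<^sup>2" "4 * b2\<^sup>2 < m\<^sup>2" "4 * b3\<^sup>2 < m\<^sup>2"
    using balanced_residue[OF assms] by metis
  then show ?thesis using that[of b0 b1 b2 b3] by (auto simp: qdvd_def qnorm_def)
qed

text \<open>An even norm means an even number of odd coordinates, so the coordinates fall into two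
  pairs of equal parity. The pairing tells which of \<open>1 + i\<close>, \<open>1 + j\<close>,
  \<open>1 + k\<close> makes the product divisible by 2.\<close>

lemma even_norm_divisible:
  assumes "even (qnorm v)"
  obtains u w where "qnorm u = 2" "qmul v u = qscale 2 w"
proof -
  obtain a b c d where v: "v = (a, b, c, d)" by (cases v)
  have "even (a\<^sup>2 + b\<^sup>2 + c\<^sup>2 + d\<^sup>2)" using assms by (simp add: v qnorm_def)
  then consider "even (a + b)" "even (c + d)" | "even (a + c)" "even (b + d)" | "even (a + d)" "even (b + c)"
    by (cases "even a"; cases "even b"; cases "even c"; cases "even d"; simp)
  then show ?thesis
  proof cases
    case 1
    have "qdvd 2 (qmul v (1, 1, 0, 0))" using 1 by (auto simp: v qdvd_def qmul_def)
    then show ?thesis using that[of "(1, 1, 0, 0)"] by (auto simp: qdvd_iff qnorm_def)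
  next
    case 2
    have "qdvd 2 (qmul v (1, 0, 1, 0))" using 2 by (auto simp: v qdvd_def qmul_def)
    then show ?thesis using that[of "(1, 0, 1, 0)"] by (auto simp: qdvd_iff qnorm_def)
  next
    case 3
    have "qdvd 2 (qmul v (1, 0, 0, 1))" using 3 by (auto simp: v qdvd_def qmul_def)
    then show ?thesis using that[of "(1, 0, 0, 1)"] by (auto simp: qdvd_iff qnorm_def)
  qed
qed

text \<open>Modulo \<open>m\<close> the first factor may be replaced by the second quaternion, whose
  product with its conjugate is its norm, a multiple of \<open>m\<close>.\<close>

lemma qmul_qconj_congruent:
  assumes "qdvd m (a0 - b0, a1 - b1, a2 - b2, a3 - b3)" "m dvd qnorm (b0, b1, b2, b3)"
  shows "qdvd m (qmul (a0, a1, a2, a3) (qconj (b0, b1, b2, b3)))"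
proof -
  obtain e0 e1 e2 e3 where "a0 - b0 = m * e0" "a1 - b1 = m * e1" "a2 - b2 = m * e2" "a3 - b3 = m * e3"
    using assms(1) by (auto simp: qdvd_def dvd_def)
  then have e: "a0 = b0 + m * e0" "a1 = b1 + m * e1" "a2 = b2 + m * e2" "a3 = b3 + m * e3" by auto
  have n: "m dvd b0\<^sup>2 + b1\<^sup>2 + b2\<^sup>2 + b3\<^sup>2" using assms(2) by (simp add: qnorm_def)
  have "m dvd (b0\<^sup>2 + b1\<^sup>2 + b2\<^sup>2 + b3\<^sup>2) + m * (e0 * b0 + e1 * b1 + e2 * b2 + e3 * b3)"
    using n by simp
  moreover have "m dvd m * (- e0 * b1 + e1 * b0 - e2 * b3 + e3 * b2)"
    "m dvd m * (- e0 * b2 + e1 * b3 + e2 * b0 - e3 * b1)"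
    "m dvd m * (- e0 * b3 - e1 * b2 + e2 * b1 + e3 * b0)" by simp_all
  ultimately show ?thesis
    by (simp add: e qmul_def qconj_def qdvd_def algebra_simps power2_eq_square)
qed

lemma qdvd_imp_dvd_qnorm: "qdvd m a \<Longrightarrow> m\<^sup>2 dvd qnorm a"
  by (auto simp: qdvd_iff qnorm_qscale)

lemma dvd_qnorm_cong:
  assumes "qdvd m (a0 - b0, a1 - b1, a2 - b2, a3 - b3)" "m dvd qnorm (a0, a1, a2, a3)"
  shows "m dvd qnorm (b0, b1, b2, b3)"
proof -
  have "m dvd qnorm (a0, a1, a2, a3) - ((a0 - b0) * (a0 + b0) + (a1 - b1) * (a1 + b1)
      + (a2 - b2) * (a2 + b2) + (a3 - b3) * (a3 + b3))"
    using assms by (intro dvd_diff) (auto simp: qdvd_def)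
  then show ?thesis by (simp add: qnorm_def algebra_simps power2_eq_square)
qed

lemma qnorm_zero_iff: "qnorm a = 0 \<longleftrightarrow> a = (0, 0, 0, 0)"
proof (cases a)
  case (fields a0 a1 a2 a3)
  have "a0\<^sup>2 \<ge> 0" "a1\<^sup>2 \<ge> 0" "a2\<^sup>2 \<ge> 0" "a3\<^sup>2 \<ge> 0" by auto
  then have "a0\<^sup>2 + a1\<^sup>2 + a2\<^sup>2 + a3\<^sup>2 = 0 \<longleftrightarrow> a0\<^sup>2 = 0 \<and> a1\<^sup>2 = 0 \<and> a2\<^sup>2 = 0 \<and> a3\<^sup>2 = 0" by linarith
  then show ?thesis by (simp add: fields qnorm_def)
qed

lemma one_true_of_four:
  assumes "((if b0 then 0 else 1) + (if b1 then 0 else 1) + (if b2 then 0 else 1) + (if b3 then 0 else 1)) mod 4 = (1::int)"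
  shows "\<not> b0 \<and> b1 \<and> b2 \<and> b3 \<or> b0 \<and> \<not> b1 \<and> b2 \<and> b3 \<or> b0 \<and> b1 \<and> \<not> b2 \<and> b3 \<or> b0 \<and> b1 \<and> b2 \<and> \<not> b3"
  using assms by (cases b0; cases b1; cases b2; cases b3) simp_all

text \<open>Squares are 0 or 1 modulo 4, so exactly one coordinate is odd. One of the eight units
  moves it to the real place and makes it positive. The unit stands on the right because right
  multiplication preserves \<open>annih\<close>.\<close>

lemma unit_multiple_in_quat_set:
  assumes "qnorm a = int n" "[n = 1] (mod 4)"
  obtains u where "qmul a u \<in> quat_set n"
proof -
  obtain a0 a1 a2 a3 where a: "a = (a0, a1, a2, a3)" by (cases a)
  have n: "a0\<^sup>2 + a1\<^sup>2 + a2\<^sup>2 + a3\<^sup>2 = int n" using assms(1) by (simp add: a qnorm_def)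
  have sq: "x\<^sup>2 mod 4 = (if even x then 0 else 1)" for x :: int
  proof (cases "even x")
    case True
    then obtain y where "x = 2 * y" by blast
    then show ?thesis by (simp add: power_mult_distrib)
  next
    case False
    then obtain y where "x = 2 * y + 1" by (auto elim: oddE)
    then have "x\<^sup>2 = 4 * (y\<^sup>2 + y) + 1" by (simp add: power2_eq_square algebra_simps)
    then show ?thesis using False by presburger
  qed
  have mod_add4: "(A mod 4 + B mod 4 + C mod 4 + D mod 4) mod 4 = (A + B + C + D) mod 4" for A B C D :: int
    by (intro mod_add_cong mod_mod_trivial)
  have "n mod 4 = 1" using assms(2) by (simp add: cong_def)
  then have "int n mod 4 = 1" by presburger
  then have "(a0\<^sup>2 mod 4 + a1\<^sup>2 mod 4 + a2\<^sup>2 mod 4 + a3\<^sup>2 mod 4) mod 4 = 1"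
    using n mod_add4 by simp
  then have "odd a0 \<and> even a1 \<and> even a2 \<and> even a3 \<or> even a0 \<and> odd a1 \<and> even a2 \<and> even a3
    \<or> even a0 \<and> even a1 \<and> odd a2 \<and> even a3 \<or> even a0 \<and> even a1 \<and> even a2 \<and> odd a3"
    unfolding sq by (rule one_true_of_four)
  then consider "odd a0" "even a1" "even a2" "even a3" | "even a0" "odd a1" "even a2" "even a3"
    | "even a0" "even a1" "odd a2" "even a3" | "even a0" "even a1" "even a2" "odd a3" by blast
  then show ?thesis
  proof cases
    case 1
    then have "a0 > 0 \<or> - a0 > 0" by (cases "a0 = 0") auto
    then show ?thesis
    proof
      assume "a0 > 0"
      then show ?thesis by (intro that[of "(1, 0, 0, 0)"]) (use 1 n in \<open>simp add: a qmul_def quat_set_def\<close>)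
    next
      assume "- a0 > 0"
      then show ?thesis by (intro that[of "(-1, 0, 0, 0)"]) (use 1 n in \<open>simp add: a qmul_def quat_set_def\<close>)
    qed
  next
    case 2
    then have "a1 > 0 \<or> - a1 > 0" by (cases "a1 = 0") auto
    then show ?thesis
    proof
      assume "a1 > 0"
      then show ?thesis by (intro that[of "(0, -1, 0, 0)"]) (use 2 n in \<open>simp add: a qmul_def quat_set_def\<close>)
    next
      assume "- a1 > 0"
      then show ?thesis by (intro that[of "(0, 1, 0, 0)"]) (use 2 n in \<open>simp add: a qmul_def quat_set_def\<close>)
    qed
  next
    case 3
    then have "a2 > 0 \<or> - a2 > 0" by (cases "a2 = 0") auto
    then show ?thesis
    proof
      assume "a2 > 0"
      then show ?thesis by (intro that[of "(0, 0, -1, 0)"]) (use 3 n in \<open>simp add: a qmul_def quat_set_def\<close>)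
    next
      assume "- a2 > 0"
      then show ?thesis by (intro that[of "(0, 0, 1, 0)"]) (use 3 n in \<open>simp add: a qmul_def quat_set_def\<close>)
    qed
  next
    case 4
    then have "a3 > 0 \<or> - a3 > 0" by (cases "a3 = 0") auto
    then show ?thesis
    proof
      assume "a3 > 0"
      then show ?thesis by (intro that[of "(0, 0, 0, -1)"]) (use 4 n in \<open>simp add: a qmul_def quat_set_def\<close>)
    next
      assume "- a3 > 0"
      then show ?thesis by (intro that[of "(0, 0, 0, 1)"]) (use 4 n in \<open>simp add: a qmul_def quat_set_def\<close>)
    qed
  qed
qed

context split_prime
begin

text \<open>Lagrange's four-square descent: right multiplication preserves \<open>annih\<close>, so the descent
  stays among the quaternions annihilated by the given row.\<close>

lemma annih_descent:
  assumes "0 < m" "int m < p" "annih p i r s v" "qnorm v = int m * p"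
  shows "\<exists>a. annih p i r s a \<and> qnorm a = p"
  using assms
proof (induction m arbitrary: v rule: less_induct)
  case (less m)
  note prems = less.prems
  consider "m = 1" | "even m" | "odd m" "m > 1" using prems(1) by (cases "m = 1") (auto simp: Suc_lessI)
  then show ?case
  proof cases
    case 1
    then show ?thesis using prems by (intro exI[of _ v]) simp
  next
    case 2
    then obtain k where k: "m = 2 * k" by blast
    then have "even (qnorm v)" using prems(4) by simp
    then obtain u w where u: "qnorm u = 2" "qmul v u = qscale 2 w"
      by (rule even_norm_divisible)
    have "annih p i r s w"
      using annih_qmul[OF prems(3), of u] annih_qscale_iff[of 2] odd_p u(2) by simp
    moreover have "qnorm w = int k * p"
    proof -
      have "qnorm v * 2 = 4 * qnorm w"
        using arg_cong[OF u(2), of qnorm] by (simp add: qnorm_qmul qnorm_qscale u(1))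
      then show ?thesis using prems(4) k by simp
    qed
    ultimately show ?thesis using less.IH[of k w] prems k by auto
  next
    case 3
    obtain v0 v1 v2 v3 where v: "v = (v0, v1, v2, v3)" by (cases v)
    obtain y0 y1 y2 y3 where y: "qdvd (int m) (v0 - y0, v1 - y1, v2 - y2, v3 - y3)"
        "qnorm (y0, y1, y2, y3) < (int m)\<^sup>2"
    proof -
      have "odd (int m)" "int m > 0" using 3 by auto
      then show ?thesis using that by (rule balanced_quaternion)
    qed
    define y where "y = (y0, y1, y2, y3)"
    have m: "int m dvd qnorm y"
      using dvd_qnorm_cong[OF y(1)] prems(4) by (simp add: v y_def)
    \<comment> \<open>The descent step: \<open>v\<close> times the conjugate of its balanced residue
      \<open>y\<close> is divisible by \<open>m\<close>, and the quotient \<open>z\<close> has norm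
      \<open>k' * p\<close> with \<open>k' < m\<close>.\<close>
    then obtain z where z: "qmul v (qconj y) = qscale (int m) z"
      using qmul_qconj_congruent[OF y(1)] by (auto simp: qdvd_iff v y_def)
    obtain k' where k': "qnorm y = int m * k'" using m by (auto simp: dvd_def)
    have mpos: "int m > 0" using prems by simp
    have "k' \<ge> 0" using k' qnorm_nonneg[of y] mpos by (simp add: zero_le_mult_iff)
    moreover have km: "k' < int m" using y(2) k' mpos by (simp add: y_def power2_eq_square)
    \<comment> \<open>Otherwise \<open>m\<close> divides every coordinate of \<open>v\<close>, so
      \<open>m^2\<close> divides \<open>m * p\<close> and \<open>m\<close> divides the prime
      \<open>p\<close>, against \<open>1 < m < p\<close>.\<close>
    moreover have "k' \<noteq> 0"
    proof
      assume "k' = 0"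
      then have "y = (0, 0, 0, 0)" using k' by (simp add: qnorm_zero_iff)
      then have "(int m)\<^sup>2 dvd int m * p" using qdvd_imp_dvd_qnorm[OF y(1)] prems(4) v by (simp add: y_def)
      then have "int m dvd p" using mpos by (simp add: power2_eq_square)
      moreover have "\<forall>k. k \<ge> 0 \<and> k dvd p \<longrightarrow> k = 1 \<or> k = p"
        using prime_p by (simp add: prime_int_iff)
      ultimately have "int m = 1 \<or> int m = p" using of_nat_0_le_iff by blast
      then show False using 3 prems by auto
    qed
    ultimately have "k' = int (nat k')" "0 < nat k'" "nat k' < m" by auto
    then obtain k where k: "k' = int k" "0 < k" "k < m" by blast
    have cop: "coprime p (int m)"
      using prime_p prems(1,2) by (intro prime_imp_coprime) (auto dest: zdvd_imp_le)
    have "annih p i r s z"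
      using annih_qmul[OF prems(3), of "qconj y"] annih_qscale_iff[OF cop] z by simp
    moreover have "qnorm z = int k * p"
    proof -
      have "(int m)\<^sup>2 * qnorm z = (int m)\<^sup>2 * (k' * p)"
        using arg_cong[OF z, of qnorm] by (auto simp: qnorm_qmul qnorm_qscale prems k' power2_eq_square algebra_simps)
      then show ?thesis using mpos k by auto
    qed
    ultimately show ?thesis using less.IH[of k z] k prems by auto
  qed
qed

lemma exists_annih_quat_set:
  assumes p: "p = int p0" and p1: "[p0 = 1] (mod 4)" and rs: "\<not> (p dvd r \<and> p dvd s)"
  obtains a where "a \<in> quat_set p0" "annih p i r s a"
proof -
  \<comment> \<open>\<open>h\<close> is the inverse of 2 modulo \<open>p\<close>, needed to recover
    a quaternion from the entries of its matrix.\<close>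
  obtain h where h: "p = 2 * h - 1" using odd_p by (metis add_diff_cancel_right' oddE one_add_one add.assoc mult_2 distrib_left mult.right_neutral)
  have p_pos: "p > 0" using p_gt_1 by simp
  have ph: "\<not> p dvd h"
  proof
    assume "p dvd h"
    then have "p dvd 2 * h - p" by simp
    then show False using h p_not_dvd_1 by simp
  qed
  \<comment> \<open>Modulo \<open>p\<close> this quaternion has a matrix with first column
    \<open>(-s, r)\<close> and second column zero, which \<open>(r, s)\<close> kills by
    construction.\<close>
  have an: "annih p i r s (- s * h, s * i * h, - r * h, - r * i * h)"
  proof -
    have "r * (- s * h + i * (s * i * h)) + s * (- (- r * h) + i * (- r * i * h)) = 0"
      by (simp add: algebra_simps)
    moreover have "r * (- r * h + i * (- r * i * h)) + s * (- s * h - i * (s * i * h))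
        = (i\<^sup>2 + 1) * (- h * (r\<^sup>2 + s\<^sup>2))"
      by (simp add: algebra_simps power2_eq_square)
    ultimately show ?thesis unfolding annih_def case_prod_conv using dvd_mult2[OF i_square] by (metis dvd_0_right)
  qed
  \<comment> \<open>Balanced residues keep the norm below \<open>p^2\<close>, so it equals
    \<open>k' * p\<close> with \<open>k' < p\<close>, as the descent requires.\<close>
  obtain y0 y1 y2 y3 where y: "qdvd p (- s * h - y0, s * i * h - y1, - r * h - y2, - r * i * h - y3)"
        "qnorm (y0, y1, y2, y3) < p\<^sup>2"
    using balanced_quaternion[OF odd_p p_pos, of "- s * h" "s * i * h" "- r * h" "- r * i * h"] by blast
  define y where "y = (y0, y1, y2, y3)"
  have any: "annih p i r s y" unfolding y_def by (rule annih_cong[OF y(1) an])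
  have "p dvd (i\<^sup>2 + 1) * (h\<^sup>2 * (r\<^sup>2 + s\<^sup>2))" using i_square by (rule dvd_mult2)
  then have "p dvd qnorm (- s * h, s * i * h, - r * h, - r * i * h)"
    by (simp add: qnorm_def algebra_simps power2_eq_square)
  then have "p dvd qnorm y" unfolding y_def by (rule dvd_qnorm_cong[OF y(1)])
  then obtain k' where k': "qnorm y = k' * p" by (metis dvd_div_mult_self)
  have "k' \<ge> 0" using k' qnorm_nonneg[of y] p_gt_1 by (simp add: zero_le_mult_iff)
  moreover have "k' < p" using y(2) k' p_gt_1 by (simp add: y_def power2_eq_square)
  moreover have "k' \<noteq> 0"
  proof
    assume "k' = 0"
    then have "y = (0, 0, 0, 0)" using k' by (simp add: qnorm_zero_iff)
    then have "p dvd s * h" "p dvd r * h" using y(1) by (auto simp: y_def qdvd_def)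
    then show False using ph rs prime_dvd_mult_iff[OF prime_p] by blast
  qed
  ultimately obtain a where a: "annih p i r s a" "qnorm a = p"
    using annih_descent[of "nat k'" r s y] any k' by auto
  then obtain u where "qmul a u \<in> quat_set p0" using unit_multiple_in_quat_set[OF _ p1, of a] p by metis
  then show ?thesis using that annih_qmul[OF a(1)] by blast
qed

text \<open>Taking the kernel is a bijection onto the \<open>p + 1\<close> points of the projective
  line: descent realises every point, and \<open>quat_set_eq_if_annih\<close> says that a point is
  realised only once.\<close>

lemma card_quat_set:
  assumes p: "p = int p0" and p1: "[p0 = 1] (mod 4)"
  shows "card (quat_set p0) = p0 + 1"
proof -
  have "\<exists>a. a \<in> quat_set p0 \<and> annih p i (lineR t) (lineS t) a" for t
    using exists_annih_quat_set[OF p p1 line_nonzero] by blast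
  then obtain f where f: "f t \<in> quat_set p0" "annih p i (lineR t) (lineS t) (f t)" for t
    by metis
  have "bij_betw f {0..p} (quat_set p0)"
    unfolding bij_betw_def
  proof
    show "inj_on f {0..p}"
    proof (rule inj_onI)
      fix t u assume "t \<in> {0..p}" "u \<in> {0..p}" "f t = f u"
      then show "t = u" using annih_line_unique[of "f t" t u] f[of t] f[of u] qnorm_quat_set[of "f t"] p by auto
    qed
    show "f ` {0..p} = quat_set p0"
    proof (intro subset_antisym subsetI)
      fix a assume a: "a \<in> quat_set p0"
      then obtain t where t: "t \<in> {0..p}" "annih p i (lineR t) (lineS t) a"
        using exists_annih_line[of a] qnorm_quat_set p by auto
      then have "a = f t" using quat_set_eq_if_annih[OF p a f(1) t(2) f(2) line_nonzero] by blast
      then show "a \<in> f ` {0..p}" using t by blast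
    qed (use f in auto)
  qed
  then have "card (quat_set p0) = card {0..p}" by (rule bij_betw_same_card[symmetric])
  then show ?thesis using p by simp
qed

end

section \<open>Projective linear groups over residue rings\<close>

text \<open>Matrix identities are proved over the integers, where \<open>algebra_simps\<close>
  applies, and then reduced modulo \<open>n\<close> once by \<open>mred\<close>.\<close>

definition imul :: "int mat2 \<Rightarrow> int mat2 \<Rightarrow> int mat2" where
  "imul = (\<lambda>(a, b, c, d) (a', b', c', d').
     (a * a' + b * c', a * b' + b * d', c * a' + d * c', c * b' + d * d'))"

definition idet :: "int mat2 \<Rightarrow> int" where
  "idet = (\<lambda>(a, b, c, d). a * d - b * c)"

definition mred :: "int \<Rightarrow> int mat2 \<Rightarrow> int mat2" where
  "mred n = (\<lambda>(a, b, c, d). (a mod n, b mod n, c mod n, d mod n))"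

definition qmat :: "int \<Rightarrow> quat \<Rightarrow> int mat2" where
  "qmat \<beta> = (\<lambda>(a0, a1, a2, a3). (a0 + \<beta> * a1, a2 + \<beta> * a3, - a2 + \<beta> * a3, a0 - \<beta> * a1))"

lemma imul_assoc: "imul (imul x y) z = imul x (imul y z)"
  by (cases x; cases y; cases z) (simp add: imul_def algebra_simps)

lemma idet_imul: "idet (imul x y) = idet x * idet y"
  by (cases x; cases y) (simp add: imul_def idet_def algebra_simps)

lemma mred_imul_left [simp]: "mred n (imul (mred n x) y) = mred n (imul x y)"
  unfolding imul_def mred_def split_beta fst_conv snd_conv prod.inject
  by (intro conjI mod_add_cong mod_mult_cong mod_mod_trivial refl)

lemma mred_imul_right [simp]: "mred n (imul x (mred n y)) = mred n (imul x y)"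
  unfolding imul_def mred_def split_beta fst_conv snd_conv prod.inject
  by (intro conjI mod_add_cong mod_mult_cong mod_mod_trivial refl)

lemma idet_mred: "idet (mred n x) mod n = idet x mod n"
  unfolding idet_def mred_def split_beta fst_conv snd_conv
  by (intro mod_diff_cong mod_mult_cong mod_mod_trivial)

lemma quat_mod_eq: "quat_mod p1 \<beta> a = PGL2_class (residue_ring (int p1)) (mred (int p1) (qmat \<beta> a))"
  by (cases a) (simp add: quat_mod_def mred_def qmat_def)

locale pgl_mod =
  fixes p1 :: nat and n :: int and R :: "int ring"
  assumes prime_p1: "prime p1"
  defines "n \<equiv> int p1" and "R \<equiv> residue_ring (int p1)"
begin

lemma prime_n: "prime n" and n_gt_1: "n > 1"
  using prime_p1 prime_gt_1_nat by (auto simp: n_def)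

lemma R_simps: "carrier R = {0..n - 1}" "monoid.mult R x y = (x * y) mod n" "one R = 1" "zero R = 0"
  "add R x y = (x + y) mod n"
  by (simp_all add: R_def n_def residue_ring_def)

sublocale residues n R
  by unfold_locales (use n_gt_1 in \<open>simp_all add: n_def R_def\<close>)

lemma Mat2_simps:
  "carrier (Mat2 R) = {0..n - 1} \<times> {0..n - 1} \<times> {0..n - 1} \<times> {0..n - 1}"
  "monoid.mult (Mat2 R) x y = mred n (imul x y)"
  "one (Mat2 R) = (1, 0, 0, 1)"
  by (cases x; cases y; simp add: Mat2_def R_simps mred_def imul_def mod_simps)+

lemma mred_carrier: "mred n x \<in> carrier (Mat2 R)"
  using n_gt_1 by (cases x) (simp add: Mat2_simps mred_def)

lemma mred_id: "x \<in> carrier (Mat2 R) \<Longrightarrow> mred n x = x"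
  by (cases x) (auto simp: Mat2_simps mred_def)

lemma monoid_Mat2: "monoid (Mat2 R)"
proof
  fix x assume "x \<in> carrier (Mat2 R)"
  then show "\<one>\<^bsub>Mat2 R\<^esub> \<otimes>\<^bsub>Mat2 R\<^esub> x = x" "x \<otimes>\<^bsub>Mat2 R\<^esub> \<one>\<^bsub>Mat2 R\<^esub> = x"
    using mred_id[of x] by (cases x; simp add: Mat2_simps(2,3) imul_def)+
qed (use n_gt_1 in \<open>simp_all add: Mat2_simps(2) mred_carrier imul_assoc\<close>, simp add: Mat2_simps)

lemma GL2_simps: "carrier (GL2 R) = Units (Mat2 R)" "monoid.mult (GL2 R) x y = mred n (imul x y)"
  "one (GL2 R) = (1, 0, 0, 1)"
  by (simp_all add: GL2_def units_of_def Mat2_simps)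

lemma group_GL2: "group (GL2 R)"
  unfolding GL2_def by (rule monoid.units_group[OF monoid_Mat2])

sublocale GL: group "GL2 R"
  by (rule group_GL2)

lemma GL2_sub_Mat2: "x \<in> carrier (GL2 R) \<Longrightarrow> x \<in> carrier (Mat2 R)"
  by (simp add: GL2_simps Units_def)

lemma mred_in_GL2:
  assumes "coprime (idet x) n" shows "mred n x \<in> carrier (GL2 R)"
proof -
  obtain a b c d where x: "x = (a, b, c, d)" by (cases x)
  obtain u where "[idet x * u = 1] (mod n)" using cong_solve_coprime_int[OF assms] by blast
  then have u: "(a * d - b * c) * u mod n = 1"
    using n_gt_1 by (simp add: cong_def idet_def x)
  \<comment> \<open>The adjugate times \<open>u\<close>, the inverse of the determinant.\<close>
  define y where "y = (d * u, - b * u, - c * u, a * u)"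
  have "imul x y = ((a * d - b * c) * u, 0, 0, (a * d - b * c) * u)"
    "imul y x = ((a * d - b * c) * u, 0, 0, (a * d - b * c) * u)"
    by (simp_all add: x y_def imul_def algebra_simps)
  then have "mred n (imul x y) = (1, 0, 0, 1)" "mred n (imul y x) = (1, 0, 0, 1)"
    using u by (simp_all add: mred_def)
  then show ?thesis unfolding GL2_simps Units_def
    by (auto simp: Mat2_simps(2,3) mred_carrier intro!: bexI[of _ "mred n y"])
qed

lemma Units_R: "Units R = {x. 0 < x \<and> x < n \<and> coprime x n}"
  by (rule res_units_eq)

lemma scalars2_eq: "scalars2 R = {(c, 0, 0, c) | c. 0 < c \<and> c < n}"
proof -
  have "coprime c n" if "0 < c" "c < n" for c
    using that prime_n by (metis coprime_commute prime_imp_coprime zdvd_not_zless)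
  then show ?thesis by (auto simp: scalars2_def Units_R R_simps)
qed

lemma scalar_in_GL2: "x \<in> scalars2 R \<Longrightarrow> x \<in> carrier (GL2 R)"
proof -
  assume "x \<in> scalars2 R"
  then obtain c where c: "x = (c, 0, 0, c)" "0 < c" "c < n" by (auto simp: scalars2_eq)
  then have "coprime c n" using prime_n by (metis coprime_commute prime_imp_coprime zdvd_not_zless)
  then have "mred n x \<in> carrier (GL2 R)" by (intro mred_in_GL2) (simp add: c idet_def)
  then show ?thesis using c by (simp add: mred_def)
qed

lemma mred_scalar: "\<not> n dvd c \<Longrightarrow> mred n (c, 0, 0, c) \<in> scalars2 R"
proof -
  assume "\<not> n dvd c"
  then have "c mod n \<noteq> 0" by (simp add: dvd_eq_mod_eq_0)
  moreover have "0 \<le> c mod n" "c mod n < n" using n_gt_1 by simp_all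
  ultimately show ?thesis by (simp add: scalars2_eq mred_def)
qed

lemma scalars2_subgroup: "subgroup (scalars2 R) (GL2 R)"
proof (rule GL.subgroupI)
  show "scalars2 R \<noteq> {}" using n_gt_1 by (auto simp: scalars2_eq intro!: exI[of _ 1])
next
  fix x y assume "x \<in> scalars2 R" "y \<in> scalars2 R"
  then obtain c d where *: "x = (c, 0, 0, c)" "0 < c" "c < n" "y = (d, 0, 0, d)" "0 < d" "d < n"
    by (auto simp: scalars2_eq)
  have "\<not> n dvd c * d" using * prime_n by (auto simp: prime_dvd_mult_iff dest: zdvd_imp_le)
  then show "x \<otimes>\<^bsub>GL2 R\<^esub> y \<in> scalars2 R"
    using mred_scalar[of "c * d"] by (simp add: GL2_simps * imul_def)
next
  fix x assume x: "x \<in> scalars2 R"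
  then obtain c where c: "x = (c, 0, 0, c)" "0 < c" "c < n" by (auto simp: scalars2_eq)
  then have "coprime c n" using prime_n by (metis coprime_commute prime_imp_coprime zdvd_not_zless)
  then obtain u where u: "[c * u = 1] (mod n)" using cong_solve_coprime_int by blast
  have "\<not> n dvd u"
  proof
    assume "n dvd u"
    then have "c * u mod n = 0" by simp
    then show False using u n_gt_1 by (simp add: cong_def)
  qed
  then have *: "mred n (u, 0, 0, u) \<in> scalars2 R" by (rule mred_scalar)
  have "mred n (u, 0, 0, u) \<otimes>\<^bsub>GL2 R\<^esub> x = \<one>\<^bsub>GL2 R\<^esub>"
    using u n_gt_1 by (simp add: GL2_simps c imul_def mred_def cong_def mult.commute mod_mult_right_eq)
  then have "inv\<^bsub>GL2 R\<^esub> x = mred n (u, 0, 0, u)"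
    using GL.inv_equality scalar_in_GL2 x * by blast
  then show "inv\<^bsub>GL2 R\<^esub> x \<in> scalars2 R" using * by simp
qed (use scalar_in_GL2 in blast)

lemma scalars2_central:
  assumes "x \<in> scalars2 R" shows "x \<otimes>\<^bsub>GL2 R\<^esub> y = y \<otimes>\<^bsub>GL2 R\<^esub> x"
  using assms by (cases y) (auto simp: scalars2_eq GL2_simps imul_def algebra_simps)

lemma scalars2_normal: "scalars2 R \<lhd> GL2 R"
proof (rule GL.normal_inv_iff[THEN iffD2], intro conjI ballI scalars2_subgroup)
  fix x h assume x: "x \<in> carrier (GL2 R)" and h: "h \<in> scalars2 R"
  have "x \<otimes>\<^bsub>GL2 R\<^esub> h \<otimes>\<^bsub>GL2 R\<^esub> inv\<^bsub>GL2 R\<^esub> x = h \<otimes>\<^bsub>GL2 R\<^esub> x \<otimes>\<^bsub>GL2 R\<^esub> inv\<^bsub>GL2 R\<^esub> x"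
    by (simp only: scalars2_central[OF h])
  also have "\<dots> = h" using x scalar_in_GL2[OF h] by (simp add: GL.m_assoc)
  finally show "x \<otimes>\<^bsub>GL2 R\<^esub> h \<otimes>\<^bsub>GL2 R\<^esub> inv\<^bsub>GL2 R\<^esub> x \<in> scalars2 R" using h by simp
qed

sublocale N: normal "scalars2 R" "GL2 R"
  by (rule scalars2_normal)

lemma group_PGL2: "group (PGL2 R)"
  unfolding PGL2_def by (rule N.factorgroup_is_group)

sublocale PG: group "PGL2 R"
  by (rule group_PGL2)

lemma class_hom: "PGL2_class R \<in> hom (GL2 R) (PGL2 R)"
  using N.r_coset_hom_Mod by (simp add: PGL2_class_def[abs_def] PGL2_def)

lemma class_one_iff: "x \<in> carrier (GL2 R) \<Longrightarrow> PGL2_class R x = \<one>\<^bsub>PGL2 R\<^esub> \<longleftrightarrow> x \<in> scalars2 R"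
  unfolding PGL2_class_def PGL2_def one_FactGroup
  using GL.coset_join1[OF _ _ scalars2_subgroup, of x] GL.coset_join2[OF _ scalars2_subgroup, of x] by blast

lemma carrier_PGL2: "carrier (PGL2 R) = PGL2_class R ` carrier (GL2 R)"
  by (simp add: PGL2_def carrier_FactGroup PGL2_class_def[abs_def])

lemma det2_eq: "det2 R x = idet x mod n"
  by (cases x) (simp add: det2_def idet_def a_minus_def res_neg_eq R_simps mod_simps)

lemma SL2_iff: "x \<in> SL2 R \<longleftrightarrow> x \<in> carrier (GL2 R) \<and> idet x mod n = 1"
  by (simp add: SL2_def det2_eq R_simps)

lemma SL2_subgroup: "subgroup (SL2 R) (GL2 R)"
proof (rule GL.subgroupI)
  have "\<one>\<^bsub>GL2 R\<^esub> \<in> SL2 R"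
    using GL.one_closed n_gt_1 by (simp add: SL2_iff GL2_simps(3) idet_def)
  then show "SL2 R \<noteq> {}" by blast
next
  fix x y assume "x \<in> SL2 R" "y \<in> SL2 R"
  moreover from this have "idet (x \<otimes>\<^bsub>GL2 R\<^esub> y) mod n = 1"
    using n_gt_1 by (simp add: SL2_iff GL2_simps idet_mred idet_imul mod_mult_eq[symmetric, of "idet x"])
  ultimately show "x \<otimes>\<^bsub>GL2 R\<^esub> y \<in> SL2 R" by (simp add: SL2_iff)
next
  fix x assume x: "x \<in> SL2 R"
  then have xG: "x \<in> carrier (GL2 R)" by (simp add: SL2_iff)
  have "idet (x \<otimes>\<^bsub>GL2 R\<^esub> inv\<^bsub>GL2 R\<^esub> x) mod n = 1"
    using xG n_gt_1 by (simp add: GL2_simps(3) idet_def)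
  then have "(idet x mod n) * idet (inv\<^bsub>GL2 R\<^esub> x) mod n = 1"
    by (simp add: GL2_simps(2) idet_mred idet_imul mod_mult_left_eq)
  then have "idet (inv\<^bsub>GL2 R\<^esub> x) mod n = 1"
    using x by (simp add: SL2_iff)
  then show "inv\<^bsub>GL2 R\<^esub> x \<in> SL2 R" using xG by (simp add: SL2_iff)
qed (auto simp: SL2_iff)

lemma PSL2_subgroup: "subgroup (PSL2 R) (PGL2 R)"
proof -
  interpret h: group_hom "GL2 R" "PGL2 R" "PGL2_class R"
    by unfold_locales (rule class_hom)
  show ?thesis unfolding PSL2_def by (rule h.subgroup_img_is_subgroup[OF SL2_subgroup])
qed

lemma finite_carrier_PGL2: "finite (carrier (PGL2 R))"
proof -
  have "finite (carrier (GL2 R))"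
    by (rule finite_subset[of _ "carrier (Mat2 R)"]) (auto intro: GL2_sub_Mat2, simp add: Mat2_simps)
  then show ?thesis by (simp add: carrier_PGL2)
qed

text \<open>Unites the two values of the Legendre symbol: in the spectral argument the vertex set
  enters as a finite subgroup containing the generators.\<close>

lemma cayley_vertices_subgroup: "subgroup (cayley_vertices p0 p1) (PGL2 R)"
  using PSL2_subgroup PG.subgroup_self by (simp add: cayley_vertices_def R_def)

lemma finite_cayley_vertices: "finite (cayley_vertices p0 p1)"
  using finite_carrier_PGL2 subgroup.subset[OF cayley_vertices_subgroup] finite_subset by blast

end

section \<open>Classes of quaternions in the projective linear group\<close>

locale quat_pgl = pgl_mod +
  fixes \<beta> :: int
  assumes beta: "[\<beta>\<^sup>2 = - 1] (mod n)" and odd_n: "odd n"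
begin

lemma n_dvd_beta: "n dvd \<beta>\<^sup>2 + 1"
  using beta by (simp add: cong_iff_dvd_diff)

sublocale split_prime n \<beta>
  by unfold_locales (use prime_n odd_n n_dvd_beta in auto)

lemma mred_eqI: "qdvd n (a0 - b0, a1 - b1, a2 - b2, a3 - b3) \<Longrightarrow> mred n (a0, a1, a2, a3) = mred n (b0, b1, b2, b3)"
  by (simp add: qdvd_def mred_def mod_eq_dvd_iff)

lemma qmat_qmul: "mred n (qmat \<beta> (qmul a b)) = mred n (imul (qmat \<beta> a) (qmat \<beta> b))"
proof -
  obtain a0 a1 a2 a3 b0 b1 b2 b3 where ab: "a = (a0, a1, a2, a3)" "b = (b0, b1, b2, b3)"
    by (cases a; cases b) auto
  obtain k where k: "\<beta>\<^sup>2 + 1 = n * k" using n_dvd_beta by (auto simp: dvd_def)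
  \<comment> \<open>A rewrite rule for \<open>\<beta>^2 = -1\<close> that keeps the error as an
    explicit multiple of \<open>n\<close>, so that the divisibility below is settled by
    simplification.\<close>
  then have k': "\<beta> * (\<beta> * x) = n * (k * x) - x" for x
    by (metis add_diff_cancel_right' distrib_right mult.assoc mult_1 power2_eq_square)
  show ?thesis
    unfolding ab imul_def qmat_def qmul_def case_prod_conv
    by (rule mred_eqI) (simp add: qdvd_def algebra_simps k')
qed

lemma idet_qmat: "idet (qmat \<beta> a) mod n = qnorm a mod n"
proof (cases a)
  case (fields a0 a1 a2 a3)
  obtain k where k: "\<beta>\<^sup>2 + 1 = n * k" using n_dvd_beta by (auto simp: dvd_def)
  have "idet (qmat \<beta> a) = qnorm a - (\<beta>\<^sup>2 + 1) * (a1\<^sup>2 + a3\<^sup>2)"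
    by (simp add: fields idet_def qmat_def qnorm_def power2_eq_square algebra_simps)
  then have "n dvd idet (qmat \<beta> a) - qnorm a" by (simp add: k)
  then show ?thesis by (simp add: mod_eq_dvd_iff)
qed

lemma mred_qmat_GL2:
  assumes "\<not> n dvd qnorm a" shows "mred n (qmat \<beta> a) \<in> carrier (GL2 R)"
proof (rule mred_in_GL2)
  have "\<not> n dvd idet (qmat \<beta> a)" using assms idet_qmat[of a] by (simp add: dvd_eq_mod_eq_0)
  then show "coprime (idet (qmat \<beta> a)) n" using prime_n by (simp add: prime_imp_coprime coprime_commute)
qed

lemma quat_mod_eq': "quat_mod p1 \<beta> a = PGL2_class R (mred n (qmat \<beta> a))"
  by (simp add: quat_mod_eq n_def R_def)

lemma quat_mod_closed: "\<not> n dvd qnorm a \<Longrightarrow> quat_mod p1 \<beta> a \<in> carrier (PGL2 R)"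
  using mred_qmat_GL2 by (simp add: quat_mod_eq' carrier_PGL2)

lemma quat_mod_qmul:
  assumes "\<not> n dvd qnorm a" "\<not> n dvd qnorm b"
  shows "quat_mod p1 \<beta> (qmul a b) = quat_mod p1 \<beta> a \<otimes>\<^bsub>PGL2 R\<^esub> quat_mod p1 \<beta> b"
proof -
  have "mred n (qmat \<beta> (qmul a b)) = mred n (qmat \<beta> a) \<otimes>\<^bsub>GL2 R\<^esub> mred n (qmat \<beta> b)"
    by (simp add: GL2_simps qmat_qmul)
  then show ?thesis
    using hom_mult[OF class_hom mred_qmat_GL2[OF assms(1)] mred_qmat_GL2[OF assms(2)]] by (simp add: quat_mod_eq')
qed

lemma quat_mod_one: "quat_mod p1 \<beta> (c, 0, 0, 0) = \<one>\<^bsub>PGL2 R\<^esub>" if "\<not> n dvd c"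
proof -
  have "\<not> n dvd qnorm (c, 0, 0, 0)" using that prime_n by (simp add: qnorm_def prime_dvd_power_iff)
  then have "mred n (qmat \<beta> (c, 0, 0, 0)) \<in> carrier (GL2 R)" by (rule mred_qmat_GL2)
  then show ?thesis using class_one_iff mred_scalar[OF that] by (simp add: quat_mod_eq' qmat_def)
qed

text \<open>A scalar matrix has equal diagonal and vanishing off-diagonal entries. Since 2 and
  \<open>\<beta>\<close> are units, this kills the imaginary coordinates modulo
  \<open>n\<close>.\<close>

lemma quat_mod_eq_one:
  assumes "\<not> n dvd qnorm (a0, a1, a2, a3)" "quat_mod p1 \<beta> (a0, a1, a2, a3) = \<one>\<^bsub>PGL2 R\<^esub>"
  shows "n dvd a1 \<and> n dvd a2 \<and> n dvd a3"
proof -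
  have "mred n (qmat \<beta> (a0, a1, a2, a3)) \<in> scalars2 R"
    using assms mred_qmat_GL2 class_one_iff by (simp add: quat_mod_eq')
  then have "(a2 + \<beta> * a3) mod n = 0" "(- a2 + \<beta> * a3) mod n = 0" "(a0 + \<beta> * a1) mod n = (a0 - \<beta> * a1) mod n"
    by (auto simp: scalars2_eq mred_def qmat_def)
  then have *: "n dvd a2 + \<beta> * a3" "n dvd - a2 + \<beta> * a3" "n dvd (a0 + \<beta> * a1) - (a0 - \<beta> * a1)"
    by (simp_all only: mod_eq_0_iff_dvd mod_eq_dvd_iff)
  have "n dvd (a2 + \<beta> * a3) + (- a2 + \<beta> * a3)" "n dvd (a2 + \<beta> * a3) - (- a2 + \<beta> * a3)"
    using * by (simp_all only: dvd_add dvd_diff)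
  then have "n dvd 2 * (\<beta> * a3)" "n dvd 2 * a2" "n dvd 2 * (\<beta> * a1)"
    using *(3) by (simp_all add: algebra_simps)
  then show ?thesis by (simp only: p_dvd_double p_dvd_i_mult simp_thms)
qed

lemma quat_mod_qconj:
  assumes "\<not> n dvd qnorm a"
  shows "quat_mod p1 \<beta> (qconj a) = inv\<^bsub>PGL2 R\<^esub> quat_mod p1 \<beta> a"
proof -
  have "quat_mod p1 \<beta> a \<otimes>\<^bsub>PGL2 R\<^esub> quat_mod p1 \<beta> (qconj a) = \<one>\<^bsub>PGL2 R\<^esub>"
    using assms quat_mod_qmul[of a "qconj a"] by (simp add: qmul_qconj quat_mod_one)
  then show ?thesis
    using PG.inv_equality[of "quat_mod p1 \<beta> (qconj a)" "quat_mod p1 \<beta> a"] PG.inv_comm assms by (simp add: quat_mod_closed)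
qed

text \<open>If \<open>p0\<close> is a square \<open>y^2\<close> modulo \<open>p1\<close>,
  multiplying \<open>a\<close> by the inverse of \<open>y\<close> keeps the class in the projective
  group and turns the determinant into 1.\<close>

lemma quat_mod_in_cayley_vertices:
  assumes a: "a \<in> quat_set p0" and p0: "\<not> n dvd int p0"
  shows "quat_mod p1 \<beta> a \<in> cayley_vertices p0 p1"
proof (cases "Legendre (int p0) (int p1) = 1")
  case False
  then show ?thesis using quat_mod_closed[of a] qnorm_quat_set[OF a] p0
    by (simp add: cayley_vertices_def R_def)
next
  case True
  then have "QuadRes (int p1) (int p0)" by (auto simp: Legendre_def split: if_splits)
  then obtain y where y: "[y\<^sup>2 = int p0] (mod n)" by (auto simp: QuadRes_def n_def)
  then have "\<not> n dvd y\<^sup>2" using p0 by (simp add: cong_dvd_iff)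
  then have ny: "\<not> n dvd y" by (metis dvd_power_le dvd_mult power2_eq_square)
  then have "coprime y n" using prime_n by (simp add: prime_imp_coprime coprime_commute)
  then obtain u where u: "[y * u = 1] (mod n)" using cong_solve_coprime_int by blast
  have nu: "\<not> n dvd u"
  proof
    assume "n dvd u"
    then have "y * u mod n = 0" by simp
    then show False using u n_gt_1 by (simp add: cong_def)
  qed
  have nn: "\<not> n dvd qnorm (u, 0, 0, 0)" "\<not> n dvd qnorm a"
    using nu p0 prime_n qnorm_quat_set[OF a] by (simp_all add: qnorm_def prime_dvd_power_iff)
  define v where "v = qmul (u, 0, 0, 0) a"
  have nv: "\<not> n dvd qnorm v" using nn prime_n by (simp add: v_def qnorm_qmul prime_dvd_mult_iff)
  have ev: "quat_mod p1 \<beta> v = quat_mod p1 \<beta> a"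
    using quat_mod_qmul[OF nn] quat_mod_closed[OF nn(2)] nu by (simp add: v_def quat_mod_one)
  have qu: "qnorm (u, 0, 0, 0) = u\<^sup>2" by (simp add: qnorm_def)
  have "[qnorm v = u\<^sup>2 * y\<^sup>2] (mod n)"
    using y by (simp add: v_def qnorm_qmul qu qnorm_quat_set[OF a] cong_scalar_left cong_sym)
  also have "u\<^sup>2 * y\<^sup>2 = (y * u)\<^sup>2" by (simp add: power_mult_distrib mult.commute)
  also have "[(y * u)\<^sup>2 = 1\<^sup>2] (mod n)" using u by (rule cong_pow)
  finally have "idet (mred n (qmat \<beta> v)) mod n = 1"
    using n_gt_1 by (simp add: idet_mred idet_qmat cong_def)
  then have "mred n (qmat \<beta> v) \<in> SL2 R" using mred_qmat_GL2[OF nv] by (simp add: SL2_iff)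
  then have "quat_mod p1 \<beta> v \<in> PSL2 R" by (simp add: PSL2_def quat_mod_eq')
  then show ?thesis using True ev by (simp add: cayley_vertices_def R_def)
qed

end

section \<open>Traces and self-adjoint operators\<close>

locale operator_space = vector_space scale
  for scale :: "'a::field \<Rightarrow> 'b::ab_group_add \<Rightarrow> 'b"
begin

text \<open>The trace of \<open>T\<close> restricted to \<open>span B\<close>, when \<open>B\<close>
  is a finite basis and \<open>T\<close> preserves its span.\<close>

definition op_trace :: "'b set \<Rightarrow> ('b \<Rightarrow> 'b) \<Rightarrow> 'a" where
  "op_trace B T = (\<Sum>b\<in>B. representation B (T b) b)"

text \<open>Two bases appear so that one formula covers both needs below: with the identity for
  \<open>T\<close> it is the change of basis, in general it is the action of a matrix on
  coordinates.\<close>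

lemma representation_linear_image:
  assumes "independent B" "finite B" "independent C" "finite C" "span B = span C"
    and T: "Vector_Spaces.linear scale scale T" "\<And>x. x \<in> span B \<Longrightarrow> T x \<in> span B" and v: "v \<in> span B"
  shows "representation B (T v) b = (\<Sum>c\<in>C. representation C v c * representation B (T c) b)"
proof -
  interpret T: Vector_Spaces.linear scale scale T by (rule T(1))
  have "T v = T (\<Sum>c\<in>C. scale (representation C v c) c)"
    using assms by (simp add: sum_representation_eq)
  also have "\<dots> = (\<Sum>c\<in>C. scale (representation C v c) (T c))"
    by (simp add: T.sum T.scale)
  finally have eq: "T v = (\<Sum>c\<in>C. scale (representation C v c) (T c))" .
  have c: "T c \<in> span B" if "c \<in> C" for c using T(2) assms(5) span_base[OF that] by simp
  show ?thesis unfolding eq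
    using assms(1) c by (simp add: representation_sum representation_scale span_scale)
qed

lemma identity_linear: "Vector_Spaces.linear scale scale (\<lambda>x. x)"
  by unfold_locales (auto simp: algebra_simps)

text \<open>Conjugate matrices have equal traces: fact 1 inserts the two base changes, fact 2 says
  that they are inverse to each other. This links the eigenbasis, where the trace is a sum over the
  spectrum, to the basis of monomials, where it counts fixed points.\<close>

lemma op_trace_basis_independent:
  assumes B: "independent B" "finite B" and C: "independent C" "finite C" and BC: "span B = span C"
    and T: "Vector_Spaces.linear scale scale T" "\<And>x. x \<in> span B \<Longrightarrow> T x \<in> span B"
  shows "op_trace B T = op_trace C T"
proof -
  have TC: "\<And>x. x \<in> span C \<Longrightarrow> T x \<in> span C" using T BC by simp
  have 1: "representation B (T b) b = (\<Sum>c\<in>C. \<Sum>c'\<in>C. representation C b c * representation C (T c) c' * representation B c' b)"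
    if b: "b \<in> B" for b
  proof -
    have "representation B (T c) b = (\<Sum>c'\<in>C. representation C (T c) c' * representation B c' b)"
      if "c \<in> C" for c
      using representation_linear_image[OF B C BC identity_linear, of "T c" b] T(2) BC span_base[OF that] by simp
    then show ?thesis
      using representation_linear_image[OF B C BC T, of b b] span_base[OF b]
      by (simp add: sum_distrib_left mult.assoc)
  qed
  have 2: "(\<Sum>b\<in>B. representation C b c * representation B c' b) = (if c = c' then 1 else 0)"
    if c: "c \<in> C" "c' \<in> C" for c c'
  proof -
    have "representation C c' c = (\<Sum>b\<in>B. representation B c' b * representation C b c)"
      using representation_linear_image[OF C B BC[symmetric] identity_linear, of c' c] span_base[OF c(2)] by simp
    then show ?thesis using representation_basis[OF C(1) c(2)] by (simp add: mult.commute)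
  qed
  have "op_trace B T = (\<Sum>b\<in>B. \<Sum>c\<in>C. \<Sum>c'\<in>C. representation C b c * representation C (T c) c' * representation B c' b)"
    unfolding op_trace_def by (intro sum.cong refl 1)
  also have "\<dots> = (\<Sum>c\<in>C. \<Sum>c'\<in>C. \<Sum>b\<in>B. representation C b c * representation C (T c) c' * representation B c' b)"
    by (subst sum.swap) (rule sum.cong[OF refl], rule sum.swap)
  also have "\<dots> = (\<Sum>c\<in>C. \<Sum>c'\<in>C. representation C (T c) c' * (\<Sum>b\<in>B. representation C b c * representation B c' b))"
    by (simp add: sum_distrib_left algebra_simps)
  also have "\<dots> = (\<Sum>c\<in>C. \<Sum>c'\<in>C. representation C (T c) c' * (if c = c' then 1 else 0))"
    by (intro sum.cong refl arg_cong2[of _ _ _ _ "(*)"] 2)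
  also have "\<dots> = op_trace C T"
    unfolding op_trace_def using C(2) by (intro sum.cong refl) (simp add: if_distrib sum.delta' cong: if_cong)
  finally show ?thesis .
qed

lemma op_trace_eigenbasis:
  assumes "independent B" "\<And>b. b \<in> B \<Longrightarrow> T b = scale (f b) b"
  shows "op_trace B T = (\<Sum>b\<in>B. f b)"
  unfolding op_trace_def
  using assms by (intro sum.cong refl) (simp add: representation_scale representation_basis span_base)

text \<open>If \<open>T u = c u\<close>, the coordinates of \<open>u\<close> at basis vectors with
  another eigenvalue vanish. This turns the multiplicities in the definition of the spectrum into
  counts over an eigenbasis.\<close>

lemma dim_eigenspace:
  assumes B: "independent B" "finite B" and T: "Vector_Spaces.linear scale scale T" and e: "\<And>b. b \<in> B \<Longrightarrow> T b = scale (f b) b"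
  shows "dim {u \<in> span B. T u = scale c u} = card {b \<in> B. f b = c}"
proof -
  interpret T: Vector_Spaces.linear scale scale T by (rule T)
  have "{u \<in> span B. T u = scale c u} \<subseteq> span {b \<in> B. f b = c}"
  proof safe
    fix u assume u: "u \<in> span B" "T u = scale c u"
    define r where "r = representation B u"
    have ur: "u = (\<Sum>b\<in>B. scale (r b) b)" using sum_representation_eq[OF B(1) u(1) B(2)] by (simp add: r_def)
    have "T u - scale c u = (\<Sum>b\<in>B. scale (r b * (f b - c)) b)"
      by (subst (1 2) ur) (simp add: T.sum T.scale e scale_sum_right sum_subtractf[symmetric] algebra_simps)
    then have "(\<Sum>b\<in>B. scale (r b * (f b - c)) b) = 0" using u(2) by simp
    then have "\<forall>b\<in>B. r b * (f b - c) = 0"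
      using B independentD[of B B "\<lambda>b. r b * (f b - c)"] by auto
    then have "u = (\<Sum>b\<in>{b \<in> B. f b = c}. scale (r b) b)"
      unfolding ur using B(2) by (intro sum.mono_neutral_right) auto
    also have "\<dots> \<in> span {b \<in> B. f b = c}" by (intro span_sum span_scale span_base)
    finally show "u \<in> span {b \<in> B. f b = c}" .
  qed
  moreover have "{b \<in> B. f b = c} \<subseteq> {u \<in> span B. T u = scale c u}" by (auto simp: e span_base)
  moreover have "independent {b \<in> B. f b = c}" by (rule independent_mono[OF B(1)]) auto
  ultimately show ?thesis
    by (intro basis_card_eq_dim[symmetric])
qed

end

section \<open>Diagonalisation of self-adjoint operators\<close>

locale selfadjoint_operator = operator_space scale
  for scale :: "complex \<Rightarrow> 'b::ab_group_add \<Rightarrow> 'b" +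
  fixes S :: "'b set" and T :: "'b \<Rightarrow> 'b" and H :: "'b \<Rightarrow> 'b \<Rightarrow> complex" and F :: "'b set"
  assumes S: "subspace S" and F: "finite F" "S \<subseteq> span F"
    and T: "Vector_Spaces.linear scale scale T" and TS: "x \<in> S \<Longrightarrow> T x \<in> S"
    and H_diff: "x \<in> S \<Longrightarrow> y \<in> S \<Longrightarrow> z \<in> S \<Longrightarrow> H (x - y) z = H x z - H y z"
    and H_scale: "x \<in> S \<Longrightarrow> y \<in> S \<Longrightarrow> H (scale c x) y = c * H x y"
    and H_cnj: "x \<in> S \<Longrightarrow> y \<in> S \<Longrightarrow> H x y = cnj (H y x)"
    and H_pos: "x \<in> S \<Longrightarrow> H x x = 0 \<Longrightarrow> x = 0"
    and H_T: "x \<in> S \<Longrightarrow> y \<in> S \<Longrightarrow> H (T x) y = H x (T y)"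
begin

interpretation T: Vector_Spaces.linear scale scale T by (rule T)

definition eigvecs :: "'b set" where
  "eigvecs = {v \<in> S. \<exists>\<mu> :: real. T v = scale (of_real \<mu>) v}"

lemma H_scale_right: "x \<in> S \<Longrightarrow> y \<in> S \<Longrightarrow> H x (scale c y) = cnj c * H x y"
  using H_cnj[of x "scale c y"] H_scale[of y x c] H_cnj[of x y] S subspace_scale by simp

lemma eigenvalue_real:
  assumes "v \<in> S" "T v = scale \<mu> v" "v \<noteq> 0" shows "\<mu> \<in> \<real>"
proof -
  have "\<mu> * H v v = cnj \<mu> * H v v"
    using H_T[OF assms(1,1)] assms(1) by (simp add: assms(2) H_scale H_scale_right)
  moreover have "H v v \<noteq> 0" using H_pos assms by blast
  ultimately show ?thesis by (simp add: Reals_cnj_iff)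
qed

lemma T_scale_diff_in_S: "v \<in> S \<Longrightarrow> T v - scale \<mu> v \<in> S"
  using TS S subspace_diff subspace_scale by blast

text \<open>Self-adjointness rules out Jordan blocks: a component of \<open>(T - \<mu>) v\<close> in the \<open>\<mu>\<close>-eigenspace
  would be orthogonal to itself.\<close>

lemma in_span_eigvecs_step:
  assumes v: "v \<in> S" and w: "T v - scale \<mu> v \<in> span eigvecs"
  shows "v \<in> span eigvecs"
proof -
  obtain t r where t: "finite t" "t \<subseteq> eigvecs" "T v - scale \<mu> v = (\<Sum>a\<in>t. scale (r a) a)"
    using w by (auto simp: span_explicit)
  have "\<forall>a\<in>t. \<exists>l :: real. T a = scale (of_real l) a" using t(2) by (auto simp: eigvecs_def)
  then obtain l :: "'b \<Rightarrow> real" where l: "\<And>a. a \<in> t \<Longrightarrow> T a = scale (of_real (l a)) a" by metis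
  define t0 where "t0 = {a \<in> t. complex_of_real (l a) = \<mu>}"
  define t1 where "t1 = t - t0"
  have tS: "a \<in> S" if "a \<in> t" for a using t(2) that by (auto simp: eigvecs_def)
  have ft: "finite t0" "finite t1" "t0 \<union> t1 = t" "t0 \<inter> t1 = {}" using t(1) by (auto simp: t0_def t1_def)
  \<comment> \<open>On the eigenspaces with eigenvalue other than \<open>\<mu>\<close> the operator
    \<open>T - \<mu>\<close> is invertible, and \<open>c\<close> is the preimage of that part of
    \<open>T v - \<mu> v\<close>. Subtracting \<open>c\<close> from \<open>v\<close> leaves only the
    part \<open>w'\<close> in the \<open>\<mu>\<close>-eigenspace.\<close>
  define c where "c = (\<Sum>a\<in>t1. scale (r a / (of_real (l a) - \<mu>)) a)"
  define w' where "w' = (\<Sum>a\<in>t0. scale (r a) a)"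
  have cE: "c \<in> span eigvecs" unfolding c_def using t(2) by (intro span_sum span_scale span_base) (auto simp: t1_def)
  have cS: "c \<in> S" unfolding c_def using tS by (intro subspace_sum[OF S] subspace_scale[OF S]) (auto simp: t1_def)
  have w'S: "w' \<in> S" unfolding w'_def using tS by (intro subspace_sum[OF S] subspace_scale[OF S]) (auto simp: t0_def)
  have Tc: "T c - scale \<mu> c = (\<Sum>a\<in>t1. scale (r a) a)"
  proof -
    have "T c - scale \<mu> c = (\<Sum>a\<in>t1. scale (r a / (of_real (l a) - \<mu>)) (T a - scale \<mu> a))"
      by (simp add: c_def T.sum T.scale scale_sum_right sum_subtractf[symmetric] algebra_simps)
    also have "\<dots> = (\<Sum>a\<in>t1. scale (r a) a)"
    proof (intro sum.cong refl)
      fix a assume a: "a \<in> t1"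
      then have "T a - scale \<mu> a = scale (of_real (l a) - \<mu>) a" by (simp add: l t1_def scale_left_diff_distrib)
      moreover have "of_real (l a) - \<mu> \<noteq> 0" using a by (auto simp: t1_def t0_def)
      ultimately show "scale (r a / (of_real (l a) - \<mu>)) (T a - scale \<mu> a) = scale (r a) a" by simp
    qed
    finally show ?thesis .
  qed
  define v' where "v' = v - c"
  have v'S: "v' \<in> S" using v cS S subspace_diff by (simp add: v'_def)
  have Tv': "T v' - scale \<mu> v' = w'"
  proof -
    have "T v' - scale \<mu> v' = (T v - scale \<mu> v) - (T c - scale \<mu> c)"
      by (simp add: v'_def T.diff scale_right_diff_distrib)
    also have "\<dots> = w'"
      using sum.union_disjoint[OF ft(1,2,4), of "\<lambda>a. scale (r a) a"] ft(3) by (simp add: t(3) Tc w'_def)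
    finally show ?thesis .
  qed
  have Tw': "T w' = scale \<mu> w'"
    by (simp add: w'_def T.sum T.scale scale_sum_right t0_def l mult.commute)
  have "w' = 0"
  proof (cases "\<mu> \<in> \<real>")
    case True
    have "H w' w' = H (T v') w' - H (scale \<mu> v') w'"
      using H_diff[OF TS[OF v'S] subspace_scale[OF S v'S] w'S, of \<mu>] Tv' by simp
    also have "\<dots> = 0"
      using True by (simp add: H_T v'S w'S Tw' H_scale H_scale_right Reals_cnj_iff)
    finally show ?thesis using H_pos w'S by blast
  next
    case False
    then have "t0 = {}" by (auto simp: t0_def)
    then show ?thesis by (simp add: w'_def)
  qed
  then have v'e: "T v' = scale \<mu> v'" using Tv' by simp
  have "v' \<in> span eigvecs"
  proof (cases "v' = 0")
    case False
    then have "\<mu> \<in> \<real>" using eigenvalue_real v'S v'e by blast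
    then show ?thesis using v'S v'e by (intro span_base) (auto simp: eigvecs_def Reals_def)
  qed (simp add: span_zero)
  then show ?thesis using span_add[OF _ cE, of v'] by (simp add: v'_def)
qed

definition poly_op :: "complex poly \<Rightarrow> 'b \<Rightarrow> 'b" where
  "poly_op f v = (\<Sum>i\<le>Polynomial.degree f. scale (poly.coeff f i) ((T ^^ i) v))"

lemma poly_op_altdef: "Polynomial.degree f \<le> n \<Longrightarrow> poly_op f v = (\<Sum>i\<le>n. scale (poly.coeff f i) ((T ^^ i) v))"
  unfolding poly_op_def by (intro sum.mono_neutral_left) (auto simp: coeff_eq_0)

lemma poly_op_linear_factor: "poly_op ([:- \<mu>, 1:] * g) v = poly_op g (T v - scale \<mu> v)"
proof -
  have lin: "(T ^^ i) (x - scale c y) = (T ^^ i) x - scale c ((T ^^ i) y)" for i x y c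
    by (induction i) (simp_all add: T.diff T.scale)
  let ?n = "Suc (Polynomial.degree g)"
  have "poly_op ([:- \<mu>, 1:] * g) v = (\<Sum>i\<le>?n. scale (poly.coeff ([:- \<mu>, 1:] * g) i) ((T ^^ i) v))"
    by (rule poly_op_altdef) (auto intro!: degree_diff_le degree_pCons_le intro: order_trans[OF degree_smult_le])
  also have "\<dots> = (\<Sum>i\<le>?n. scale (poly.coeff (pCons 0 g) i) ((T ^^ i) v)) - (\<Sum>i\<le>?n. scale (\<mu> * poly.coeff g i) ((T ^^ i) v))"
    by (simp add: sum_subtractf[symmetric] scale_left_diff_distrib del: sum.atMost_Suc)
  also have "(\<Sum>i\<le>?n. scale (poly.coeff (pCons 0 g) i) ((T ^^ i) v)) = (\<Sum>i\<le>Polynomial.degree g. scale (poly.coeff g i) ((T ^^ i) (T v)))"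
    by (subst sum.atMost_Suc_shift) (simp add: funpow_swap1)
  also have "(\<Sum>i\<le>?n. scale (\<mu> * poly.coeff g i) ((T ^^ i) v)) = (\<Sum>i\<le>Polynomial.degree g. scale (\<mu> * poly.coeff g i) ((T ^^ i) v))"
    by (simp add: coeff_eq_0)
  finally show ?thesis
    by (simp add: poly_op_def lin sum_subtractf[symmetric] scale_right_diff_distrib mult.commute)
qed

text \<open>A complex root \<open>\<mu>\<close> of \<open>f\<close> splits off a linear factor. The
  remaining factor kills \<open>T v - \<mu> v\<close>, which is in the span by induction, and
  \<open>in_span_eigvecs_step\<close> passes from there to \<open>v\<close>.\<close>

lemma in_span_eigvecs_if_killed:
  assumes "f \<noteq> 0" "v \<in> S" "poly_op f v = 0"
  shows "v \<in> span eigvecs"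
  using assms
proof (induction "Polynomial.degree f" arbitrary: f v)
  case 0
  then obtain c where "f = [:c:]" "c \<noteq> 0" by (metis degree_eq_zeroE pCons_0_0)
  then have "v = 0" using 0 by (simp add: poly_op_def)
  then show ?case by (simp add: span_zero)
next
  case (Suc n)
  have "\<not> constant (poly f)" using Suc(2) by (simp add: constant_degree)
  then obtain \<mu> where "poly f \<mu> = 0" using fundamental_theorem_of_algebra by blast
  then obtain g where g: "f = [:- \<mu>, 1:] * g" by (auto simp: poly_eq_0_iff_dvd dvd_def)
  have g0: "g \<noteq> 0" using Suc.prems(1) g by auto
  then have "Polynomial.degree f = Suc (Polynomial.degree g)" unfolding g by (subst degree_mult_eq) auto
  then have "n = Polynomial.degree g" using Suc(2) by simp
  then have "T v - scale \<mu> v \<in> span eigvecs"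
    using Suc.hyps(1)[of g "T v - scale \<mu> v"] g0 Suc.prems T_scale_diff_in_S g poly_op_linear_factor by auto
  then show ?case using in_span_eigvecs_step Suc.prems(2) by blast
qed

text \<open>The first \<open>card F + 1\<close> iterates of \<open>v\<close> lie in a space of
  dimension at most \<open>card F\<close>. Dependence is a property of sets, so the case of
  coinciding iterates is separate and uses a difference of two monomials.\<close>

lemma exists_killing_poly:
  assumes v: "v \<in> S" shows "\<exists>f. f \<noteq> 0 \<and> poly_op f v = 0"
proof -
  have TiS: "(T ^^ i) v \<in> S" for i by (induction i) (simp_all add: v TS)
  define n where "n = card F"
  define g where "g i = (T ^^ i) v" for i
  show ?thesis
  proof (cases "inj_on g {..n}")
    case False
    then obtain i j where ij: "i \<noteq> j" "g i = g j" by (auto simp: inj_on_def)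
    define f where "f = Polynomial.monom (1 :: complex) i - Polynomial.monom 1 j"
    have "poly.coeff f i = 1" using ij(1) by (simp add: f_def)
    then have "f \<noteq> 0" by auto
    have "poly_op f v = (\<Sum>k\<le>i + j + Polynomial.degree f. scale (poly.coeff f k) ((T ^^ k) v))"
      by (rule poly_op_altdef) simp
    also have "\<dots> = (\<Sum>k\<le>i + j + Polynomial.degree f. (if k = i then g i else 0) - (if k = j then g j else 0))"
      by (intro sum.cong refl) (auto simp: f_def g_def)
    also have "\<dots> = 0" using ij by (simp add: sum_subtractf)
    finally show ?thesis using \<open>f \<noteq> 0\<close> by blast
  next
    case True
    have "g ` {..n} \<subseteq> span F" using TiS F(2) by (auto simp: g_def)
    then have "dependent (g ` {..n})"
      using independent_span_bound[OF F(1), of "g ` {..n}"] card_image[OF True] by (auto simp: n_def)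
    then obtain u where u: "\<exists>x\<in>g ` {..n}. u x \<noteq> 0" "(\<Sum>x\<in>g ` {..n}. scale (u x) x) = 0"
      by (auto simp: dependent_finite)
    define f where "f = (\<Sum>i\<le>n. Polynomial.monom (u (g i)) i)"
    have cf: "poly.coeff f i = (if i \<le> n then u (g i) else 0)" for i
      by (simp add: f_def coeff_sum)
    obtain i where "i \<le> n" "u (g i) \<noteq> 0" using u(1) by auto
    then have "poly.coeff f i \<noteq> 0" by (simp add: cf)
    then have "f \<noteq> 0" by auto
    have "Polynomial.degree f \<le> n" by (rule degree_le) (simp add: cf)
    then have "poly_op f v = (\<Sum>i\<le>n. scale (poly.coeff f i) ((T ^^ i) v))" by (rule poly_op_altdef)
    also have "\<dots> = (\<Sum>x\<in>g ` {..n}. scale (u x) x)"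
      by (subst sum.reindex[OF True]) (auto intro!: sum.cong simp: cf g_def)
    finally show ?thesis using u(2) \<open>f \<noteq> 0\<close> by auto
  qed
qed

text \<open>Every vector of \<open>S\<close> is killed by a nonzero polynomial in \<open>T\<close>,
  so the eigenvectors with real eigenvalue span \<open>S\<close>, and a maximal independent set of
  them is a basis.\<close>

theorem exists_eigenbasis:
  obtains B l where "finite B" "independent B" "span B = S" "\<And>b. b \<in> B \<Longrightarrow> T b = scale (of_real (l b)) b"
proof -
  obtain B where B: "B \<subseteq> eigvecs" "independent B" "eigvecs \<subseteq> span B"
    using maximal_independent_subset by blast
  have "S \<subseteq> span eigvecs" using exists_killing_poly in_span_eigvecs_if_killed by blast
  then have "S \<subseteq> span B" using span_mono[OF B(3)] by (simp add: span_span) 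
  moreover have BS: "B \<subseteq> S" using B(1) by (auto simp: eigvecs_def)
  ultimately have "span B = S" using span_minimal[OF BS S] by blast
  moreover have "finite B" using independent_span_bound[OF F(1) B(2)] BS F(2) by blast
  moreover have "\<forall>b\<in>B. \<exists>l :: real. T b = scale (of_real l) b" using B(1) by (auto simp: eigvecs_def)
  then obtain l where "\<And>b. b \<in> B \<Longrightarrow> T b = scale (of_real (l b)) b" by metis
  ultimately show ?thesis using that B(2) by blast
qed

end

section \<open>The Kesten--McKay density\<close>

text \<open>The value of \<open>nbp q k\<close> at the adjacency operator of a \<open>(q + 1)\<close>-regular graph is the sum over
  the non-backtracking walks of length \<open>k\<close>.\<close>

fun nbp :: "real \<Rightarrow> nat \<Rightarrow> real \<Rightarrow> real" where
  "nbp q 0 x = 1"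
| "nbp q (Suc 0) x = x"
| "nbp q (Suc (Suc k)) x = x * nbp q (Suc k) x - (if k = 0 then q + 1 else q) * nbp q k x"

definition km_density :: "real \<Rightarrow> real \<Rightarrow> real" where
  "km_density q t = (q + 1) * sqrt (4 * q - t\<^sup>2) / (2 * pi * ((q + 1)\<^sup>2 - t\<^sup>2))"

lemma continuous_nbp: "continuous_on S (nbp q k)"
  by (induction q k "0 :: real" rule: nbp.induct) (auto simp: fun_eq_iff[symmetric] intro!: continuous_intros cong: continuous_on_cong)

text \<open>In terms of Chebyshev polynomials of the second kind, \<open>nbp q (k+1)\<close> is
  \<open>q^((k+1)/2)\<close> times \<open>U_(k+1) - U_(k-1) / q\<close>. The formula starts at index
  1 because the coefficient \<open>q + 1\<close> in the recurrence breaks the pattern at index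
  0.\<close>

lemma sin_nbp:
  assumes "q > 0"
  shows "sin u * nbp q (Suc k) (2 * sqrt q * cos u)
    = sqrt q ^ Suc k * (sin (real (k + 2) * u) - sin (real k * u) / q)"
proof (induction k rule: induct_nat_012)
  case 0
  have "sin (real (0 + 2) * u) = 2 * sin u * cos u" by (simp add: sin_double)
  then show ?case by (simp add: mult_ac)
next
  case 1
  have s: "sqrt q * sqrt q = q" using assms by simp
  have "sin (3 * u) = sin u * (4 * (cos u)\<^sup>2 - 1)"
  proof -
    have "sin (3 * u) = sin (2 * u + u)" by simp
    also have "\<dots> = sin u * (4 * (cos u)\<^sup>2 - 1)"
      by (simp only: sin_add sin_double cos_double_cos) (simp add: power2_eq_square algebra_simps)
    finally show ?thesis .
  qed
  moreover have "sin u * nbp q (Suc 1) (2 * sqrt q * cos u) = sin u * (q * (4 * (cos u)\<^sup>2 - 1) - 1)"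
    using s by (simp add: power2_eq_square algebra_simps)
  moreover have "sqrt q ^ Suc 1 = q" using s by simp
  moreover have "q * (sin (3 * u) - sin u / q) = q * sin (3 * u) - sin u"
    using assms by (simp add: right_diff_distrib)
  ultimately show ?case by (simp add: right_diff_distrib mult.left_commute)
next
  case (ge2 k)
  define s where "s = sqrt q"
  have s: "s * s = q" "s > 0" using assms by (simp_all add: s_def)
  have two_cos: "2 * cos u * sin ((x + 1) * u) = sin ((x + 2) * u) + sin (x * u)" for x
  proof -
    have "sin ((x + 1) * u + u) + sin ((x + 1) * u - u) = 2 * cos u * sin ((x + 1) * u)"
      by (simp add: sin_add sin_diff)
    then show ?thesis by (simp add: algebra_simps)
  qed
  have "sin u * nbp q (Suc (Suc (Suc k))) (2 * s * cos u)
      = s * (2 * cos u) * (sin u * nbp q (Suc (Suc k)) (2 * s * cos u)) - q * (sin u * nbp q (Suc k) (2 * s * cos u))"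
    by (simp add: algebra_simps)
  also have "\<dots> = s * (2 * cos u) * (s ^ Suc (Suc k) * (sin (real (Suc k + 2) * u) - sin (real (Suc k) * u) / q))
      - q * (s ^ Suc k * (sin (real (k + 2) * u) - sin (real k * u) / q))"
    using ge2 by (simp only: s_def)
  also have "\<dots> = s ^ (k + 3) * (2 * cos u * sin ((real (k + 2) + 1) * u)
      - 2 * cos u * sin ((real k + 1) * u) / q - sin (real (k + 2) * u) + sin (real k * u) / q)"
    by (simp add: s(1)[symmetric] algebra_simps power_add numeral_3_eq_3 numeral_2_eq_2 add_divide_distrib diff_divide_distrib)
  also have "\<dots> = s ^ (k + 3) * (sin (real (k + 4) * u) - sin (real (k + 2) * u) / q)"
    unfolding two_cos by (simp add: algebra_simps add_divide_distrib)
  finally show ?case by (simp add: s_def numeral_3_eq_3 numeral_eq_Suc)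
qed

context
  fixes q :: real
  assumes q: "q > 1"
begin

text \<open>The substitution \<open>t = 2 sqrt q cos u\<close> turns \<open>(q + 1)\<^sup>2 - t\<^sup>2\<close> into \<open>poisson_den u\<close>, the squared
  modulus of \<open>q - exp (2 i u)\<close>.\<close>

definition poisson_den :: "real \<Rightarrow> real" where
  "poisson_den u = q\<^sup>2 - 2 * q * cos (2 * u) + 1"

text \<open>Cosine coefficients of a Poisson kernel. Integer indices allow the two-step recurrence
  to be used across zero.\<close>

definition poisson_coeff :: "int \<Rightarrow> real" where
  "poisson_coeff n = integral {0..pi} (\<lambda>u. cos (of_int n * u) / poisson_den u)"

lemma poisson_den_ge: "poisson_den u \<ge> (q - 1)\<^sup>2"
proof -
  have "q * cos (2 * u) \<le> q * 1" using q by (intro mult_left_mono) auto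
  then show ?thesis by (simp add: poisson_den_def power2_eq_square algebra_simps)
qed

lemma poisson_den_pos: "poisson_den u > 0"
  using poisson_den_ge[of u] q by (smt (verit) zero_less_power2)

lemma poisson_has_integral:
  "((\<lambda>u. cos (of_int n * u) / poisson_den u) has_integral poisson_coeff n) {0..pi}"
proof -
  have "continuous_on {0..pi} (\<lambda>u. cos (of_int n * u) / poisson_den u)"
    using poisson_den_pos unfolding poisson_den_def
    by (intro continuous_intros) (metis less_irrefl)
  then show ?thesis unfolding poisson_coeff_def
    by (intro integrable_integral integrable_continuous_real)
qed

lemma poisson_coeff_bound: "\<bar>poisson_coeff n\<bar> \<le> pi / (q - 1)\<^sup>2"
proof -
  have "norm (poisson_coeff n) \<le> (1 / (q - 1)\<^sup>2) * measure lborel (cbox 0 pi)"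
  proof (rule has_integral_bound)
    show "((\<lambda>u. cos (of_int n * u) / poisson_den u) has_integral poisson_coeff n) (cbox 0 pi)"
      using poisson_has_integral by simp
    fix u :: real
    have "\<bar>cos (of_int n * u)\<bar> / poisson_den u \<le> 1 / (q - 1)\<^sup>2"
      using poisson_den_ge[of u] q by (intro frac_le) auto
    then show "norm (cos (of_int n * u) / poisson_den u) \<le> 1 / (q - 1)\<^sup>2"
      using poisson_den_pos[of u] by simp
  qed simp
  then show ?thesis by simp
qed

lemma cos_has_integral:
  "((\<lambda>u. cos (of_int n * u)) has_integral (if n = 0 then pi else 0)) {0..pi}"
proof (cases "n = 0")
  case True
  then show ?thesis using has_integral_const_real[of "1 :: real" 0 pi] by simp
next
  case False
  have "((\<lambda>u. cos (of_int n * u)) has_integral sin (of_int n * pi) / of_int n - sin (of_int n * 0) / of_int n) {0..pi}"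
    using False by (intro fundamental_theorem_of_calculus)
      (auto intro!: derivative_eq_intros simp flip: has_real_derivative_iff_has_vector_derivative)
  then show ?thesis using False by (simp add: mult.commute[of _ pi] sin_npi_int)
qed

text \<open>Multiplying \<open>1 / poisson_den u\<close> by its denominator leaves the integral of a
  plain cosine, while the factor \<open>cos (2 * u)\<close> shifts the index by two in both
  directions.\<close>

lemma poisson_recurrence:
  "(q\<^sup>2 + 1) * poisson_coeff n - q * poisson_coeff (n + 2) - q * poisson_coeff (n - 2) = (if n = 0 then pi else 0)"
proof (rule has_integral_unique[OF _ cos_has_integral])
  have eq: "cos (of_int n * u) = (q\<^sup>2 + 1) * (cos (of_int n * u) / poisson_den u)
      - q * (cos (of_int (n + 2) * u) / poisson_den u) - q * (cos (of_int (n - 2) * u) / poisson_den u)" for u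
  proof -
    have "cos (of_int (n + 2) * u) + cos (of_int (n - 2) * u) = 2 * cos (of_int n * u) * cos (2 * u)"
      by (simp add: algebra_simps cos_add cos_diff)
    then have "cos (of_int n * u) * poisson_den u = (q\<^sup>2 + 1) * cos (of_int n * u)
      - q * cos (of_int (n + 2) * u) - q * cos (of_int (n - 2) * u)"
      unfolding poisson_den_def
      by (subst diff_diff_eq, subst distrib_left[symmetric]) (simp add: algebra_simps)
    then have "cos (of_int n * u) = ((q\<^sup>2 + 1) * cos (of_int n * u)
      - q * cos (of_int (n + 2) * u) - q * cos (of_int (n - 2) * u)) / poisson_den u"
      using poisson_den_pos[of u] by (simp add: nonzero_eq_divide_eq)
    then show ?thesis by (simp add: diff_divide_distrib)
  qed
  show "((\<lambda>u. cos (of_int n * u)) has_integral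
      (q\<^sup>2 + 1) * poisson_coeff n - q * poisson_coeff (n + 2) - q * poisson_coeff (n - 2)) {0..pi}"
    by (subst eq) (intro has_integral_diff has_integral_mult_right poisson_has_integral)
qed

text \<open>In steps of two, the solutions of the recurrence are spanned by \<open>q\<^sup>j\<close> and \<open>q\<^sup>-\<^sup>j\<close>, and
  only the second one is bounded.\<close>

lemma poisson_geometric:
  assumes "n \<ge> -1" shows "poisson_coeff (n + 2) = poisson_coeff n / q"
proof -
  \<comment> \<open>\<open>D\<close> vanishes on the decaying solution and is multiplied by
    \<open>q\<close> in each step. The assumption \<open>n \<ge> -1\<close> keeps the index
    \<open>n + 2 * j + 2\<close> away from 0, where the recurrence is inhomogeneous.\<close>
  define D where "D j = poisson_coeff (n + 2 * int j + 2) - poisson_coeff (n + 2 * int j) / q" for j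
  have step: "D (Suc j) = q * D j" for j
  proof -
    have "n + 2 * int j + 2 \<noteq> 0" using assms by linarith
    then have *: "(q\<^sup>2 + 1) * poisson_coeff (n + 2 * int j + 2) - q * poisson_coeff (n + 2 * int j + 4)
        - q * poisson_coeff (n + 2 * int j) = 0"
      using poisson_recurrence[of "n + 2 * int j + 2"] by (simp add: add.commute[of 4])
    have "q * D (Suc j) = q * poisson_coeff (n + 2 * int j + 4) - poisson_coeff (n + 2 * int j + 2)"
      using q by (simp add: D_def algebra_simps)
    also have "\<dots> = q * (q * D j)" using * q by (simp add: D_def power2_eq_square algebra_simps)
    finally show ?thesis using q by simp
  qed
  have pow: "D j = q ^ j * D 0" for j by (induction j) (simp_all add: step)
  define M where "M = 2 * (pi / (q - 1)\<^sup>2)"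
  have bound: "\<bar>D j\<bar> \<le> M" for j
  proof -
    have "\<bar>poisson_coeff (n + 2 * int j) / q\<bar> \<le> \<bar>poisson_coeff (n + 2 * int j)\<bar>"
      using q by (simp add: divide_le_eq mult_le_cancel_left1)
    then show ?thesis
      using poisson_coeff_bound[of "n + 2 * int j"] poisson_coeff_bound[of "n + 2 * int j + 2"]
        abs_triangle_ineq4[of "poisson_coeff (n + 2 * int j + 2)" "poisson_coeff (n + 2 * int j) / q"]
      unfolding D_def M_def by linarith
  qed
  have "D 0 = 0"
  proof (rule ccontr)
    assume "D 0 \<noteq> 0"
    obtain j where "q ^ j > M / \<bar>D 0\<bar>" using real_arch_pow[OF q] by blast
    then have "q ^ j * \<bar>D 0\<bar> > M" using \<open>D 0 \<noteq> 0\<close> by (simp add: divide_less_eq)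
    moreover have "q ^ j * \<bar>D 0\<bar> = \<bar>D j\<bar>" using q by (simp add: pow[of j] abs_mult)
    ultimately show False using bound[of j] by linarith
  qed
  then show ?thesis by (simp add: D_def)
qed

text \<open>Products of sines become cosines, so the integral is a combination of Poisson
  coefficients. For \<open>k > 0\<close> it is \<open>(q+1) c_k - q c_(k+2) - c_(k-2)\<close> up to
  a factor, which the geometric law cancels; \<open>k = 1\<close> is the case that needs the law
  from index \<open>-1\<close>.\<close>

lemma sin_product_integral:
  "((\<lambda>u. sin u * (sin u * nbp q k (2 * sqrt q * cos u)) / poisson_den u)
     has_integral (if k = 0 then pi / (2 * q * (q + 1)) else 0)) {0..pi}"
proof (cases k)
  case 0
  have eq: "sin u * (sin u * nbp q k (2 * sqrt q * cos u)) / poisson_den u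
      = 1 / 2 * (cos (of_int 0 * u) / poisson_den u - cos (of_int 2 * u) / poisson_den u)" for u
    by (simp add: 0 cos_double_sin diff_divide_distrib[symmetric] power2_eq_square)
  have g: "poisson_coeff 2 = poisson_coeff 0 / q" using poisson_geometric[of 0] by simp
  have "poisson_coeff (- 2) = poisson_coeff 2" by (simp add: poisson_coeff_def)
  then have "(q\<^sup>2 + 1) * poisson_coeff 0 - 2 * (q * poisson_coeff 2) = pi" using poisson_recurrence[of 0] by simp
  then have "(q\<^sup>2 - 1) * poisson_coeff 0 = pi" using q by (simp add: g algebra_simps)
  moreover have "q\<^sup>2 - 1 = (q - 1) * (q + 1)" by (simp add: power2_eq_square algebra_simps)
  ultimately have "poisson_coeff 0 = pi / ((q - 1) * (q + 1))"
    using q by (simp add: nonzero_eq_divide_eq mult.commute)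
  then have "1 / 2 * (poisson_coeff 0 - poisson_coeff 2) = pi / (2 * q * (q + 1))"
    using q by (simp add: g divide_simps) (simp add: algebra_simps)
  moreover have "((\<lambda>u. 1 / 2 * (cos (of_int 0 * u) / poisson_den u - cos (of_int 2 * u) / poisson_den u))
      has_integral 1 / 2 * (poisson_coeff 0 - poisson_coeff 2)) {0..pi}"
    by (intro has_integral_mult_right has_integral_diff poisson_has_integral)
  ultimately show ?thesis unfolding eq using 0 by (simp only: if_True refl)
next
  case (Suc m)
  define c where "c = sqrt q ^ k / (2 * q)"
  have eq: "sin u * (sin u * nbp q k (2 * sqrt q * cos u)) / poisson_den u
      = c * ((q + 1) * (cos (of_int (int k) * u) / poisson_den u) - q * (cos (of_int (int k + 2) * u) / poisson_den u)
          - cos (of_int (int k - 2) * u) / poisson_den u)" for u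
  proof -
    have p: "2 * (sin u * sin (x * u)) = cos ((x - 1) * u) - cos ((x + 1) * u)" for x
      by (simp add: algebra_simps cos_add cos_diff)
    have "sin u * (sin u * nbp q k (2 * sqrt q * cos u))
        = sqrt q ^ k * (sin u * sin (real (m + 2) * u) - sin u * sin (real m * u) / q)"
    proof -
      have "sin u * nbp q k (2 * sqrt q * cos u) = sqrt q ^ k * (sin (real (m + 2) * u) - sin (real m * u) / q)"
        unfolding Suc using q by (intro sin_nbp) simp
      then show ?thesis by (simp only:) (simp add: right_diff_distrib)
    qed
    also have "\<dots> = c * (q * (2 * (sin u * sin (real (m + 2) * u))) - 2 * (sin u * sin (real m * u)))"
      using q by (simp add: c_def field_simps)
    also have "\<dots> = c * ((q + 1) * cos (of_int (int k) * u) - q * cos (of_int (int k + 2) * u) - cos (of_int (int k - 2) * u))"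
      unfolding p by (simp add: Suc algebra_simps)
    finally show ?thesis by (simp add: diff_divide_distrib right_diff_distrib)
  qed
  have g1: "poisson_coeff (int k + 2) = poisson_coeff (int k) / q" by (rule poisson_geometric) simp
  have g2: "poisson_coeff (int k) = poisson_coeff (int k - 2) / q"
    using poisson_geometric[of "int k - 2"] Suc by simp
  have "(q + 1) * poisson_coeff (int k) - q * poisson_coeff (int k + 2) - poisson_coeff (int k - 2) = 0"
    unfolding g1 unfolding g2 using q by (simp add: field_simps)
  moreover have "((\<lambda>u. c * ((q + 1) * (cos (of_int (int k) * u) / poisson_den u) - q * (cos (of_int (int k + 2) * u) / poisson_den u)
          - cos (of_int (int k - 2) * u) / poisson_den u)) has_integral
      c * ((q + 1) * poisson_coeff (int k) - q * poisson_coeff (int k + 2) - poisson_coeff (int k - 2))) {0..pi}"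
    by (intro has_integral_mult_right has_integral_diff poisson_has_integral)
  ultimately show ?thesis unfolding eq using Suc by simp
qed

lemma km_den_pos:
  assumes "t \<in> {- 2 * sqrt q..2 * sqrt q}" shows "(q + 1)\<^sup>2 - t\<^sup>2 > 0" "4 * q - t\<^sup>2 \<ge> 0"
proof -
  have "\<bar>t\<bar> \<le> 2 * sqrt q" using assms by (auto simp: abs_le_iff)
  then have "t\<^sup>2 \<le> (2 * sqrt q)\<^sup>2" by (intro power2_le_iff_abs_le[THEN iffD2]) (use q in auto)
  then have t: "t\<^sup>2 \<le> 4 * q" using q by (simp add: power_mult_distrib)
  then show "4 * q - t\<^sup>2 \<ge> 0" by simp
  have "(q - 1)\<^sup>2 > 0" using q by simp
  then have "(q + 1)\<^sup>2 > 4 * q" by (simp add: power2_eq_square algebra_simps)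
  then show "(q + 1)\<^sup>2 - t\<^sup>2 > 0" using t by simp
qed

lemma continuous_km_density: "continuous_on {- 2 * sqrt q..2 * sqrt q} (km_density q)"
  unfolding km_density_def using km_den_pos(1) by (intro continuous_intros) (force simp: less_imp_neq)

lemma km_density_nonneg: "t \<in> {- 2 * sqrt q..2 * sqrt q} \<Longrightarrow> km_density q t \<ge> 0"
  unfolding km_density_def using km_den_pos[of t] q by simp

text \<open>The analogue of the vanishing traces: for \<open>k > 0\<close> the polynomial
  \<open>nbp q k\<close> has mean zero. The case \<open>k = 0\<close> says that the density has
  total mass 1.\<close>

lemma km_nbp_integral:
  "((\<lambda>t. km_density q t * nbp q k t) has_integral (if k = 0 then 1 else 0)) {- 2 * sqrt q..2 * sqrt q}"
proof -
  define f where "f t = km_density q t * nbp q k t" for t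
  have cf: "continuous_on {- 2 * sqrt q..2 * sqrt q} f"
    unfolding f_def by (intro continuous_intros continuous_km_density continuous_nbp)
  \<comment> \<open>The cosine decreases on the interval, so the general substitution rule yields
    the integral with reversed endpoints, hence the minus sign below.\<close>
  have "((\<lambda>u. (- 2 * sqrt q * sin u) *\<^sub>R f (2 * sqrt q * cos u)) has_integral
      (integral {2 * sqrt q * cos 0..2 * sqrt q * cos pi} f - integral {2 * sqrt q * cos pi..2 * sqrt q * cos 0} f)) {0..pi}"
  proof (rule has_integral_substitution_general[of "{}" _ _ _ "- 2 * sqrt q" "2 * sqrt q"])
    have "\<bar>2 * sqrt q * cos u\<bar> \<le> 2 * sqrt q * 1" for u
      using q by (simp only: abs_mult) (intro mult_mono; simp)
    then show "(\<lambda>u. 2 * sqrt q * cos u) ` {0..pi} \<subseteq> {- 2 * sqrt q..2 * sqrt q}"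
      by (auto simp: abs_le_iff) (metis minus_le_iff mult_minus_right)
  qed (use cf in \<open>auto intro!: continuous_intros derivative_eq_intros\<close>)
  moreover have "integral {2 * sqrt q * cos 0..2 * sqrt q * cos pi} f = 0" using q by simp
  ultimately have 1: "((\<lambda>u. (- 2 * sqrt q * sin u) *\<^sub>R f (2 * sqrt q * cos u)) has_integral
      - integral {- 2 * sqrt q..2 * sqrt q} f) {0..pi}" by simp
  have eq: "(- 2 * sqrt q * sin u) *\<^sub>R f (2 * sqrt q * cos u) =
     - (2 * q * (q + 1) / pi) * (sin u * (sin u * nbp q k (2 * sqrt q * cos u)) / poisson_den u)"
    if "u \<in> {0..pi}" for u
  proof -
    have sq: "sqrt q * sqrt q = q" using q by simp
    have "4 * q - (2 * sqrt q * cos u)\<^sup>2 = (2 * sqrt q * sin u)\<^sup>2"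
      using q by (simp add: power_mult_distrib sin_squared_eq algebra_simps)
    moreover have "sin u \<ge> 0" using that sin_ge_zero by simp
    ultimately have r: "sqrt (4 * q - (2 * sqrt q * cos u)\<^sup>2) = 2 * sqrt q * sin u" using q by simp
    have d: "(q + 1)\<^sup>2 - (2 * sqrt q * cos u)\<^sup>2 = poisson_den u"
    proof -
      have "cos (2 * u) = 2 * (cos u)\<^sup>2 - 1" by (rule cos_double_cos)
      then show ?thesis unfolding poisson_den_def using q
        by (simp only:) (simp add: power_mult_distrib power2_sum algebra_simps)
    qed
    have "(- 2 * sqrt q * sin u) *\<^sub>R f (2 * sqrt q * cos u) =
      - (2 * sqrt q * sin u) * ((q + 1) * (2 * sqrt q * sin u) / (2 * pi * poisson_den u) * nbp q k (2 * sqrt q * cos u))"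
      by (simp add: f_def km_density_def r d)
    also have "\<dots> = - ((sqrt q * sqrt q) * 2 * (q + 1) / pi) * (sin u * (sin u * nbp q k (2 * sqrt q * cos u)) / poisson_den u)"
      using poisson_den_pos[of u] by (simp add: divide_simps)
    finally show ?thesis using q by (simp add: sq mult.commute)
  qed
  have "((\<lambda>u. (- 2 * sqrt q * sin u) *\<^sub>R f (2 * sqrt q * cos u)) has_integral
      - (2 * q * (q + 1) / pi) * (if k = 0 then pi / (2 * q * (q + 1)) else 0)) {0..pi}"
    using has_integral_mult_right[OF sin_product_integral[of k], of "- (2 * q * (q + 1) / pi)"]
    by (rule has_integral_eq[rotated]) (use eq in auto)
  from has_integral_unique[OF 1 this] have "integral {- 2 * sqrt q..2 * sqrt q} f = (if k = 0 then 1 else 0)"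
    using q by (simp split: if_splits)
  then show ?thesis
    using integrable_integral[OF integrable_continuous_real[OF cf]] by (simp add: f_def[abs_def])
qed

end

section \<open>Convergence of averages\<close>

definition km_integral :: "real \<Rightarrow> (real \<Rightarrow> real) \<Rightarrow> real" where
  "km_integral q f = integral {- 2 * sqrt q..2 * sqrt q} (\<lambda>t. km_density q t * f t)"

definition set_average :: "'a set \<Rightarrow> ('a \<Rightarrow> real) \<Rightarrow> (real \<Rightarrow> real) \<Rightarrow> real" where
  "set_average B l f = (\<Sum>b\<in>B. f (l b)) / real (card B)"

lemma set_average_add: "set_average B l (\<lambda>x. f x + g x) = set_average B l f + set_average B l g"
  by (simp add: set_average_def sum.distrib add_divide_distrib)

lemma set_average_cmult: "set_average B l (\<lambda>x. c * f x) = c * set_average B l f"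
  by (simp add: set_average_def sum_distrib_left)

lemma set_average_diff_le:
  assumes "finite B" "B \<noteq> {}" "\<And>b. b \<in> B \<Longrightarrow> \<bar>f (l b) - g (l b)\<bar> \<le> e"
  shows "\<bar>set_average B l f - set_average B l g\<bar> \<le> e"
proof -
  have c: "real (card B) > 0" using assms by (simp add: card_gt_0_iff)
  have "\<bar>\<Sum>b\<in>B. f (l b) - g (l b)\<bar> \<le> (\<Sum>b\<in>B. e)"
    by (rule order_trans[OF sum_abs sum_mono]) (rule assms(3))
  then have "\<bar>(\<Sum>b\<in>B. f (l b) - g (l b)) / real (card B)\<bar> \<le> e"
    using c by (simp add: field_simps)
  then show ?thesis by (simp add: set_average_def diff_divide_distrib sum_subtractf)
qed

context
  fixes q :: real
  assumes q: "q > 1"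
begin

abbreviation "km_support \<equiv> {- 2 * sqrt q..2 * sqrt q}"

lemma km_integrable: "continuous_on UNIV f \<Longrightarrow> (\<lambda>t. km_density q t * f t) integrable_on km_support"
  by (intro integrable_continuous_real continuous_intros continuous_km_density q) (blast intro: continuous_on_subset)

lemma km_integral_add:
  assumes "continuous_on UNIV f" "continuous_on UNIV g"
  shows "km_integral q (\<lambda>x. f x + g x) = km_integral q f + km_integral q g"
  unfolding km_integral_def distrib_left by (intro integral_add km_integrable assms)

lemma km_integral_cmult: "km_integral q (\<lambda>x. c * f x) = c * km_integral q f"
  unfolding km_integral_def by (simp add: mult.left_commute[of _ c])

lemma km_integral_nbp: "km_integral q (nbp q k) = (if k = 0 then 1 else 0)"
  unfolding km_integral_def by (rule integral_unique[OF km_nbp_integral[OF q]])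

lemma km_integral_diff_le:
  assumes f: "continuous_on UNIV f" and g: "continuous_on UNIV g"
    and e: "\<And>t. t \<in> km_support \<Longrightarrow> \<bar>f t - g t\<bar> \<le> e"
  shows "\<bar>km_integral q f - km_integral q g\<bar> \<le> e"
proof -
  have one: "((\<lambda>t. km_density q t * 1) has_integral 1) km_support"
    using km_nbp_integral[OF q, of 0] by simp
  have "km_integral q f - km_integral q g = integral km_support (\<lambda>t. km_density q t * f t - km_density q t * g t)"
    unfolding km_integral_def by (intro integral_diff[symmetric] km_integrable f g)
  also have "\<bar>\<dots>\<bar> \<le> integral km_support (\<lambda>t. e * (km_density q t * 1))"
    unfolding real_norm_def[symmetric]
  proof (rule integral_norm_bound_integral)
    show "(\<lambda>t. km_density q t * f t - km_density q t * g t) integrable_on km_support"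
      by (intro integrable_diff km_integrable f g)
    show "(\<lambda>t. e * (km_density q t * 1)) integrable_on km_support"
      using has_integral_mult_right[OF one, of e] by blast
    fix t assume t: "t \<in> km_support"
    have "norm (km_density q t * f t - km_density q t * g t) = km_density q t * \<bar>f t - g t\<bar>"
      using km_density_nonneg[OF q t] by (simp add: right_diff_distrib[symmetric] abs_mult)
    also have "\<dots> \<le> km_density q t * e"
      by (intro mult_left_mono e t km_density_nonneg q)
    finally show "norm (km_density q t * f t - km_density q t * g t) \<le> e * (km_density q t * 1)"
      by (simp add: mult.commute)
  qed
  also have "\<dots> = e" using integral_unique[OF has_integral_mult_right[OF one, of e]] by simp
  finally show ?thesis .
qed

context
  fixes B :: "nat \<Rightarrow> 'a set" and l :: "nat \<Rightarrow> 'a \<Rightarrow> real"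
  assumes B: "\<And>n. finite (B n)" "\<And>n. B n \<noteq> {}"
    and l: "\<And>n b. b \<in> B n \<Longrightarrow> \<bar>l n b\<bar> \<le> q + 1"
    and nbp_lim: "\<And>k. k > 0 \<Longrightarrow> (\<lambda>n. set_average (B n) (l n) (nbp q k)) \<longlonglongrightarrow> 0"
begin

text \<open>Products with \<open>nbp q j\<close> make the induction on the exponent work: the
  three-term recurrence read backwards writes \<open>x * nbp q j x\<close> through its neighbours in
  \<open>j\<close>, and averages and integrals are both linear. The case \<open>j = 0\<close> then
  gives the moments.\<close>

lemma average_power_nbp: "(\<lambda>n. set_average (B n) (l n) (\<lambda>x. x ^ m * nbp q j x)) \<longlonglongrightarrow> km_integral q (\<lambda>x. x ^ m * nbp q j x)"
proof (induction m arbitrary: j)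
  case 0
  show ?case
  proof (cases "j = 0")
    case True
    have "set_average (B n) (l n) (\<lambda>x. 1) = 1" for n
      using B[of n] by (simp add: set_average_def card_gt_0_iff)
    moreover have "nbp q 0 = (\<lambda>x. 1)" by (rule ext) simp
    ultimately show ?thesis using True km_integral_nbp[of 0] by simp
  next
    case False
    then show ?thesis using nbp_lim[of j] km_integral_nbp[of j] by simp
  qed
next
  case (Suc m)
  show ?case
  proof (cases j)
    case 0
    then show ?thesis using Suc[of 1] by (simp add: mult.commute)
  next
    case (Suc i)
    define c where "c = (if i = 0 then q + 1 else q)"
    have eq: "(\<lambda>x. x ^ Suc m * nbp q j x) = (\<lambda>x. x ^ m * nbp q (Suc j) x + c * (x ^ m * nbp q i x))"
      by (auto simp: Suc c_def algebra_simps)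
    have cont: "continuous_on UNIV (\<lambda>x. x ^ m * nbp q k x)" for k
      by (intro continuous_intros continuous_nbp)
    have "km_integral q (\<lambda>x. x ^ m * nbp q (Suc j) x + c * (x ^ m * nbp q i x))
        = km_integral q (\<lambda>x. x ^ m * nbp q (Suc j) x) + c * km_integral q (\<lambda>x. x ^ m * nbp q i x)"
      by (subst km_integral_add) (auto intro!: continuous_intros continuous_nbp simp: km_integral_cmult)
    then show ?thesis unfolding eq set_average_add set_average_cmult
      by (simp only:) (intro tendsto_intros Suc.IH)
  qed
qed

lemma average_polynomial:
  "(\<lambda>n. set_average (B n) (l n) (\<lambda>x. \<Sum>i\<le>m. a i * x ^ i)) \<longlonglongrightarrow> km_integral q (\<lambda>x. \<Sum>i\<le>m. a i * x ^ i)"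
proof -
  have p: "(\<lambda>n. set_average (B n) (l n) (\<lambda>x. a i * x ^ i)) \<longlonglongrightarrow> km_integral q (\<lambda>x. a i * x ^ i)" for i
    using tendsto_mult_left[OF average_power_nbp[of i 0], of "a i"]
    by (simp add: set_average_cmult km_integral_cmult)
  show ?thesis
  proof (induction m)
    case (Suc m)
    have "km_integral q (\<lambda>x. (\<Sum>i\<le>m. a i * x ^ i) + a (Suc m) * x ^ Suc m)
        = km_integral q (\<lambda>x. \<Sum>i\<le>m. a i * x ^ i) + km_integral q (\<lambda>x. a (Suc m) * x ^ Suc m)"
      by (intro km_integral_add continuous_intros)
    then show ?case unfolding sum.atMost_Suc set_average_add
      by (simp only:) (intro tendsto_add Suc p)
  qed (use p[of 0] in simp)
qed

text \<open>Polynomial approximation on \<open>[-(q+1), q+1]\<close>, which contains all eigenvalues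
  as well as the support of the limit.\<close>

lemma average_continuous:
  assumes f: "continuous_on UNIV f"
  shows "(\<lambda>n. set_average (B n) (l n) f) \<longlonglongrightarrow> km_integral q f"
proof (rule LIMSEQ_I)
  fix e :: real assume e: "e > 0"
  have cf: "continuous_on {- (q + 1)..q + 1} f" using f continuous_on_subset by blast
  obtain g where g: "real_polynomial_function g" "\<And>x. x \<in> {- (q + 1)..q + 1} \<Longrightarrow> \<bar>f x - g x\<bar> < e / 3"
    using Stone_Weierstrass_real_polynomial_function[OF _ cf, of "e / 3"] e by auto
  then obtain a m where gm: "g = (\<lambda>x. \<Sum>i\<le>m. a i * x ^ i)" by (auto simp: real_polynomial_function_iff_sum)
  have cg: "continuous_on UNIV g" unfolding gm by (intro continuous_intros)
  have lim: "(\<lambda>n. set_average (B n) (l n) g) \<longlonglongrightarrow> km_integral q g" unfolding gm by (rule average_polynomial)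
  have "e / 3 > 0" using e by simp
  from LIMSEQ_D[OF lim this]
  obtain N where N: "\<And>n. n \<ge> N \<Longrightarrow> \<bar>set_average (B n) (l n) g - km_integral q g\<bar> < e / 3"
    unfolding real_norm_def by blast
  \<comment> \<open>The inequality of arithmetic and geometric means: the support lies where the
    polynomial is close to \<open>f\<close>.\<close>
  have "2 * sqrt q \<le> q + 1"
  proof -
    have "(sqrt q - 1)\<^sup>2 \<ge> 0" by simp
    then show ?thesis using q by (simp add: power2_diff)
  qed
  then have *: "\<bar>km_integral q f - km_integral q g\<bar> \<le> e / 3"
    using g(2) by (intro km_integral_diff_le f cg) (auto intro!: less_imp_le)
  have **: "\<bar>set_average (B n) (l n) f - set_average (B n) (l n) g\<bar> \<le> e / 3" for n
  proof (rule set_average_diff_le[OF B])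
    fix b assume "b \<in> B n"
    then have "l n b \<in> {- (q + 1)..q + 1}" using l[of b n] by (auto simp: abs_le_iff)
    then show "\<bar>f (l n b) - g (l n b)\<bar> \<le> e / 3" using g(2) less_imp_le by blast
  qed
  have "norm (set_average (B n) (l n) f - km_integral q f) < e" if "n \<ge> N" for n
    using N[OF that] * **[of n] unfolding real_norm_def by linarith
  then show "\<exists>N. \<forall>n\<ge>N. norm (set_average (B n) (l n) f - km_integral q f) < e" by blast
qed

text \<open>The indicator cuts off meaningless values: outside the support the argument of the root
  is negative, and \<open>sqrt\<close> of a negative real is the negative of the root of its
  absolute value.\<close>

definition km_measure :: "real measure" where
  "km_measure = density lborel (\<lambda>t. ennreal (indicator km_support t * km_density q t))"

lemma measurable_km: "(\<lambda>t. indicator km_support t * km_density q t) \<in> borel_measurable borel"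
  unfolding km_density_def by measurable

lemma km_weight_nonneg: "indicator km_support t * km_density q t \<ge> 0"
  using km_density_nonneg[OF q] by (simp add: indicator_def)

lemma real_distribution_km: "real_distribution km_measure"
proof -
  have "emeasure km_measure (space km_measure) = (\<integral>\<^sup>+t. ennreal (indicator km_support t * km_density q t) \<partial>lborel)"
    unfolding km_measure_def using measurable_km by (subst emeasure_density) auto
  also have "\<dots> = 1"
  proof -
    have "(km_density q has_integral 1) km_support" using km_nbp_integral[OF q, of 0] by simp
    from nn_integral_has_integral_lebesgue[OF km_density_nonneg[OF q] this] show ?thesis by simp
  qed
  finally have "prob_space km_measure" by (rule prob_spaceI)
  then show ?thesis
    by (simp add: real_distribution_def real_distribution_axioms_def km_measure_def)
qed

lemma integral_km_measure:
  assumes "f \<in> borel_measurable borel"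
  shows "integral\<^sup>L km_measure f = (LINT t|lborel. indicator km_support t * km_density q t * f t)"
  unfolding km_measure_def using assms measurable_km km_weight_nonneg
  by (subst integral_density) auto

lemma integral_km_measure_continuous:
  assumes "continuous_on UNIV f"
  shows "integral\<^sup>L km_measure f = km_integral q f"
proof -
  have "continuous_on km_support (\<lambda>t. km_density q t * f t)"
    by (intro continuous_intros continuous_km_density q continuous_on_subset[OF assms]) simp
  then have "set_integrable lborel km_support (\<lambda>t. km_density q t * f t)"
    unfolding set_integrable_def by (intro borel_integrable_compact) auto
  then have "(LINT t:km_support|lborel. km_density q t * f t) = km_integral q f"
    unfolding km_integral_def by (rule set_borel_integral_eq_integral(2))
  moreover have "f \<in> borel_measurable borel" using assms by (rule borel_measurable_continuous_onI)
  ultimately show ?thesis by (simp add: integral_km_measure set_lebesgue_integral_def mult.assoc)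
qed

definition average_measure :: "nat \<Rightarrow> real measure" where
  "average_measure n = distr (measure_pmf (pmf_of_set (B n))) borel (l n)"

lemma real_distribution_average: "real_distribution (average_measure n)"
  unfolding real_distribution_def real_distribution_axioms_def average_measure_def
  by (auto intro!: prob_space.prob_space_distr prob_space_measure_pmf)

lemma integral_average_measure:
  "f \<in> borel_measurable borel \<Longrightarrow> integral\<^sup>L (average_measure n) f = set_average (B n) (l n) f"
  unfolding average_measure_def set_average_def
  by (subst integral_distr) (use B in \<open>auto simp: integral_pmf_of_set\<close>)

text \<open>The frontier of an interval is Lebesgue null, so \<open>I\<close> is a continuity set of
  the limit measure and weak convergence carries over to its mass.\<close>

theorem average_interval:
  assumes I: "is_interval I"
  shows "(\<lambda>n. real (card {b \<in> B n. l n b \<in> I}) / real (card (B n)))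
    \<longlonglongrightarrow> (LBINT t:I. km_density q t * indicator (km_support \<inter> I) t)"
proof -
  have Ib: "I \<in> sets borel" using I by (rule real_interval_borel_measurable)
  have fr: "emeasure km_measure (frontier I) = 0"
  proof -
    have "negligible (frontier I)" using I is_interval_convex negligible_convex_frontier by blast
    then have "frontier I \<in> null_sets lborel"
      by (simp add: negligible_iff_null_sets null_sets_completion_iff)
    then have "AE x in lborel. x \<notin> frontier I" by (rule AE_not_in)
    then have "frontier I \<in> null_sets km_measure"
      unfolding km_measure_def using measurable_km by (subst null_sets_density_iff) auto
    then show ?thesis by auto
  qed
  have "weak_conv_m average_measure km_measure"
  proof (rule integral_bdd_continuous_conv_imp_weak_conv)
    fix f :: "real \<Rightarrow> real" assume "\<And>x. isCont f x"
    then have f: "continuous_on UNIV f" by (simp add: continuous_at_imp_continuous_on)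
    then have "f \<in> borel_measurable borel" by (rule borel_measurable_continuous_onI)
    then show "(\<lambda>n. integral\<^sup>L (average_measure n) f) \<longlonglongrightarrow> integral\<^sup>L km_measure f"
      using average_continuous[OF f] by (simp add: integral_average_measure integral_km_measure_continuous[OF f])
  qed (use real_distribution_km real_distribution_average in auto)
  then have "(\<lambda>n. measure (average_measure n) I) \<longlonglongrightarrow> measure km_measure I"
    by (intro weak_conv_imp_continuity_set_conv real_distribution_km real_distribution_average Ib fr)
  moreover have "measure (average_measure n) I = real (card {b \<in> B n. l n b \<in> I}) / real (card (B n))" for n
    unfolding average_measure_def using Ib B[of n]
    by (subst measure_distr) (auto simp: measure_pmf_of_set Int_def)
  moreover have "measure km_measure I = (LBINT t:I. km_density q t * indicator (km_support \<inter> I) t)"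
  proof -
    have "measure km_measure I = integral\<^sup>L km_measure (indicator I)"
      using Ib by (simp add: km_measure_def)
    also have "\<dots> = (LINT t|lborel. indicator km_support t * km_density q t * indicator I t)"
      using Ib by (intro integral_km_measure) auto
    also have "\<dots> = (LBINT t:I. km_density q t * indicator (km_support \<inter> I) t)"
      unfolding set_lebesgue_integral_def by (intro Bochner_Integration.integral_cong) (auto simp: indicator_def)
    finally show ?thesis .
  qed
  ultimately show ?thesis by simp
qed

end
end

section \<open>Symmetric powers of two-by-two matrices\<close>

definition sym_mono :: "nat \<Rightarrow> nat \<Rightarrow> complex^2 \<Rightarrow> complex" where
  "sym_mono p j z = (z $ 1) ^ (p - j) * (z $ 2) ^ j"

text \<open>The choice is unique only at indices \<open>j \<le> p\<close>, hence this side condition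
  in the rules for coefficients.\<close>

definition sym_coeff :: "nat \<Rightarrow> (complex^2 \<Rightarrow> complex) \<Rightarrow> nat \<Rightarrow> complex" where
  "sym_coeff p s = (SOME c. \<forall>z. s z = (\<Sum>j\<le>p. c j * sym_mono p j z))"

lemma Sym_poly_iff: "s \<in> Sym_poly p \<longleftrightarrow> (\<exists>c. \<forall>z. s z = (\<Sum>j\<le>p. c j * sym_mono p j z))"
  by (simp add: Sym_poly_def sym_mono_def mult.assoc)

lemma sym_expand: "s \<in> Sym_poly p \<Longrightarrow> s z = (\<Sum>j\<le>p. sym_coeff p s j * sym_mono p j z)"
  unfolding sym_coeff_def Sym_poly_iff by (drule someI_ex) (rule spec)

lemma sym_mono_unique:
  assumes "\<And>z. (\<Sum>j\<le>p. c j * sym_mono p j z) = (\<Sum>j\<le>p. d j * sym_mono p j z)" "j \<le> p"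
  shows "c j = d j"
proof -
  have "(\<Sum>j\<le>p. c j * t ^ j) = (\<Sum>j\<le>p. d j * t ^ j)" for t
    \<comment> \<open>Dehomogenising at \<open>(1, t)\<close> gives polynomials in one
      variable.\<close>
    using assms(1)[of "vector [1, t]"] by (simp add: sym_mono_def)
  then have "\<forall>j\<le>p. c j = d j" using polyfun_eq_coeffs[of c p d] by blast
  then show ?thesis using assms(2) by blast
qed

lemma sym_coeff_eq:
  assumes "\<And>z. s z = (\<Sum>j\<le>p. c j * sym_mono p j z)" "j \<le> p"
  shows "sym_coeff p s j = c j"
proof -
  have "s \<in> Sym_poly p" using assms by (auto simp: Sym_poly_iff)
  from sym_expand[OF this] have "(\<Sum>j\<le>p. sym_coeff p s j * sym_mono p j z) = (\<Sum>j\<le>p. c j * sym_mono p j z)" for z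
    by (rule trans[OF sym]) (rule assms(1))
  then show ?thesis using assms(2) by (rule sym_mono_unique)
qed

lemma Sym_polyI: "(\<And>z. s z = (\<Sum>j\<le>p. c j * sym_mono p j z)) \<Longrightarrow> s \<in> Sym_poly p"
  by (auto simp: Sym_poly_iff)

lemma sym_add_expand:
  assumes "s \<in> Sym_poly p" "t \<in> Sym_poly p"
  shows "s z + t z = (\<Sum>j\<le>p. (sym_coeff p s j + sym_coeff p t j) * sym_mono p j z)"
  using sym_expand[OF assms(1), of z] sym_expand[OF assms(2), of z] by (simp add: distrib_right sum.distrib)

lemma sym_cmult_expand:
  assumes "s \<in> Sym_poly p"
  shows "c * s z = (\<Sum>j\<le>p. (c * sym_coeff p s j) * sym_mono p j z)"
  using sym_expand[OF assms(1), of z] by (simp add: sum_distrib_left mult.assoc)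

lemma sym_mono_expand:
  "j \<le> p \<Longrightarrow> sym_mono p j z = (\<Sum>i\<le>p. (if i = j then 1 else 0) * sym_mono p i z)"
  by (simp add: if_distrib[of "\<lambda>x. x * _"] cong: if_cong)

lemma sym_zero_expand: "0 = (\<Sum>j\<le>p. 0 * sym_mono p j z)"
  by simp

lemma Sym_poly_add: "s \<in> Sym_poly p \<Longrightarrow> t \<in> Sym_poly p \<Longrightarrow> (\<lambda>z. s z + t z) \<in> Sym_poly p"
  by (rule Sym_polyI[OF sym_add_expand])

lemma Sym_poly_cmult: "s \<in> Sym_poly p \<Longrightarrow> (\<lambda>z. c * s z) \<in> Sym_poly p"
  by (rule Sym_polyI[OF sym_cmult_expand])

lemma Sym_poly_zero: "(\<lambda>z. 0) \<in> Sym_poly p"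
  by (rule Sym_polyI[OF sym_zero_expand])

lemma Sym_poly_sum: "(\<And>i. i \<in> A \<Longrightarrow> f i \<in> Sym_poly p) \<Longrightarrow> (\<lambda>z. \<Sum>i\<in>A. f i z) \<in> Sym_poly p"
  by (induction A rule: infinite_finite_induct) (simp_all add: Sym_poly_zero Sym_poly_add)

lemma sym_mono_in_Sym_poly: "j \<le> p \<Longrightarrow> sym_mono p j \<in> Sym_poly p"
  by (rule Sym_polyI[OF sym_mono_expand])

lemma sym_coeff_mono: "i \<le> p \<Longrightarrow> j \<le> p \<Longrightarrow> sym_coeff p (sym_mono p j) i = (if i = j then 1 else 0)"
  by (rule sym_coeff_eq[OF sym_mono_expand])

lemma sym_coeff_add:
  "s \<in> Sym_poly p \<Longrightarrow> t \<in> Sym_poly p \<Longrightarrow> j \<le> p \<Longrightarrow> sym_coeff p (\<lambda>z. s z + t z) j = sym_coeff p s j + sym_coeff p t j"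
  by (rule sym_coeff_eq[OF sym_add_expand])

lemma sym_coeff_cmult:
  "s \<in> Sym_poly p \<Longrightarrow> j \<le> p \<Longrightarrow> sym_coeff p (\<lambda>z. c * s z) j = c * sym_coeff p s j"
  by (rule sym_coeff_eq[OF sym_cmult_expand])

lemma sym_coeff_zero: "j \<le> p \<Longrightarrow> sym_coeff p (\<lambda>z. 0) j = 0"
  by (rule sym_coeff_eq[OF sym_zero_expand])

lemma Sym_poly_linear_mult:
  assumes "s \<in> Sym_poly p" shows "(\<lambda>z. (a * z $ 1 + b * z $ 2) * s z) \<in> Sym_poly (Suc p)"
proof -
  define c where "c = sym_coeff p s"
  have e: "s z = (\<Sum>j\<le>p. c j * sym_mono p j z)" for z
    unfolding c_def by (rule sym_expand[OF assms])
  have 1: "(\<lambda>z. z $ 1 * s z) \<in> Sym_poly (Suc p)"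
  proof (rule Sym_polyI[where c = "\<lambda>j. if j \<le> p then c j else 0"])
    fix z :: "complex^2"
    have "z $ 1 * s z = (\<Sum>j\<le>p. c j * sym_mono (Suc p) j z)"
      unfolding e[of z] sum_distrib_left
      by (intro sum.cong refl) (simp add: sym_mono_def Suc_diff_le)
    then show "z $ 1 * s z = (\<Sum>j\<le>Suc p. (if j \<le> p then c j else 0) * sym_mono (Suc p) j z)" by simp
  qed
  have 2: "(\<lambda>z. z $ 2 * s z) \<in> Sym_poly (Suc p)"
  proof (rule Sym_polyI[where c = "\<lambda>j. case j of 0 \<Rightarrow> 0 | Suc i \<Rightarrow> c i"])
    fix z :: "complex^2"
    have "z $ 2 * s z = (\<Sum>j\<le>p. c j * sym_mono (Suc p) (Suc j) z)"
      unfolding e[of z] sum_distrib_left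
      by (intro sum.cong refl) (simp add: sym_mono_def)
    then show "z $ 2 * s z = (\<Sum>j\<le>Suc p. (case j of 0 \<Rightarrow> 0 | Suc i \<Rightarrow> c i) * sym_mono (Suc p) j z)"
      by (subst sum.atMost_Suc_shift) simp
  qed
  have "(\<lambda>z. a * (z $ 1 * s z) + b * (z $ 2 * s z)) \<in> Sym_poly (Suc p)"
    by (intro Sym_poly_add Sym_poly_cmult 1 2)
  then show ?thesis by (simp add: distrib_right mult.assoc)
qed

lemma Sym_poly_linear_power_mult:
  assumes "s \<in> Sym_poly p" shows "(\<lambda>z. (a * z $ 1 + b * z $ 2) ^ m * s z) \<in> Sym_poly (m + p)"
  by (induction m) (use assms Sym_poly_linear_mult in \<open>simp_all add: mult.assoc\<close>)

lemma matrix_vector_mult_2: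
  fixes M :: "complex^2^2"
  shows "(M *v z) $ 1 = M $ 1 $ 1 * z $ 1 + M $ 1 $ 2 * z $ 2" "(M *v z) $ 2 = M $ 2 $ 1 * z $ 1 + M $ 2 $ 2 * z $ 2"
  by (simp_all add: matrix_vector_mult_def sum_2)

lemma sym_mono_matrix_in_Sym_poly: "j \<le> p \<Longrightarrow> (\<lambda>z. sym_mono p j (M *v z)) \<in> Sym_poly p"
proof -
  assume j: "j \<le> p"
  have "(\<lambda>z. 1) \<in> Sym_poly 0" by (rule Sym_polyI[where c = "\<lambda>j. 1"]) (simp add: sym_mono_def)
  then have "(\<lambda>z. (M $ 1 $ 1 * z $ 1 + M $ 1 $ 2 * z $ 2) ^ (p - j) * ((M $ 2 $ 1 * z $ 1 + M $ 2 $ 2 * z $ 2) ^ j * 1))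
      \<in> Sym_poly ((p - j) + (j + 0))"
    by (intro Sym_poly_linear_power_mult)
  then show ?thesis using j by (simp add: sym_mono_def[abs_def] matrix_vector_mult_2)
qed

lemma Sym_poly_matrix:
  assumes "s \<in> Sym_poly p" shows "(\<lambda>z. s (M *v z)) \<in> Sym_poly p"
proof -
  have "(\<lambda>z. \<Sum>j\<le>p. sym_coeff p s j * sym_mono p j (M *v z)) \<in> Sym_poly p"
    by (intro Sym_poly_sum Sym_poly_cmult sym_mono_matrix_in_Sym_poly) simp
  moreover have "(\<lambda>z. s (M *v z)) = (\<lambda>z. \<Sum>j\<le>p. sym_coeff p s j * sym_mono p j (M *v z))"
    by (rule ext) (rule sym_expand[OF assms])
  ultimately show ?thesis by (simp only:)
qed

text \<open>Row \<open>j\<close> holds the coefficients of the \<open>j\<close>-th monomial after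
  substituting \<open>M\<close>. With rows rather than columns, the symmetric power is
  multiplicative in the order of \<open>M ** N\<close>.\<close>

definition sym_matrix :: "nat \<Rightarrow> complex^2^2 \<Rightarrow> nat \<Rightarrow> nat \<Rightarrow> complex" where
  "sym_matrix p M j k = sym_coeff p (\<lambda>z. sym_mono p j (M *v z)) k"

lemma sym_mono_matrix: "j \<le> p \<Longrightarrow> sym_mono p j (M *v z) = (\<Sum>k\<le>p. sym_matrix p M j k * sym_mono p k z)"
  unfolding sym_matrix_def by (rule sym_expand[OF sym_mono_matrix_in_Sym_poly])

lemma sym_matrix_eq:
  assumes "\<And>z. sym_mono p j (M *v z) = (\<Sum>k\<le>p. c k * sym_mono p k z)" "k \<le> p"
  shows "sym_matrix p M j k = c k"
  unfolding sym_matrix_def using assms by (rule sym_coeff_eq)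

lemma sym_coeff_matrix:
  assumes "s \<in> Sym_poly p" "k \<le> p"
  shows "sym_coeff p (\<lambda>z. s (M *v z)) k = (\<Sum>j\<le>p. sym_coeff p s j * sym_matrix p M j k)"
proof (rule sym_coeff_eq[OF _ assms(2)])
  fix z
  have "s (M *v z) = (\<Sum>j\<le>p. sym_coeff p s j * sym_mono p j (M *v z))"
    by (rule sym_expand[OF assms(1)])
  also have "\<dots> = (\<Sum>j\<le>p. \<Sum>k\<le>p. sym_coeff p s j * sym_matrix p M j k * sym_mono p k z)"
    by (intro sum.cong refl) (simp add: sym_mono_matrix sum_distrib_left mult.assoc)
  finally show "s (M *v z) = (\<Sum>k\<le>p. (\<Sum>j\<le>p. sym_coeff p s j * sym_matrix p M j k) * sym_mono p k z)"
    by (subst (asm) sum.swap) (simp add: sum_distrib_right)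
qed

lemma sym_matrix_mult:
  assumes "j \<le> p" "k \<le> p"
  shows "sym_matrix p (M ** N) j k = (\<Sum>i\<le>p. sym_matrix p M j i * sym_matrix p N i k)"
proof -
  have "sym_matrix p (M ** N) j k = sym_coeff p (\<lambda>z. sym_mono p j (M *v (N *v z))) k"
    by (simp add: sym_matrix_def matrix_vector_mul_assoc)
  also have "\<dots> = (\<Sum>i\<le>p. sym_matrix p M j i * sym_matrix p N i k)"
    using sym_coeff_matrix[OF sym_mono_matrix_in_Sym_poly[OF assms(1)] assms(2)] by (simp add: sym_matrix_def)
  finally show ?thesis .
qed

lemma sym_matrix_diagonal:
  assumes "M $ 1 $ 2 = 0" "M $ 2 $ 1 = 0" "j \<le> p" "k \<le> p"
  shows "sym_matrix p M j k = (if k = j then (M $ 1 $ 1) ^ (p - j) * (M $ 2 $ 2) ^ j else 0)"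
proof (rule sym_matrix_eq[OF _ assms(4)])
  fix z
  have "sym_mono p j (M *v z) = (M $ 1 $ 1) ^ (p - j) * (M $ 2 $ 2) ^ j * sym_mono p j z"
    by (simp add: sym_mono_def matrix_vector_mult_2 assms power_mult_distrib)
  then show "sym_mono p j (M *v z) = (\<Sum>k\<le>p. (if k = j then (M $ 1 $ 1) ^ (p - j) * (M $ 2 $ 2) ^ j else 0) * sym_mono p k z)"
    using assms(3) by (simp add: if_distrib[of "\<lambda>x. x * _"] cong: if_cong)
qed

definition sym_trace :: "nat \<Rightarrow> complex^2^2 \<Rightarrow> complex" where
  "sym_trace p M = (\<Sum>j\<le>p. sym_matrix p M j j)"

lemma sym_trace_commute: "sym_trace p (M ** N) = sym_trace p (N ** M)"
proof -
  have "sym_trace p (M ** N) = (\<Sum>j\<le>p. \<Sum>i\<le>p. sym_matrix p M j i * sym_matrix p N i j)"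
    by (simp add: sym_trace_def sym_matrix_mult)
  also have "\<dots> = (\<Sum>i\<le>p. \<Sum>j\<le>p. sym_matrix p N i j * sym_matrix p M j i)"
    by (subst sum.swap) (simp add: mult.commute)
  also have "\<dots> = sym_trace p (N ** M)" by (simp add: sym_trace_def sym_matrix_mult)
  finally show ?thesis .
qed

lemma sym_trace_similar:
  assumes "S ** M = D ** S" "S ** S' = mat 1" "S' ** S = mat 1"
  shows "sym_trace p M = sym_trace p D"
proof -
  have "sym_trace p M = sym_trace p (S' ** (S ** M))" by (simp add: matrix_mul_assoc assms(3))
  also have "\<dots> = sym_trace p ((D ** S) ** S')" by (simp add: sym_trace_commute[of _ S'] assms(1))
  also have "(D ** S) ** S' = D" by (simp add: matrix_mul_assoc[symmetric] assms(2))
  finally show ?thesis .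
qed

lemma sym_trace_diagonal:
  assumes "M $ 1 $ 2 = 0" "M $ 2 $ 1 = 0"
  shows "sym_trace p M = (\<Sum>j\<le>p. (M $ 1 $ 1) ^ (p - j) * (M $ 2 $ 2) ^ j)"
  unfolding sym_trace_def by (intro sum.cong refl) (simp add: sym_matrix_diagonal[OF assms])

lemma matrix2_eqI:
  fixes M N :: "'a^2^2"
  assumes "M $ 1 $ 1 = N $ 1 $ 1" "M $ 1 $ 2 = N $ 1 $ 2" "M $ 2 $ 1 = N $ 2 $ 1" "M $ 2 $ 2 = N $ 2 $ 2"
  shows "M = N"
  using assms by (simp add: vec_eq_iff forall_2)

lemma matrix_mult_2:
  fixes M N :: "complex^2^2"
  shows "(M ** N) $ i $ j = M $ i $ 1 * N $ 1 $ j + M $ i $ 2 * N $ 2 $ j"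
  by (simp add: matrix_matrix_mult_def sum_2)

lemma mat_1_entries: "(mat 1 :: complex^2^2) $ 1 $ 1 = 1" "(mat 1 :: complex^2^2) $ 1 $ 2 = 0"
  "(mat 1 :: complex^2^2) $ 2 $ 1 = 0" "(mat 1 :: complex^2^2) $ 2 $ 2 = 1"
  by (simp_all add: mat_def)

text \<open>Explicit diagonalisation. The nonzero entry supplies eigenvectors for both eigenvalues;
  diagonal matrices are covered by \<open>sym_trace_diagonal\<close>.\<close>

lemma sym_trace_eigenvalues:
  fixes M :: "complex^2^2"
  assumes ev: "\<alpha> + \<beta> = M $ 1 $ 1 + M $ 2 $ 2" "\<alpha> * \<beta> = M $ 1 $ 1 * M $ 2 $ 2 - M $ 1 $ 2 * M $ 2 $ 1"
    and ne: "\<alpha> \<noteq> \<beta>" "M $ 2 $ 1 \<noteq> 0"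
  shows "sym_trace p M = (\<Sum>j\<le>p. \<alpha> ^ (p - j) * \<beta> ^ j)"
proof -
  define a b c d where abcd: "a = M $ 1 $ 1" "b = M $ 1 $ 2" "c = M $ 2 $ 1" "d = M $ 2 $ 2"
  have d: "d = \<alpha> + \<beta> - a" using ev(1) by (simp add: abcd)
  have bc: "b * c = a * d - \<alpha> * \<beta>" using ev(2) by (simp add: abcd)
  \<comment> \<open>The rows of \<open>S\<close> are left eigenvectors of \<open>M\<close>, and
    \<open>e\<close> is the inverse of the determinant of \<open>S\<close>.\<close>
  define S :: "complex^2^2" where "S = vector [vector [c, \<alpha> - a], vector [c, \<beta> - a]]"
  define e where "e = 1 / (c * (\<beta> - \<alpha>))"
  define S' :: "complex^2^2" where "S' = vector [vector [e * (\<beta> - a), - e * (\<alpha> - a)], vector [- e * c, e * c]]"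
  define D :: "complex^2^2" where "D = vector [vector [\<alpha>, 0], vector [0, \<beta>]]"
  have ne': "c \<noteq> 0" "\<beta> - \<alpha> \<noteq> 0" using ne by (simp_all add: abcd)
  have e: "e * (c * (\<beta> - \<alpha>)) = 1" using ne' by (simp add: e_def)
  have "S ** M = D ** S"
    by (rule matrix2_eqI; simp add: matrix_mult_2 S_def D_def abcd[symmetric] d)
      (use bc in \<open>simp_all add: d algebra_simps\<close>)
  moreover have "S ** S' = mat 1" "S' ** S = mat 1"
    by (rule matrix2_eqI; use e in \<open>simp add: matrix_mult_2 S_def S'_def mat_1_entries algebra_simps\<close>)+
  ultimately have "sym_trace p M = sym_trace p D" by (rule sym_trace_similar)
  then show ?thesis by (simp add: sym_trace_diagonal D_def)
qed

text \<open>The geometric sum is a difference of two \<open>(p+1)\<close>-th powers of unit numbers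
  divided by the difference of the numbers, hence bounded independently of \<open>p\<close>.\<close>

lemma norm_geometric_sum_le:
  fixes \<alpha> \<beta> :: complex
  assumes "cmod \<alpha> = 1" "cmod \<beta> = 1" "\<alpha> \<noteq> \<beta>"
  shows "cmod (\<Sum>j\<le>p. \<alpha> ^ (p - j) * \<beta> ^ j) \<le> 2 / cmod (\<alpha> - \<beta>)"
proof -
  have "\<beta> ^ Suc p - \<alpha> ^ Suc p = (\<beta> - \<alpha>) * (\<Sum>j<Suc p. \<beta> ^ j * \<alpha> ^ (p - j))"
    by (rule diff_power_eq_sum)
  also have "(\<Sum>j<Suc p. \<beta> ^ j * \<alpha> ^ (p - j)) = (\<Sum>j\<le>p. \<alpha> ^ (p - j) * \<beta> ^ j)"
    by (intro sum.cong) auto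
  finally have "cmod (\<beta> - \<alpha>) * cmod (\<Sum>j\<le>p. \<alpha> ^ (p - j) * \<beta> ^ j) = cmod (\<beta> ^ Suc p - \<alpha> ^ Suc p)"
    by (simp only: norm_mult)
  also have "\<dots> \<le> cmod (\<beta> ^ Suc p) + cmod (\<alpha> ^ Suc p)" by (rule norm_triangle_ineq4)
  also have "\<dots> = 2" using assms by (simp only: norm_power) simp
  finally show ?thesis using assms(3) by (simp add: field_simps norm_minus_commute)
qed

text \<open>This is \<open>p + 1\<close> times the invariant inner product given by integration:
  monomials are orthogonal, with squared norms inversely proportional to the binomial coefficients.
  The adjoint of a substitution is then found algebraically.\<close>

definition sym_form :: "nat \<Rightarrow> (complex^2 \<Rightarrow> complex) \<Rightarrow> (complex^2 \<Rightarrow> complex) \<Rightarrow> complex" where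
  "sym_form p s t = (\<Sum>j\<le>p. sym_coeff p s j * cnj (sym_coeff p t j) / of_nat (p choose j))"

definition mat_adjoint :: "complex^2^2 \<Rightarrow> complex^2^2" where
  "mat_adjoint M = (\<chi> i j. cnj (M $ j $ i))"

text \<open>Both sides are coefficients of the polynomial \<open>(w\<^sup>T M z)\<^sup>p\<close>.\<close>

lemma sym_matrix_transpose:
  assumes "j \<le> p" "k \<le> p"
  shows "of_nat (p choose j) * sym_matrix p M j k = of_nat (p choose k) * sym_matrix p (transpose M) k j"
proof -
  have binom: "(w $ 1 * z $ 1 + w $ 2 * z $ 2) ^ p = (\<Sum>j\<le>p. of_nat (p choose j) * sym_mono p j w * sym_mono p j z)"
    for w z :: "complex^2"
  proof -
    have "(w $ 2 * z $ 2 + w $ 1 * z $ 1) ^ p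
        = (\<Sum>j\<le>p. of_nat (p choose j) * (w $ 2 * z $ 2) ^ j * (w $ 1 * z $ 1) ^ (p - j))"
      by (rule binomial_ring)
    then show ?thesis by (simp add: sym_mono_def power_mult_distrib add.commute mult_ac)
  qed
  have eq: "(\<Sum>k\<le>p. (\<Sum>j\<le>p. of_nat (p choose j) * sym_matrix p M j k * sym_mono p j w) * sym_mono p k z)
      = (\<Sum>k\<le>p. (\<Sum>j\<le>p. of_nat (p choose k) * sym_matrix p (transpose M) k j * sym_mono p j w) * sym_mono p k z)" for w z
  proof -
    have "(\<Sum>k\<le>p. (\<Sum>j\<le>p. of_nat (p choose j) * sym_matrix p M j k * sym_mono p j w) * sym_mono p k z)
        = (\<Sum>j\<le>p. of_nat (p choose j) * sym_mono p j w * sym_mono p j (M *v z))"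
      unfolding sum_distrib_right
      by (subst sum.swap) (intro sum.cong refl, simp add: sym_mono_matrix sum_distrib_left mult_ac)
    also have "\<dots> = (\<Sum>k\<le>p. of_nat (p choose k) * sym_mono p k z * sym_mono p k (transpose M *v w))"
      unfolding binom[symmetric] by (simp add: matrix_vector_mult_2 transpose_def algebra_simps)
    also have "\<dots> = (\<Sum>k\<le>p. (\<Sum>j\<le>p. of_nat (p choose k) * sym_matrix p (transpose M) k j * sym_mono p j w) * sym_mono p k z)"
      by (intro sum.cong refl) (simp add: sym_mono_matrix sum_distrib_left sum_distrib_right mult_ac
        del: transpose_matrix_vector)
    finally show ?thesis .
  qed
  have "(\<Sum>j\<le>p. of_nat (p choose j) * sym_matrix p M j k * sym_mono p j w)
      = (\<Sum>j\<le>p. of_nat (p choose k) * sym_matrix p (transpose M) k j * sym_mono p j w)" for w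
    using eq by (rule sym_mono_unique[OF _ assms(2)])
  then show ?thesis by (rule sym_mono_unique[OF _ assms(1)])
qed

lemma sym_matrix_cnj:
  assumes "j \<le> p" "k \<le> p"
  shows "sym_matrix p (mat_adjoint M) j k = cnj (sym_matrix p (transpose M) j k)"
proof (rule sym_matrix_eq[OF _ assms(2)])
  fix z :: "complex^2"
  define z' :: "complex^2" where "z' = (\<chi> i. cnj (z $ i))"
  have "sym_mono p j (mat_adjoint M *v z) = cnj (sym_mono p j (transpose M *v z'))"
    by (simp add: sym_mono_def matrix_vector_mult_2 mat_adjoint_def transpose_def z'_def)
  also have "\<dots> = (\<Sum>k\<le>p. cnj (sym_matrix p (transpose M) j k) * sym_mono p k z)"
    using assms(1) by (simp add: sym_mono_matrix del: transpose_matrix_vector) (simp add: sym_mono_def z'_def)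
  finally show "sym_mono p j (mat_adjoint M *v z) = (\<Sum>k\<le>p. cnj (sym_matrix p (transpose M) j k) * sym_mono p k z)" .
qed

text \<open>The binomial weights of the form are the ones that \<open>sym_matrix_transpose\<close>
  exchanges, so substituting the adjoint matrix gives the adjoint operator.\<close>

lemma sym_form_adjoint:
  assumes "s \<in> Sym_poly p" "t \<in> Sym_poly p"
  shows "sym_form p (\<lambda>z. s (M *v z)) t = sym_form p s (\<lambda>z. t (mat_adjoint M *v z))"
proof -
  have "sym_form p (\<lambda>z. s (M *v z)) t
      = (\<Sum>k\<le>p. \<Sum>j\<le>p. sym_coeff p s j * sym_matrix p M j k * cnj (sym_coeff p t k) / of_nat (p choose k))"
    by (simp add: sym_form_def sym_coeff_matrix assms sum_distrib_right sum_divide_distrib)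
  also have "\<dots> = (\<Sum>k\<le>p. \<Sum>j\<le>p. sym_coeff p s j * (cnj (sym_coeff p t k) * cnj (sym_matrix p (mat_adjoint M) k j)) / of_nat (p choose j))"
  proof (intro sum.cong refl)
    fix j k assume jk: "k \<in> {..p}" "j \<in> {..p}"
    then have "of_nat (p choose j) * sym_matrix p M j k = of_nat (p choose k) * sym_matrix p (transpose M) k j"
      by (intro sym_matrix_transpose) auto
    then have "sym_matrix p M j k / of_nat (p choose k) = sym_matrix p (transpose M) k j / of_nat (p choose j)"
      using jk by (simp add: field_simps)
    then have "sym_coeff p s j * cnj (sym_coeff p t k) * (sym_matrix p M j k / of_nat (p choose k))
      = sym_coeff p s j * cnj (sym_coeff p t k) * (sym_matrix p (transpose M) k j / of_nat (p choose j))" by simp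
    then show "sym_coeff p s j * sym_matrix p M j k * cnj (sym_coeff p t k) / of_nat (p choose k)
        = sym_coeff p s j * (cnj (sym_coeff p t k) * cnj (sym_matrix p (mat_adjoint M) k j)) / of_nat (p choose j)"
      using jk by (simp add: sym_matrix_cnj mult_ac)
  qed
  also have "\<dots> = (\<Sum>j\<le>p. \<Sum>k\<le>p. sym_coeff p s j * (cnj (sym_coeff p t k) * cnj (sym_matrix p (mat_adjoint M) k j)) / of_nat (p choose j))"
    by (rule sum.swap)
  also have "\<dots> = sym_form p s (\<lambda>z. t (mat_adjoint M *v z))"
    by (simp add: sym_form_def sym_coeff_matrix assms sum_distrib_left sum_divide_distrib)
  finally show ?thesis .
qed

section \<open>Sections over the Cayley graph\<close>

text \<open>The matrix without the factor \<open>1 / sqrt p0\<close>: words are multiplied as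
  integral quaternions and normalised at the end.\<close>

definition cq :: "quat \<Rightarrow> complex^2^2" where
  "cq = (\<lambda>(a0, a1, a2, a3).
     vector [vector [of_int a0 + \<i> * of_int a1, of_int a2 + \<i> * of_int a3],
             vector [- of_int a2 + \<i> * of_int a3, of_int a0 - \<i> * of_int a1]])"

lemma cq_entries:
  "cq (a0, a1, a2, a3) $ 1 $ 1 = of_int a0 + \<i> * of_int a1"
  "cq (a0, a1, a2, a3) $ 1 $ 2 = of_int a2 + \<i> * of_int a3"
  "cq (a0, a1, a2, a3) $ 2 $ 1 = - of_int a2 + \<i> * of_int a3"
  "cq (a0, a1, a2, a3) $ 2 $ 2 = of_int a0 - \<i> * of_int a1"
  by (simp_all add: cq_def)

lemma cq_qmul: "cq (qmul a b) = cq a ** cq b"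
  by (cases a; cases b)
    (intro matrix2_eqI; simp add: matrix_mult_2 cq_entries qmul_def complex_eq_iff algebra_simps)

lemma cq_scalar: "cq (c, 0, 0, 0) = of_int c *\<^sub>R mat 1"
  by (intro matrix2_eqI) (simp_all add: cq_entries mat_1_entries complex_eq_iff)

lemma mat_adjoint_cq: "mat_adjoint (r *\<^sub>R cq a) = r *\<^sub>R cq (qconj a)"
  by (cases a) (intro matrix2_eqI; simp add: mat_adjoint_def cq_entries qconj_def complex_eq_iff)

lemma scaleR_matrix_mult:
  fixes M N :: "complex^2^2"
  shows "(r *\<^sub>R M) ** (s *\<^sub>R N) = (r * s) *\<^sub>R (M ** N)"
  by (intro matrix2_eqI) (simp_all add: matrix_mult_2 scaleR_right_distrib mult.commute)

lemma quat_SU2_eq: "quat_SU2 p0 a = (1 / sqrt (real p0)) *\<^sub>R cq a"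
  by (cases a) (simp add: quat_SU2_def cq_def)

lemma quat_SU2_mult_qconj:
  assumes "qnorm a = int p0" "p0 > 0"
  shows "quat_SU2 p0 a ** quat_SU2 p0 (qconj a) = mat 1"
proof -
  have "cq a ** cq (qconj a) = real p0 *\<^sub>R mat 1"
    by (simp add: cq_qmul[symmetric] qmul_qconj assms cq_scalar)
  then show ?thesis using assms(2) by (simp add: quat_SU2_eq scaleR_matrix_mult)
qed

lemma matrix_inv_quat_SU2:
  assumes "qnorm a = int p0" "p0 > 0"
  shows "matrix_inv (quat_SU2 p0 a) = quat_SU2 p0 (qconj a)"
proof -
  let ?A = "quat_SU2 p0 a" and ?B = "quat_SU2 p0 (qconj a)"
  have AB: "?A ** ?B = mat 1" "?B ** ?A = mat 1"
    using quat_SU2_mult_qconj[of a] quat_SU2_mult_qconj[of "qconj a"] assms by simp_all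
  then have "?A ** matrix_inv ?A = mat 1 \<and> matrix_inv ?A ** ?A = mat 1"
    unfolding matrix_inv_def by (intro someI[of "\<lambda>X. ?A ** X = mat 1 \<and> X ** ?A = mat 1"]) simp
  then have "matrix_inv ?A = matrix_inv ?A ** (?A ** ?B)" using AB by simp
  also have "\<dots> = ?B" using \<open>?A ** matrix_inv ?A = mat 1 \<and> _\<close> by (simp add: matrix_mul_assoc)
  finally show ?thesis .
qed

text \<open>The eigenvalues of a unit quaternion are \<open>exp (\<plusminus> i u)\<close> with \<open>\<bar>sin u\<bar>\<close> the length of its imaginary
  part, and the character of \<open>Sym\<^sup>p\<close> is \<open>sin ((p + 1) u) / sin u\<close>.\<close>

lemma sym_trace_quat_bound:
  assumes v: "v = (v0, v1, v2, v3)" and r: "r > 0" "r\<^sup>2 = of_int (qnorm v)"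
    and im: "v1\<^sup>2 + v2\<^sup>2 + v3\<^sup>2 > 0"
  shows "cmod (sym_trace p ((1 / r) *\<^sub>R cq v)) \<le> r"
proof -
  define y2 where "y2 = v1\<^sup>2 + v2\<^sup>2 + v3\<^sup>2"
  define y where "y = sqrt (of_int y2)"
  have y2: "y2 \<ge> 1" using im by (simp add: y2_def)
  \<comment> \<open>Integrality keeps the imaginary part away from zero. The eigenvalues differ by
    \<open>2 * y / r\<close> in modulus, so the geometric bound \<open>r / y\<close> is at most
    \<open>r\<close>.\<close>
  have y: "y \<ge> 1" "y\<^sup>2 = of_int y2" using y2 by (simp_all add: y_def)
  have rn: "r\<^sup>2 = (of_int v0)\<^sup>2 + y\<^sup>2" using r(2) by (simp add: v qnorm_def y(2) y2_def)
  define M where "M = (1 / r) *\<^sub>R cq v"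
  have M: "M $ 1 $ 1 = Complex (of_int v0 / r) (of_int v1 / r)" "M $ 1 $ 2 = Complex (of_int v2 / r) (of_int v3 / r)"
     "M $ 2 $ 1 = Complex (- of_int v2 / r) (of_int v3 / r)" "M $ 2 $ 2 = Complex (of_int v0 / r) (- of_int v1 / r)"
    by (simp_all add: M_def v cq_entries complex_eq_iff)
  have unit: "cmod (Complex (of_int v0 / r) (t / r)) = 1" "cmod (Complex (of_int v0 / r) (- t / r)) = 1" if "t\<^sup>2 = y\<^sup>2" for t
  proof -
    have "(of_int v0 / r)\<^sup>2 + (t / r)\<^sup>2 = ((of_int v0)\<^sup>2 + t\<^sup>2) / r\<^sup>2"
      by (simp add: power_divide add_divide_distrib)
    also have "(of_int v0)\<^sup>2 + t\<^sup>2 = r\<^sup>2" using rn that by simp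
    also have "r\<^sup>2 / r\<^sup>2 = 1" using r(1) by simp
    finally have "(of_int v0 / r)\<^sup>2 + (t / r)\<^sup>2 = 1" .
    then show "cmod (Complex (of_int v0 / r) (t / r)) = 1" "cmod (Complex (of_int v0 / r) (- t / r)) = 1"
      by (simp_all add: cmod_def)
  qed
  \<comment> \<open>Stated for any \<open>t\<close> with \<open>t^2 = y^2\<close>: the general case
    takes \<open>t = y\<close>, the diagonal one \<open>t = v1\<close>, which may be
    negative.\<close>
  have bound: "cmod (\<Sum>j\<le>p. (Complex (of_int v0 / r) (t / r)) ^ (p - j) * (Complex (of_int v0 / r) (- t / r)) ^ j) \<le> r"
    if t: "t\<^sup>2 = y\<^sup>2" for t
  proof -
    have t1: "\<bar>t\<bar> = y" using t y(1) by (metis abs_of_nonneg abs_square_eq_1 order_trans power2_eq_iff abs_minus_cancel zero_le_one)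
    have d: "Complex (of_int v0 / r) (t / r) - Complex (of_int v0 / r) (- t / r) = Complex 0 (2 * t / r)"
      by (simp add: complex_eq_iff)
    have cd: "cmod (Complex 0 (2 * t / r)) = 2 * y / r" using r(1) t1 by (simp add: cmod_def abs_mult)
    have "Complex (of_int v0 / r) (t / r) \<noteq> Complex (of_int v0 / r) (- t / r)"
      using d cd y(1) r(1) by auto
    from norm_geometric_sum_le[OF unit[OF t] this, of p] have
      "cmod (\<Sum>j\<le>p. (Complex (of_int v0 / r) (t / r)) ^ (p - j) * (Complex (of_int v0 / r) (- t / r)) ^ j) \<le> r / y"
      unfolding d cd by simp
    also have "\<dots> \<le> r" using y(1) r(1) by (simp add: divide_le_eq mult_le_cancel_left1)
    finally show ?thesis .
  qed
  show ?thesis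
  proof (cases "M $ 2 $ 1 = 0")
    case False
    have "sym_trace p M = (\<Sum>j\<le>p. (Complex (of_int v0 / r) (y / r)) ^ (p - j) * (Complex (of_int v0 / r) (- y / r)) ^ j)"
    proof (rule sym_trace_eigenvalues[OF _ _ _ False])
      show "Complex (of_int v0 / r) (y / r) + Complex (of_int v0 / r) (- y / r) = M $ 1 $ 1 + M $ 2 $ 2"
        by (simp add: M complex_eq_iff)
      have "y * y = (of_int v1 * of_int v1 + of_int v2 * of_int v2 + of_int v3 * of_int v3)"
        using y(2) by (simp add: y2_def power2_eq_square)
      then show "Complex (of_int v0 / r) (y / r) * Complex (of_int v0 / r) (- y / r)
          = M $ 1 $ 1 * M $ 2 $ 2 - M $ 1 $ 2 * M $ 2 $ 1"
        using r(1) by (simp add: M complex_eq_iff add_divide_distrib diff_divide_distrib)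
      show "Complex (of_int v0 / r) (y / r) \<noteq> Complex (of_int v0 / r) (- y / r)"
        using y(1) r(1) by simp
    qed
    then show ?thesis using bound[of y] by (simp add: M_def)
  next
    case True
    then have "v2 = 0" "v3 = 0" using r(1) by (simp_all add: M complex_eq_iff)
    then have "sym_trace p M = (\<Sum>j\<le>p. (Complex (of_int v0 / r) (of_int v1 / r)) ^ (p - j) * (Complex (of_int v0 / r) (- of_int v1 / r)) ^ j)"
      by (subst sym_trace_diagonal) (simp_all add: M complex_eq_iff)
    moreover have "(of_int v1)\<^sup>2 = y\<^sup>2" using \<open>v2 = 0\<close> \<open>v3 = 0\<close> y(2) by (simp add: y2_def)
    ultimately show ?thesis using bound[of "of_int v1"] by (simp add: M_def)
  qed
qed

interpretation sec: operator_space section_scale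
  by (simp add: operator_space_def vector_space_section_scale)

lemma sum_fun_apply: "(\<Sum>i\<in>A. f i) x = (\<Sum>i\<in>A. f i x)"
  by (induction A rule: infinite_finite_induct) simp_all

lemma Sym_poly_zero_fun: "0 \<in> Sym_poly p"
  using Sym_poly_zero[of p] by (simp add: zero_fun_def)

lemma section_space_subspace: "sec.subspace (section_space p0 p1 p)"
proof (rule sec.subspaceI)
  fix u v assume "u \<in> section_space p0 p1 p" "v \<in> section_space p0 p1 p"
  then show "u + v \<in> section_space p0 p1 p"
    using Sym_poly_add by (auto simp: section_space_def plus_fun_def zero_fun_def)
next
  fix c u assume "u \<in> section_space p0 p1 p"
  then show "section_scale c u \<in> section_space p0 p1 p"
    using Sym_poly_cmult by (auto simp: section_space_def section_scale_def zero_fun_def)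
qed (simp add: section_space_def Sym_poly_zero_fun)

definition section_mono :: "nat \<Rightarrow> int mat2 set \<times> nat \<Rightarrow> sym_section" where
  "section_mono p = (\<lambda>(x, j) y. if y = x then sym_mono p j else 0)"

context
  fixes p0 p1 p :: nat
  assumes fin: "finite (cayley_vertices p0 p1)"
begin

private abbreviation "V \<equiv> cayley_vertices p0 p1"
private abbreviation "sec_basis \<equiv> section_mono p ` (V \<times> {..p})"

lemma section_mono_in_space: "x \<in> V \<Longrightarrow> j \<le> p \<Longrightarrow> section_mono p (x, j) \<in> section_space p0 p1 p"
  using sym_mono_in_Sym_poly by (auto simp: section_space_def section_mono_def Sym_poly_zero_fun)

lemma sum_section_mono_apply:
  assumes "x \<in> V"
  shows "(\<Sum>k\<in>V \<times> {..p}. section_scale (c k) (section_mono p k)) x z = (\<Sum>j\<le>p. c (x, j) * sym_mono p j z)"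
proof -
  have "(\<Sum>k\<in>V \<times> {..p}. section_scale (c k) (section_mono p k)) x z
      = (\<Sum>(y, j)\<in>V \<times> {..p}. if y = x then c (x, j) * sym_mono p j z else 0)"
    unfolding sum_fun_apply by (intro sum.cong refl) (auto simp: section_scale_def section_mono_def)
  also have "\<dots> = (\<Sum>y\<in>V. \<Sum>j\<le>p. (if y = x then c (x, j) * sym_mono p j z else 0))"
    by (rule sum.cartesian_product[symmetric])
  also have "\<dots> = (\<Sum>y\<in>V. if y = x then (\<Sum>j\<le>p. c (x, j) * sym_mono p j z) else 0)"
    by (intro sum.cong refl) auto
  finally show ?thesis using fin assms by simp
qed

lemma section_expand:
  assumes u: "u \<in> section_space p0 p1 p"
  shows "u = (\<Sum>k\<in>V \<times> {..p}. section_scale (sym_coeff p (u (fst k)) (snd k)) (section_mono p k))"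
proof (intro ext)
  fix x z
  show "u x z = (\<Sum>k\<in>V \<times> {..p}. section_scale (sym_coeff p (u (fst k)) (snd k)) (section_mono p k)) x z"
  proof (cases "x \<in> V")
    case True
    then have "u x \<in> Sym_poly p" using u by (simp add: section_space_def)
    then show ?thesis unfolding sum_section_mono_apply[OF True] by (simp add: sym_expand[of "u x" p z])
  next
    case False
    have "(\<Sum>k\<in>V \<times> {..p}. section_scale (sym_coeff p (u (fst k)) (snd k)) (section_mono p k)) \<in> section_space p0 p1 p"
      using section_mono_in_space by (intro sec.subspace_sum[OF section_space_subspace] sec.subspace_scale[OF section_space_subspace]) auto
    then show ?thesis using False u by (simp add: section_space_def)
  qed
qed

lemma inj_section_mono: "inj_on (section_mono p) (V \<times> {..p})"
proof (rule inj_onI)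
  fix a b assume ab: "a \<in> V \<times> {..p}" "b \<in> V \<times> {..p}" "section_mono p a = section_mono p b"
  obtain x j y k where xy: "a = (x, j)" "b = (y, k)" by (cases a; cases b)
  have *: "x \<in> V" "j \<in> {..p}" "y \<in> V" "k \<in> {..p}" "section_mono p (x, j) = section_mono p (y, k)"
    using ab by (simp_all only: xy mem_Sigma_iff)
  have "sym_coeff p (section_mono p (x, j) x) j = 1" using *(2) by (simp add: section_mono_def sym_coeff_mono)
  then have **: "sym_coeff p (section_mono p (y, k) x) j = 1" by (simp only: *(5))
  moreover have "sym_coeff p 0 j = 0" using sym_coeff_zero[of j p] * by (simp add: zero_fun_def)
  ultimately have "x = y" by (auto simp: section_mono_def split: if_splits)
  moreover from this ** have "j = k" using *(1-4) by (auto simp: section_mono_def sym_coeff_mono split: if_splits)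
  ultimately show "a = b" by (simp add: xy)
qed

lemma finite_sec_basis: "finite sec_basis"
  using fin by simp

lemma card_sec_basis: "card sec_basis = card V * (p + 1)"
  using card_image[OF inj_section_mono] by (simp add: card_cartesian_product)

lemma independent_sec_basis: "sec.independent sec_basis"
proof -
  have "u (section_mono p (x, j)) = 0" if "(\<Sum>b\<in>sec_basis. section_scale (u b) b) = 0" "x \<in> V" "j \<le> p" for u x j
  proof -
    have 0: "(\<Sum>k\<in>V \<times> {..p}. section_scale (u (section_mono p k)) (section_mono p k)) = 0"
      using that(1) by (simp add: sum.reindex[OF inj_section_mono])
    have "(\<Sum>i\<le>p. u (section_mono p (x, i)) * sym_mono p i z) = (\<Sum>i\<le>p. 0 * sym_mono p i z)" for z
      using sum_section_mono_apply[OF that(2), of "\<lambda>k. u (section_mono p k)" z] by (simp add: 0)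
    then show ?thesis using that(3) by (rule sym_mono_unique)
  qed
  then show ?thesis using sec.dependent_finite[OF finite_sec_basis] by auto
qed

lemma span_sec_basis: "sec.span sec_basis = section_space p0 p1 p"
proof (rule subset_antisym)
  show "sec.span sec_basis \<subseteq> section_space p0 p1 p"
    using section_mono_in_space by (intro sec.span_minimal section_space_subspace) auto
  show "section_space p0 p1 p \<subseteq> sec.span sec_basis"
  proof
    fix u assume u: "u \<in> section_space p0 p1 p"
    have "(\<Sum>k\<in>V \<times> {..p}. section_scale (sym_coeff p (u (fst k)) (snd k)) (section_mono p k)) \<in> sec.span sec_basis"
      by (rule sec.span_sum, rule sec.span_scale, rule sec.span_base) simp
    then show "u \<in> sec.span sec_basis" by (simp only: section_expand[OF u, symmetric])
  qed
qed

lemma section_dim_space: "section_dim (section_space p0 p1 p) = card V * (p + 1)"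
  using sec.dim_span_eq_card_independent[OF independent_sec_basis] by (simp add: span_sec_basis card_sec_basis)

lemma representation_sec_basis:
  assumes u: "u \<in> section_space p0 p1 p" and xj: "x \<in> V" "j \<le> p"
  shows "sec.representation sec_basis u (section_mono p (x, j)) = sym_coeff p (u x) j"
proof -
  let ?c = "\<lambda>k. sym_coeff p (u (fst k)) (snd k)"
  have b: "section_mono p k \<in> sec.span sec_basis" if "k \<in> V \<times> {..p}" for k
    by (rule sec.span_base) (use that in simp)
  have "sec.representation sec_basis u (section_mono p (x, j))
      = sec.representation sec_basis (\<Sum>k\<in>V \<times> {..p}. section_scale (?c k) (section_mono p k)) (section_mono p (x, j))"
    by (rule arg_cong[OF section_expand[OF u], of "\<lambda>w. sec.representation sec_basis w (section_mono p (x, j))"])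
  also have "\<dots> = (\<Sum>k\<in>V \<times> {..p}. ?c k * (if section_mono p (x, j) = section_mono p k then 1 else 0))"
    by (subst sec.representation_sum[OF independent_sec_basis])
      (auto intro: sec.span_scale b simp: sec.representation_scale[OF independent_sec_basis b]
        sec.representation_basis[OF independent_sec_basis])
  also have "\<dots> = (\<Sum>k\<in>V \<times> {..p}. if k = (x, j) then ?c k else 0)"
    using xj by (intro sum.cong refl) (auto dest: inj_onD[OF inj_section_mono])
  also have "\<dots> = sym_coeff p (u x) j" using fin xj by (subst sum.delta) auto
  finally show ?thesis .
qed

lemma op_trace_sec_basis:
  assumes "\<And>u. u \<in> section_space p0 p1 p \<Longrightarrow> T u \<in> section_space p0 p1 p"
  shows "sec.op_trace sec_basis T = (\<Sum>x\<in>V. \<Sum>j\<le>p. sym_coeff p (T (section_mono p (x, j)) x) j)"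
  unfolding sec.op_trace_def sum.reindex[OF inj_section_mono] sum.cartesian_product
  by (intro sum.cong refl) (auto simp: representation_sec_basis assms section_mono_in_space)

end

section \<open>Traces over reduced words\<close>

lemma (in operator_space) op_trace_sum:
  assumes "independent B" "\<And>i b. i \<in> I \<Longrightarrow> b \<in> B \<Longrightarrow> T i b \<in> span B"
  shows "op_trace B (\<lambda>u. \<Sum>i\<in>I. T i u) = (\<Sum>i\<in>I. op_trace B (T i))"
proof -
  have "op_trace B (\<lambda>u. \<Sum>i\<in>I. T i u) = (\<Sum>b\<in>B. \<Sum>i\<in>I. representation B (T i b) b)"
    unfolding op_trace_def by (intro sum.cong refl) (simp add: representation_sum[OF assms(1)] assms(2))
  then show ?thesis unfolding op_trace_def by (simp add: sum.swap[of _ I])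
qed

lemma sym_form_add:
  assumes "s \<in> Sym_poly p" "s' \<in> Sym_poly p"
  shows "sym_form p (\<lambda>z. s z + s' z) t = sym_form p s t + sym_form p s' t"
  by (simp add: sym_form_def sym_coeff_add[OF assms] sum.distrib distrib_right add_divide_distrib)

lemma sym_form_cmult:
  assumes "s \<in> Sym_poly p"
  shows "sym_form p (\<lambda>z. c * s z) t = c * sym_form p s t"
  by (simp add: sym_form_def sym_coeff_cmult[OF assms] sum_distrib_left mult.assoc)

lemma sym_form_cnj: "sym_form p s t = cnj (sym_form p t s)"
  by (simp add: sym_form_def mult.commute)

lemma sym_form_self: "sym_form p s s = of_real (\<Sum>j\<le>p. (cmod (sym_coeff p s j))\<^sup>2 / real (p choose j))"
  by (simp add: sym_form_def complex_norm_square[symmetric])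

text \<open>Supplies the root that splits the quaternions at \<open>p0\<close>: the exponent in
  Euler's criterion is even, so the Legendre symbol of \<open>-1\<close> is 1.\<close>

lemma sqrt_minus_one_mod_prime:
  fixes q :: nat
  assumes "prime q" "[q = 1] (mod 4)"
  obtains i where "int q dvd i\<^sup>2 + 1"
proof -
  have q4: "q mod 4 = 1" using assms(2) by (simp add: cong_def)
  have "q \<noteq> 2" using q4 by auto
  then have q2: "2 < q" using prime_ge_2_nat[OF assms(1)] by simp
  obtain m where "q = 4 * m + 1" using q4 by (metis mult_div_mod_eq)
  then have e: "even ((q - 1) div 2)" by simp
  have "[Legendre (- 1) (int q) = (- 1) ^ ((q - 1) div 2)] (mod int q)"
    using euler_criterion[OF assms(1) q2] by simp
  then have "[Legendre (- 1) (int q) = 1] (mod int q)" using e by simp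
  then have "Legendre (- 1) (int q) \<noteq> 0 \<and> Legendre (- 1) (int q) \<noteq> - 1"
    using zdvd_not_zless[of 1 "int q"] zdvd_not_zless[of 2 "int q"] q2
    by (auto simp: cong_iff_dvd_diff simp del: of_nat_dvd_iff)
  then have "QuadRes (int q) (- 1)" by (auto simp: Legendre_def split: if_splits)
  then show ?thesis using that by (auto simp: QuadRes_def cong_iff_dvd_diff)
qed

definition reduced_words :: "nat \<Rightarrow> nat \<Rightarrow> quat list set" where
  "reduced_words p0 k = {l. set l \<subseteq> quat_set p0 \<and> length l = k \<and> reduced l}"

lemma finite_reduced_words: "finite (reduced_words p0 k)"
proof (rule finite_subset)
  show "finite {l. set l \<subseteq> quat_set p0 \<and> length l = k}"
    by (rule finite_lists_length_eq[OF finite_quat_set])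
qed (auto simp: reduced_words_def)

lemma reduced_words_0: "reduced_words p0 0 = {[]}"
  by (auto simp: reduced_words_def)

lemma reduced_words_1: "reduced_words p0 (Suc 0) = (\<lambda>a. [a]) ` quat_set p0"
  by (auto simp: reduced_words_def length_Suc_conv)

section \<open>The Laplacian of one Cayley graph\<close>

locale cayley_laplacian =
  fixes p0 p1 p :: nat and \<beta> :: int
  assumes prime_p0: "prime p0" and p0_mod_4: "[p0 = 1] (mod 4)"
    and prime_p1': "prime p1" and p1_mod_4: "[p1 = 1] (mod 4)" and p1_ne_p0: "p1 \<noteq> p0"
    and beta_square: "[\<beta>\<^sup>2 = - 1] (mod int p1)"
begin

sublocale Q: quat_pgl p1 "int p1" "residue_ring (int p1)" \<beta>
proof unfold_locales
  have "p1 mod 4 = 1" using p1_mod_4 by (simp add: cong_def)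
  then have "odd p1" by presburger
  then show "odd (int p1)" by simp
qed (use prime_p1' beta_square in auto)

abbreviation "A \<equiv> quat_set p0"
abbreviation "V \<equiv> cayley_vertices p0 p1"
abbreviation "G \<equiv> PGL2 (residue_ring (int p1))"
abbreviation "g \<equiv> quat_mod p1 \<beta>"
abbreviation "SEC \<equiv> section_space p0 p1 p"
abbreviation "secB \<equiv> section_mono p ` (V \<times> {..p})"

lemma subgroup_V: "subgroup V G" and finite_V: "finite V"
  by (rule Q.cayley_vertices_subgroup Q.finite_cayley_vertices)+

lemma V_closed [simp]: "x \<in> V \<Longrightarrow> y \<in> V \<Longrightarrow> x \<otimes>\<^bsub>G\<^esub> y \<in> V" "x \<in> V \<Longrightarrow> inv\<^bsub>G\<^esub> x \<in> V"
  "\<one>\<^bsub>G\<^esub> \<in> V" "x \<in> V \<Longrightarrow> x \<in> carrier G"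
  using subgroup_V by (auto simp: subgroup.m_closed subgroup.m_inv_closed subgroup.one_closed subgroup.mem_carrier)

lemma p0_pos: "p0 > 0" using prime_p0 prime_gt_0_nat by blast

lemma p0_not_dvd: "\<not> int p1 dvd int p0"
  using primes_dvd_imp_eq[OF prime_p1' prime_p0] p1_ne_p0 by auto

lemma A_norm: "a \<in> A \<Longrightarrow> qnorm a = int p0" "a \<in> A \<Longrightarrow> \<not> int p1 dvd qnorm a"
  using qnorm_quat_set p0_not_dvd by auto

lemma g_in_V [simp]: "a \<in> A \<Longrightarrow> g a \<in> V"
  using Q.quat_mod_in_cayley_vertices p0_not_dvd by blast

lemma g_qconj: "a \<in> A \<Longrightarrow> g (qconj a) = inv\<^bsub>G\<^esub> (g a)"
  using Q.quat_mod_qconj A_norm by blast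

lemma card_A: "card A = p0 + 1"
proof -
  obtain i where i: "int p0 dvd i\<^sup>2 + 1" using sqrt_minus_one_mod_prime[OF prime_p0 p0_mod_4] .
  have "p0 mod 4 = 1" using p0_mod_4 by (simp add: cong_def)
  then have "odd p0" by presburger
  then interpret split_prime "int p0" i by unfold_locales (use prime_p0 i in auto)
  show ?thesis by (rule card_quat_set[OF refl p0_mod_4])
qed

definition rho :: "quat \<Rightarrow> sym_section \<Rightarrow> sym_section" where
  "rho a u = (\<lambda>x. if x \<in> V then poly_action (quat_SU2 p0 a) (u (inv\<^bsub>G\<^esub> (g a) \<otimes>\<^bsub>G\<^esub> x)) else 0)"

lemma laplacian_eq: "laplacian p0 p1 \<beta> u = (\<Sum>a\<in>A. rho a u)"
  by (rule ext) (simp add: laplacian_def sum_fun_apply rho_def)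

lemma rho_apply:
  "a \<in> A \<Longrightarrow> x \<in> V \<Longrightarrow> rho a u x = (\<lambda>z. u (inv\<^bsub>G\<^esub> (g a) \<otimes>\<^bsub>G\<^esub> x) (quat_SU2 p0 (qconj a) *v z))"
  using matrix_inv_quat_SU2[of a p0] A_norm p0_pos by (simp add: rho_def poly_action_def)

lemma rho_outside: "x \<notin> V \<Longrightarrow> rho a u x = 0"
  by (simp add: rho_def)

lemma rho_linear: "Vector_Spaces.linear section_scale section_scale (rho a)"
  unfolding Vector_Spaces.linear_iff using vector_space_section_scale
  by (auto simp: rho_def poly_action_def section_scale_def fun_eq_iff)

lemma rho_section: "a \<in> A \<Longrightarrow> u \<in> SEC \<Longrightarrow> rho a u \<in> SEC"
  using Sym_poly_matrix by (auto simp: section_space_def rho_apply rho_outside)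

lemma rho_cancel:
  assumes a: "a \<in> A" and u: "u \<in> SEC" shows "rho a (rho (qconj a) u) = u"
proof (intro ext)
  fix x z
  have ca: "qconj a \<in> A" using a by (rule qconj_quat_set)
  show "rho a (rho (qconj a) u) x z = u x z"
  proof (cases "x \<in> V")
    case False
    then show ?thesis using u by (simp add: rho_outside section_space_def)
  next
    case True
    have "inv\<^bsub>G\<^esub> (g (qconj a)) \<otimes>\<^bsub>G\<^esub> (inv\<^bsub>G\<^esub> (g a) \<otimes>\<^bsub>G\<^esub> x) = x"
      using a True by (simp add: g_qconj Q.PG.m_assoc[symmetric])
    moreover have "quat_SU2 p0 a *v (quat_SU2 p0 (qconj a) *v z) = z"
      using quat_SU2_mult_qconj[of a p0] A_norm[OF a] p0_pos by (simp add: matrix_vector_mul_assoc)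
    ultimately show ?thesis using a ca True by (simp add: rho_apply)
  qed
qed

definition rho_list :: "quat list \<Rightarrow> sym_section \<Rightarrow> sym_section" where
  "rho_list l u = foldr rho l u"

lemma rho_list_simps [simp]: "rho_list [] u = u" "rho_list (a # l) u = rho a (rho_list l u)"
  by (simp_all add: rho_list_def)

lemma rho_list_section: "set l \<subseteq> A \<Longrightarrow> u \<in> SEC \<Longrightarrow> rho_list l u \<in> SEC"
  by (induction l) (simp_all add: rho_section)

text \<open>The group acts on a polynomial by substituting the inverse matrix, which for a
  normalised quaternion is its conjugate, hence \<open>qconj\<close>.\<close>

definition list_matrix :: "quat list \<Rightarrow> complex^2^2" where
  "list_matrix l = (1 / sqrt (real p0)) ^ length l *\<^sub>R cq (qconj (qprod l))"

lemma qnorm_qprod_list: "set l \<subseteq> A \<Longrightarrow> qnorm (qprod l) = int p0 ^ length l"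
  using A_norm by (intro qnorm_qprod) blast

lemma qprod_not_dvd: "set l \<subseteq> A \<Longrightarrow> \<not> int p1 dvd qnorm (qprod l)"
proof -
  assume "set l \<subseteq> A"
  then have "qnorm (qprod l) = int p0 ^ length l" by (rule qnorm_qprod_list)
  moreover have "\<not> int p1 dvd int p0 ^ length l"
    using p0_not_dvd Q.prime_n prime_dvd_power by blast
  ultimately show ?thesis by simp
qed

lemma g_qprod_in_V: "set l \<subseteq> A \<Longrightarrow> g (qprod l) \<in> V"
proof (induction l)
  case Nil
  have "\<not> int p1 dvd 1" using Q.n_gt_1 by (simp add: zdvd1_eq)
  then show ?case using Q.quat_mod_one[of 1] by simp
next
  case (Cons a l)
  then show ?case using Q.quat_mod_qmul[of a "qprod l"] A_norm(2)[of a] qprod_not_dvd[of l] by simp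
qed

text \<open>A word acts through its product: the inverse in the group and the conjugate in the
  variables reverse the order of the letters in the same way.\<close>

lemma rho_list_apply:
  assumes "set l \<subseteq> A" "x \<in> V"
  shows "rho_list l u x = (\<lambda>z. u (inv\<^bsub>G\<^esub> (g (qprod l)) \<otimes>\<^bsub>G\<^esub> x) (list_matrix l *v z))"
  using assms
proof (induction l arbitrary: x)
  case Nil
  have "\<not> int p1 dvd 1" using Q.n_gt_1 by (simp add: zdvd1_eq)
  then have "g (1, 0, 0, 0) = \<one>\<^bsub>G\<^esub>" by (rule Q.quat_mod_one)
  moreover have "list_matrix [] = mat 1" using cq_scalar[of 1] by (simp add: list_matrix_def qconj_def)
  ultimately show ?case using Nil by simp
next
  case (Cons a l)
  have al: "a \<in> A" "set l \<subseteq> A" using Cons.prems by auto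
  have gV: "g (qprod l) \<in> V" using g_qprod_in_V al(2) .
  have gg: "g (qprod (a # l)) = g a \<otimes>\<^bsub>G\<^esub> g (qprod l)"
    using Q.quat_mod_qmul[of a "qprod l"] A_norm(2)[OF al(1)] qprod_not_dvd[OF al(2)] by simp
  have "inv\<^bsub>G\<^esub> (g (qprod (a # l))) \<otimes>\<^bsub>G\<^esub> x = inv\<^bsub>G\<^esub> (g (qprod l)) \<otimes>\<^bsub>G\<^esub> (inv\<^bsub>G\<^esub> (g a) \<otimes>\<^bsub>G\<^esub> x)"
    unfolding gg using al(1) gV Cons.prems(2) by (simp add: Q.PG.inv_mult_group Q.PG.m_assoc)
  moreover have "list_matrix (a # l) = list_matrix l ** quat_SU2 p0 (qconj a)"
    by (simp add: list_matrix_def quat_SU2_eq scaleR_matrix_mult cq_qmul qconj_qmul mult.commute)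
  ultimately show ?case
    using Cons.IH[OF al(2), of "inv\<^bsub>G\<^esub> (g a) \<otimes>\<^bsub>G\<^esub> x"] al(1) Cons.prems(2)
    by (simp add: rho_apply matrix_vector_mul_assoc)
qed

text \<open>A left translation of a group fixes every point or none. In the first case each vertex
  contributes the same diagonal block, in the second all diagonal blocks vanish.\<close>

lemma op_trace_rho_list:
  assumes l: "set l \<subseteq> A"
  shows "sec.op_trace secB (rho_list l) =
    (if g (qprod l) = \<one>\<^bsub>G\<^esub> then of_nat (card V) * sym_trace p (list_matrix l) else 0)"
proof -
  have gV: "g (qprod l) \<in> V" using l by (rule g_qprod_in_V)
  have "sec.op_trace secB (rho_list l) = (\<Sum>x\<in>V. \<Sum>j\<le>p. sym_coeff p (rho_list l (section_mono p (x, j)) x) j)"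
    by (rule op_trace_sec_basis[OF finite_V]) (rule rho_list_section[OF l])
  also have "\<dots> = (\<Sum>x\<in>V. if g (qprod l) = \<one>\<^bsub>G\<^esub> then sym_trace p (list_matrix l) else 0)"
  proof (intro sum.cong refl)
    fix x assume x: "x \<in> V"
    show "(\<Sum>j\<le>p. sym_coeff p (rho_list l (section_mono p (x, j)) x) j)
       = (if g (qprod l) = \<one>\<^bsub>G\<^esub> then sym_trace p (list_matrix l) else 0)"
    proof (cases "g (qprod l) = \<one>\<^bsub>G\<^esub>")
      case True
      then show ?thesis using x
        by (simp add: rho_list_apply[OF l x] section_mono_def sym_trace_def sym_matrix_def)
    next
      case False
      have "inv\<^bsub>G\<^esub> (g (qprod l)) \<otimes>\<^bsub>G\<^esub> x \<noteq> x"
      proof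
        assume "inv\<^bsub>G\<^esub> (g (qprod l)) \<otimes>\<^bsub>G\<^esub> x = x"
        then have "inv\<^bsub>G\<^esub> (g (qprod l)) = \<one>\<^bsub>G\<^esub>"
          using gV x by (metis Q.PG.inv_closed Q.PG.l_cancel_one' V_closed(4) Q.PG.r_cancel_one)
        then show False using False gV by (metis Q.PG.inv_inv Q.PG.inv_one V_closed(4))
      qed
      then show ?thesis using False sym_coeff_zero
        by (simp add: rho_list_apply[OF l x] section_mono_def)
    qed
  qed
  finally show ?thesis by simp
qed

text \<open>If the class of the word is trivial, its quaternion is congruent to a scalar modulo \<open>p1\<close> without
  being one, so its norm is at least \<open>p1\<close>.\<close>

lemma op_trace_rho_list_bound:
  assumes l: "set l \<subseteq> A" "reduced l" "l \<noteq> []"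
  shows "cmod (sec.op_trace secB (rho_list l)) \<le> (if p0 ^ length l < p1 then 0 else real (card V) * sqrt (real p0) ^ length l)"
proof (cases "g (qprod l) = \<one>\<^bsub>G\<^esub>")
  case False
  then show ?thesis by (simp add: op_trace_rho_list[OF l(1)])
next
  case True
  obtain w0 w1 w2 w3 where w: "qprod l = (w0, w1, w2, w3)" by (cases "qprod l")
  obtain i where i: "int p0 dvd i\<^sup>2 + 1" using sqrt_minus_one_mod_prime[OF prime_p0 p0_mod_4] .
  have "p0 mod 4 = 1" using p0_mod_4 by (simp add: cong_def)
  then have "odd p0" by presburger
  then interpret S: split_prime "int p0" i by unfold_locales (use prime_p0 i in auto)
  have im: "w1\<^sup>2 + w2\<^sup>2 + w3\<^sup>2 > 0" using S.reduced_imaginary_part[OF refl l w] .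
  have n: "qnorm (qprod l) = int p0 ^ length l" using l(1) by (rule qnorm_qprod_list)
  have "int p1 dvd w1 \<and> int p1 dvd w2 \<and> int p1 dvd w3"
    using qprod_not_dvd[OF l(1)] True unfolding w by (rule Q.quat_mod_eq_one)
  then obtain v1 v2 v3 where v: "w1 = int p1 * v1" "w2 = int p1 * v2" "w3 = int p1 * v3" by (auto simp: dvd_def)
  have "(int p1)\<^sup>2 * (v1\<^sup>2 + v2\<^sup>2 + v3\<^sup>2) > 0" using im by (simp add: v power_mult_distrib algebra_simps)
  then have v1: "v1\<^sup>2 + v2\<^sup>2 + v3\<^sup>2 \<ge> 1" by (simp add: zero_less_mult_iff)
  have "int p1 * 1 \<le> int p1 * int p1" using Q.n_gt_1 by (intro mult_left_mono) auto
  also have "\<dots> \<le> (int p1)\<^sup>2 * (v1\<^sup>2 + v2\<^sup>2 + v3\<^sup>2)"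
    using mult_left_mono[OF v1, of "(int p1)\<^sup>2"] by (simp add: power2_eq_square)
  also have "\<dots> = w1\<^sup>2 + w2\<^sup>2 + w3\<^sup>2" by (simp add: v power_mult_distrib algebra_simps)
  also have "\<dots> \<le> w0\<^sup>2 + w1\<^sup>2 + w2\<^sup>2 + w3\<^sup>2" using zero_le_power2[of w0] by linarith
  also have "\<dots> = int p0 ^ length l" using n by (simp add: w qnorm_def)
  finally have "int p1 \<le> int (p0 ^ length l)" by simp
  then have np: "\<not> p0 ^ length l < p1" by linarith
  define r where "r = sqrt (real p0) ^ length l"
  have r: "r > 0" "r\<^sup>2 = of_int (qnorm (qconj (qprod l)))"
    using p0_pos n by (simp_all add: r_def power_mult[symmetric] mult.commute[of _ 2])
      (simp add: power_mult)
  have "list_matrix l = (1 / r) *\<^sub>R cq (qconj (qprod l))"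
    by (simp add: list_matrix_def r_def power_one_over)
  then have "cmod (sym_trace p (list_matrix l)) \<le> r"
    using sym_trace_quat_bound[OF _ r, of w0 "- w1" "- w2" "- w3"] im by (simp add: w qconj_def)
  then show ?thesis
    using np True by (simp add: op_trace_rho_list[OF l(1)] norm_mult mult_left_mono r_def)
qed

definition hecke :: "nat \<Rightarrow> sym_section \<Rightarrow> sym_section" where
  "hecke k u = (\<Sum>l\<in>reduced_words p0 k. rho_list l u)"

lemma hecke_0: "hecke 0 u = u"
  by (simp add: hecke_def reduced_words_0)

lemma hecke_1: "hecke (Suc 0) u = laplacian p0 p1 \<beta> u"
  by (simp add: hecke_def reduced_words_1 sum.reindex inj_on_def laplacian_eq)

lemma rho_sum: "rho a (\<Sum>i\<in>I. f i) = (\<Sum>i\<in>I. rho a (f i))"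
proof -
  interpret Vector_Spaces.linear section_scale section_scale "rho a" by (rule rho_linear)
  show ?thesis by (rule sum)
qed

text \<open>Prepending \<open>a\<close> to a reduced word either gives a longer reduced word (the
  pairs in \<open>N\<close>) or cancels its first letter (the pairs in \<open>E\<close>). A
  remaining word \<open>l\<close> arises from every \<open>a\<close> other than its first letter,
  thus \<open>p0\<close> times, or \<open>p0 + 1\<close> times if \<open>l\<close> is empty.\<close>

lemma laplacian_hecke:
  assumes u: "u \<in> SEC"
  shows "laplacian p0 p1 \<beta> (hecke (Suc k) u) =
    hecke (Suc (Suc k)) u + section_scale (of_nat (if k = 0 then p0 + 1 else p0)) (hecke k u)"
proof -
  let ?W = "reduced_words p0"
  let ?P = "A \<times> ?W (Suc k)"
  define N where "N = {(a, l) \<in> ?P. hd l \<noteq> qconj a}"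
  define E where "E = {(a, l) \<in> ?P. hd l = qconj a}"
  have fP: "finite ?P" using finite_quat_set finite_reduced_words by blast
  have ne: "l \<noteq> []" if "l \<in> ?W (Suc k)" for l using that by (auto simp: reduced_words_def)
  have "laplacian p0 p1 \<beta> (hecke (Suc k) u) = (\<Sum>(a, l)\<in>?P. rho_list (a # l) u)"
    by (simp add: laplacian_eq hecke_def rho_sum sum.cartesian_product)
  also have "\<dots> = (\<Sum>(a, l)\<in>N. rho_list (a # l) u) + (\<Sum>(a, l)\<in>E. rho_list (a # l) u)"
  proof -
    have "?P = N \<union> E" "N \<inter> E = {}" by (auto simp only: N_def E_def)
    moreover from this have "finite N" "finite E" using fP by simp_all
    ultimately show ?thesis by (simp only: sum.union_disjoint)
  qed
  also have "(\<Sum>(a, l)\<in>N. rho_list (a # l) u) = hecke (Suc (Suc k)) u"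
    unfolding hecke_def
  proof (rule sum.reindex_bij_witness[of _ "\<lambda>l. (hd l, tl l)" "\<lambda>(a, l). a # l"])
    fix l assume l: "l \<in> ?W (Suc (Suc k))"
    then obtain a b l' where "l = a # b # l'" by (auto simp: reduced_words_def length_Suc_conv)
    then show "(hd l, tl l) \<in> N" "(case (hd l, tl l) of (a, l) \<Rightarrow> a # l) = l" using l by (auto simp: N_def reduced_words_def)
  next
    fix al assume al: "al \<in> N"
    then obtain a b l' where "al = (a, b # l')" by (auto simp: N_def reduced_words_def length_Suc_conv)
    then show "(case al of (a, l) \<Rightarrow> a # l) \<in> ?W (Suc (Suc k))" using al by (auto simp: N_def reduced_words_def)
  qed auto
  \<comment> \<open>The cancelled letter is the conjugate of \<open>a\<close>. It may precede
    \<open>l\<close> in a reduced word exactly when \<open>l\<close> is empty or does not begin with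
    \<open>a\<close>.\<close>
  also have "(\<Sum>(a, l)\<in>E. rho_list (a # l) u) = (\<Sum>(l, a)\<in>Sigma (?W k) (\<lambda>l. {a \<in> A. l = [] \<or> hd l \<noteq> a}). rho_list l u)"
  proof (rule sum.reindex_bij_witness[of _ "\<lambda>(l, a). (a, qconj a # l)" "\<lambda>(a, l). (tl l, a)"])
    fix al assume al: "al \<in> E"
    then obtain a l where al': "al = (a, qconj a # l)" by (auto simp: E_def reduced_words_def length_Suc_conv)
    have aA: "a \<in> A" and l: "qconj a # l \<in> ?W (Suc k)" using al by (auto simp: E_def al')
    show "(case case al of (a, l) \<Rightarrow> (tl l, a) of (l, a) \<Rightarrow> (a, qconj a # l)) = al" by (simp add: al')
    have "set l \<subseteq> A" using l by (auto simp: reduced_words_def)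
    then have "rho_list l u \<in> SEC" using u by (rule rho_list_section)
    then show "(case case al of (a, l) \<Rightarrow> (tl l, a) of (l, a) \<Rightarrow> rho_list l u) = (case al of (a, l) \<Rightarrow> rho_list (a # l) u)"
      using aA by (simp add: al' rho_cancel)
    show "(case al of (a, l) \<Rightarrow> (tl l, a)) \<in> Sigma (?W k) (\<lambda>l. {a \<in> A. l = [] \<or> hd l \<noteq> a})"
      using aA l by (cases l) (auto simp: al' reduced_words_def)
  next
    fix la assume "la \<in> Sigma (?W k) (\<lambda>l. {a \<in> A. l = [] \<or> hd l \<noteq> a})"
    then obtain l a where la: "la = (l, a)" "l \<in> ?W k" "a \<in> A" "l = [] \<or> hd l \<noteq> a" by auto
    then show "(case la of (l, a) \<Rightarrow> (a, qconj a # l)) \<in> E"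
      using qconj_quat_set[of a p0] by (cases l) (auto simp: E_def reduced_words_def)
  qed auto
  also have "\<dots> = (\<Sum>l\<in>?W k. \<Sum>a\<in>{a \<in> A. l = [] \<or> hd l \<noteq> a}. rho_list l u)"
    using finite_reduced_words finite_quat_set by (subst sum.Sigma) auto
  also have "\<dots> = (\<Sum>l\<in>?W k. section_scale (of_nat (if k = 0 then p0 + 1 else p0)) (rho_list l u))"
  proof (intro sum.cong refl)
    fix l assume l: "l \<in> ?W k"
    have "card {a \<in> A. l = [] \<or> hd l \<noteq> a} = (if k = 0 then p0 + 1 else p0)"
    proof (cases l)
      case Nil
      then show ?thesis using l card_A by (auto simp: reduced_words_def)
    next
      case (Cons b l')
      then have "b \<in> A" "k \<noteq> 0" using l by (auto simp: reduced_words_def)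
      moreover have "{a \<in> A. l = [] \<or> hd l \<noteq> a} = A - {b}" using Cons by auto
      ultimately show ?thesis using card_A finite_quat_set by simp
    qed
    then show "(\<Sum>a\<in>{a \<in> A. l = [] \<or> hd l \<noteq> a}. rho_list l u)
        = section_scale (of_nat (if k = 0 then p0 + 1 else p0)) (rho_list l u)"
      by (simp only: sec.sum_constant_scale)
  qed
  also have "\<dots> = section_scale (of_nat (if k = 0 then p0 + 1 else p0)) (hecke k u)"
    by (simp add: hecke_def sec.scale_sum_right)
  finally show ?thesis .
qed

lemma laplacian_linear: "Vector_Spaces.linear section_scale section_scale (laplacian p0 p1 \<beta>)"
proof -
  have "rho a (x + y) = rho a x + rho a y" "rho a (section_scale c x) = section_scale c (rho a x)" for a x y c
    using rho_linear[of a] by (auto simp: Vector_Spaces.linear_iff)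
  then show ?thesis unfolding Vector_Spaces.linear_iff
    using vector_space_section_scale by (auto simp: laplacian_eq sum.distrib sec.scale_sum_right)
qed

lemma laplacian_section: "u \<in> SEC \<Longrightarrow> laplacian p0 p1 \<beta> u \<in> SEC"
  unfolding laplacian_eq by (intro sec.subspace_sum section_space_subspace rho_section)

lemma hecke_eigenvector:
  assumes u: "u \<in> SEC" "laplacian p0 p1 \<beta> u = section_scale (of_real t) u"
  shows "hecke k u = section_scale (of_real (nbp (real p0) k t)) u"
proof -
  interpret Vector_Spaces.linear section_scale section_scale "laplacian p0 p1 \<beta>" by (rule laplacian_linear)
  show ?thesis
  proof (induction k rule: induct_nat_012)
    case 0
    then show ?case by (simp add: hecke_0)
  next
    case 1
    then show ?case by (simp add: hecke_1 u)
  next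
    case (ge2 k)
    have "hecke (Suc (Suc k)) u = laplacian p0 p1 \<beta> (hecke (Suc k) u)
        - section_scale (of_nat (if k = 0 then p0 + 1 else p0)) (hecke k u)"
      using laplacian_hecke[OF u(1), of k] by simp
    also have "\<dots> = section_scale (of_real (nbp (real p0) (Suc k) t) * of_real t - of_nat (if k = 0 then p0 + 1 else p0) * of_real (nbp (real p0) k t)) u"
      by (simp only: ge2 scale u(2) sec.scale_scale sec.scale_left_diff_distrib)
    also have "of_real (nbp (real p0) (Suc k) t) * of_real t - of_nat (if k = 0 then p0 + 1 else p0) * of_real (nbp (real p0) k t)
        = (of_real (nbp (real p0) (Suc (Suc k)) t) :: complex)"
      by (simp add: mult.commute)
    finally show ?case .
  qed
qed

end

section \<open>Eigenvalues of the Laplacian\<close>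

context cayley_laplacian
begin

definition sec_form :: "sym_section \<Rightarrow> sym_section \<Rightarrow> complex" where
  "sec_form u v = (\<Sum>x\<in>V. sym_form p (u x) (v x))"

lemma section_at: "u \<in> SEC \<Longrightarrow> x \<in> V \<Longrightarrow> u x \<in> Sym_poly p"
  by (simp add: section_space_def)

lemma sec_form_add:
  assumes "u \<in> SEC" "v \<in> SEC" shows "sec_form (u + v) w = sec_form u w + sec_form v w"
  using sym_form_add[OF section_at[OF assms(1)] section_at[OF assms(2)]]
  by (simp add: sec_form_def plus_fun_def sum.distrib)

lemma sec_form_scale:
  assumes "u \<in> SEC" shows "sec_form (section_scale c u) w = c * sec_form u w"
  using sym_form_cmult[OF section_at[OF assms]]
  by (simp add: sec_form_def section_scale_def sum_distrib_left)

lemma section_scale_closed: "u \<in> SEC \<Longrightarrow> section_scale c u \<in> SEC"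
  by (rule sec.subspace_scale[OF section_space_subspace])

lemma sec_form_diff:
  assumes "u \<in> SEC" "v \<in> SEC" shows "sec_form (u - v) w = sec_form u w - sec_form v w"
proof -
  have "u - v = u + section_scale (- 1) v" by (simp add: section_scale_def fun_eq_iff)
  then show ?thesis
    using sec_form_add[OF assms(1) section_scale_closed[OF assms(2)], of "- 1" w] sec_form_scale[OF assms(2), of "- 1" w]
    by (simp only:) simp
qed

lemma sec_form_cnj: "sec_form u v = cnj (sec_form v u)"
  unfolding sec_form_def cnj_sum by (intro sum.cong refl sym_form_cnj)

lemma sec_form_self:
  "sec_form u u = of_real (\<Sum>x\<in>V. \<Sum>j\<le>p. (cmod (sym_coeff p (u x) j))\<^sup>2 / real (p choose j))"
  by (simp add: sec_form_def sym_form_self)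

lemma sec_form_self_Re: "Re (sec_form u u) \<ge> 0"
  unfolding sec_form_self Re_complex_of_real by (intro sum_nonneg divide_nonneg_nonneg) auto

lemma sec_form_definite:
  assumes u: "u \<in> SEC" and 0: "sec_form u u = 0" shows "u = 0"
proof -
  have "(\<Sum>x\<in>V. \<Sum>j\<le>p. (cmod (sym_coeff p (u x) j))\<^sup>2 / real (p choose j)) = 0"
    using 0 unfolding sec_form_self by (simp only: of_real_eq_0_iff)
  then have "\<forall>x\<in>V. (\<Sum>j\<le>p. (cmod (sym_coeff p (u x) j))\<^sup>2 / real (p choose j)) = 0"
    using finite_V by (subst (asm) sum_nonneg_eq_0_iff) (auto intro!: sum_nonneg)
  then have "\<forall>x\<in>V. \<forall>j\<in>{..p}. (cmod (sym_coeff p (u x) j))\<^sup>2 / real (p choose j) = 0"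
    by (subst (asm) sum_nonneg_eq_0_iff) auto
  then have c: "sym_coeff p (u x) j = 0" if "x \<in> V" "j \<le> p" for x j using that by fastforce
  show ?thesis
  proof (intro ext)
    fix x z
    show "u x z = 0 x z"
    proof (cases "x \<in> V")
      case True
      then show ?thesis using sym_expand[OF section_at[OF u True], of z] c by simp
    qed (use u in \<open>simp add: section_space_def\<close>)
  qed
qed

text \<open>Translation is undone by reindexing the vertices, the substitution by its adjoint
  matrix. Conjugation permutes the generators, so summing over them makes the Laplacian
  self-adjoint.\<close>

lemma rho_adjoint:
  assumes a: "a \<in> A" and u: "u \<in> SEC" and v: "v \<in> SEC"
  shows "sec_form (rho a u) v = sec_form u (rho (qconj a) v)"
proof -
  have ca: "qconj a \<in> A" using a by (rule qconj_quat_set)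
  have adj: "mat_adjoint (quat_SU2 p0 (qconj a)) = quat_SU2 p0 a"
    by (simp add: quat_SU2_eq mat_adjoint_cq)
  have "sec_form (rho a u) v
      = (\<Sum>x\<in>V. sym_form p (u (inv\<^bsub>G\<^esub> (g a) \<otimes>\<^bsub>G\<^esub> x)) (\<lambda>z. v x (quat_SU2 p0 a *v z)))"
    unfolding sec_form_def
    by (intro sum.cong refl) (use a u v in \<open>simp add: rho_apply sym_form_adjoint section_at adj\<close>)
  also have "\<dots> = (\<Sum>y\<in>V. sym_form p (u y) (\<lambda>z. v (g a \<otimes>\<^bsub>G\<^esub> y) (quat_SU2 p0 a *v z)))"
    by (rule sum.reindex_bij_witness[of _ "\<lambda>y. g a \<otimes>\<^bsub>G\<^esub> y" "\<lambda>x. inv\<^bsub>G\<^esub> (g a) \<otimes>\<^bsub>G\<^esub> x"])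
      (use a in \<open>simp_all add: Q.PG.m_assoc[symmetric]\<close>)
  also have "\<dots> = sec_form u (rho (qconj a) v)"
    unfolding sec_form_def by (intro sum.cong refl) (use a ca in \<open>simp add: rho_apply[OF ca] g_qconj\<close>)
  finally show ?thesis .
qed

lemma sec_form_sum:
  assumes "finite I" "\<And>i. i \<in> I \<Longrightarrow> f i \<in> SEC"
  shows "sec_form (\<Sum>i\<in>I. f i) w = (\<Sum>i\<in>I. sec_form (f i) w)"
  using assms
proof (induction I)
  case empty
  have "sec_form 0 w = 0" using sec_form_scale[of 0 0 w] sec.subspace_0[OF section_space_subspace] by simp
  then show ?case by (simp only: sum.empty)
next
  case (insert i I)
  have "(\<Sum>i\<in>I. f i) \<in> SEC"
    by (rule sec.subspace_sum[OF section_space_subspace]) (use insert.prems in blast)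
  then have "sec_form (f i + (\<Sum>i\<in>I. f i)) w = sec_form (f i) w + sec_form (\<Sum>i\<in>I. f i) w"
    using insert.prems by (intro sec_form_add) blast+
  moreover have "sec_form (\<Sum>i\<in>I. f i) w = (\<Sum>i\<in>I. sec_form (f i) w)"
    using insert.prems by (intro insert.IH) blast
  ultimately show ?case by (simp only: sum.insert[OF insert.hyps])
qed

lemma laplacian_selfadjoint:
  assumes u: "u \<in> SEC" and v: "v \<in> SEC"
  shows "sec_form (laplacian p0 p1 \<beta> u) v = sec_form u (laplacian p0 p1 \<beta> v)"
proof -
  have "sec_form (laplacian p0 p1 \<beta> u) v = (\<Sum>a\<in>A. sec_form (rho a u) v)"
    unfolding laplacian_eq by (rule sec_form_sum[OF finite_quat_set rho_section[OF _ u]])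
  also have "\<dots> = (\<Sum>a\<in>A. sec_form u (rho (qconj a) v))"
    by (intro sum.cong refl rho_adjoint u v)
  also have "\<dots> = (\<Sum>a\<in>A. sec_form u (rho a v))"
    by (rule sum.reindex_bij_witness[of _ qconj qconj]) (auto intro: qconj_quat_set)
  also have "\<dots> = cnj (\<Sum>a\<in>A. sec_form (rho a v) u)"
    unfolding cnj_sum by (intro sum.cong refl sec_form_cnj)
  also have "(\<Sum>a\<in>A. sec_form (rho a v) u) = sec_form (laplacian p0 p1 \<beta> v) u"
    unfolding laplacian_eq by (rule sec_form_sum[OF finite_quat_set rho_section[OF _ v], symmetric])
  finally show ?thesis by (simp only: sec_form_cnj[symmetric])
qed

text \<open>\<open>rho a\<close> is an isometry. Expanding the nonnegative squares of
  \<open>u + rho a u\<close> and \<open>u - rho a u\<close> gives the Cauchy-Schwarz bound in the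
  only case required.\<close>

lemma rho_form_bound:
  assumes a: "a \<in> A" and u: "u \<in> SEC"
  shows "\<bar>Re (sec_form (rho a u) u)\<bar> \<le> Re (sec_form u u)"
proof -
  have ru: "rho a u \<in> SEC" using rho_section a u .
  have iso: "sec_form (rho a u) (rho a u) = sec_form u u"
    using rho_adjoint[OF a u ru] rho_cancel[OF qconj_quat_set[OF a] u] by simp
  have "sec_form u (rho a u) = cnj (sec_form (rho a u) u)" by (rule sec_form_cnj)
  then have Re: "Re (sec_form u (rho a u)) = Re (sec_form (rho a u) u)" by simp
  have "0 \<le> Re (sec_form (u + section_scale c (rho a u)) (u + section_scale c (rho a u)))" for c
    by (rule sec_form_self_Re)
  moreover have "Re (sec_form (u + section_scale (of_real c) (rho a u)) (u + section_scale (of_real c) (rho a u)))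
      = (1 + c\<^sup>2) * Re (sec_form u u) + 2 * c * Re (sec_form (rho a u) u)" for c :: real
  proof -
    let ?r = "section_scale (of_real c) (rho a u)"
    have r: "?r \<in> SEC" using ru by (rule section_scale_closed)
    have right: "sec_form w (u + ?r) = sec_form w u + of_real c * sec_form w (rho a u)" for w
      using arg_cong[OF sec_form_add[OF u r, of w], of cnj] sec_form_scale[OF ru, of "of_real c" w]
      by (simp add: sec_form_cnj[symmetric])
    show ?thesis
      unfolding sec_form_add[OF u r] sec_form_scale[OF ru] right
      by (simp add: iso Re algebra_simps power2_eq_square)
  qed
  ultimately have "0 \<le> (1 + c\<^sup>2) * Re (sec_form u u) + 2 * c * Re (sec_form (rho a u) u)" for c :: real
    by metis
  from this[of 1] this[of "-1"] show ?thesis by simp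
qed

text \<open>The Laplacian is a sum of \<open>p0 + 1\<close> isometries. This puts all spectra into
  one compact interval, independent of \<open>p1\<close> and \<open>p\<close>.\<close>

lemma eigenvalue_bound:
  assumes u: "u \<in> SEC" "u \<noteq> 0" and t: "laplacian p0 p1 \<beta> u = section_scale (of_real t) u"
  shows "\<bar>t\<bar> \<le> real p0 + 1"
proof -
  have "Re (sec_form u u) \<noteq> 0"
    using sec_form_definite[OF u(1)] u(2) by (auto simp: sec_form_self simp del: of_real_sum)
  then have pos: "Re (sec_form u u) > 0" using sec_form_self_Re[of u] by simp
  have "of_real t * sec_form u u = sec_form (laplacian p0 p1 \<beta> u) u"
    by (simp add: t sec_form_scale[OF u(1)])
  also have "\<dots> = (\<Sum>a\<in>A. sec_form (rho a u) u)"
    unfolding laplacian_eq by (rule sec_form_sum[OF finite_quat_set rho_section[OF _ u(1)]])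
  finally have "Re (of_real t * sec_form u u) = Re (\<Sum>a\<in>A. sec_form (rho a u) u)" by (rule arg_cong)
  then have "t * Re (sec_form u u) = (\<Sum>a\<in>A. Re (sec_form (rho a u) u))" by simp
  moreover have "\<bar>\<Sum>a\<in>A. Re (sec_form (rho a u) u)\<bar> \<le> (\<Sum>a\<in>A. Re (sec_form u u))"
    by (rule order_trans[OF sum_abs sum_mono]) (rule rho_form_bound[OF _ u(1)])
  ultimately have "\<bar>t * Re (sec_form u u)\<bar> \<le> (real p0 + 1) * Re (sec_form u u)"
    by (simp only:) (simp add: card_A add.commute)
  then have "\<bar>t\<bar> * Re (sec_form u u) \<le> (real p0 + 1) * Re (sec_form u u)"
    using pos by (simp add: abs_mult)
  then show ?thesis using pos by simp
qed

lemma card_V_pos: "card V > 0"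
  using finite_V V_closed(3) unfolding card_gt_0_iff by blast

lemma hecke_linear: "Vector_Spaces.linear section_scale section_scale (hecke k)"
proof -
  have rl: "rho_list l (x + y) = rho_list l x + rho_list l y" "rho_list l (section_scale c x) = section_scale c (rho_list l x)" for l x y c
    by (induction l) (use rho_linear in \<open>auto simp: Vector_Spaces.linear_iff\<close>)
  show ?thesis unfolding Vector_Spaces.linear_iff
    using vector_space_section_scale by (auto simp: hecke_def rl sum.distrib sec.scale_sum_right)
qed

lemma op_trace_hecke_bound:
  assumes "k > 0"
  shows "cmod (sec.op_trace secB (hecke k)) \<le>
    real (card (reduced_words p0 k)) * (if p0 ^ k < p1 then 0 else real (card V) * sqrt (real p0) ^ k)"
proof -
  have "sec.op_trace secB (hecke k) = sec.op_trace secB (\<lambda>u. \<Sum>l\<in>reduced_words p0 k. rho_list l u)"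
    by (simp add: hecke_def[abs_def])
  also have "\<dots> = (\<Sum>l\<in>reduced_words p0 k. sec.op_trace secB (rho_list l))"
  proof (rule sec.op_trace_sum[OF independent_sec_basis[OF finite_V]])
    fix l b assume l: "l \<in> reduced_words p0 k" and "b \<in> secB"
    then have "b \<in> SEC" using section_mono_in_space[OF finite_V] by auto
    then show "rho_list l b \<in> sec.span secB"
      unfolding span_sec_basis[OF finite_V] using l by (intro rho_list_section) (auto simp: reduced_words_def)
  qed
  also have "cmod \<dots> \<le> real (card (reduced_words p0 k)) * (if p0 ^ k < p1 then 0 else real (card V) * sqrt (real p0) ^ k)"
  proof (rule sum_norm_bound)
    fix l assume "l \<in> reduced_words p0 k"
    then have l: "set l \<subseteq> A" "reduced l" "l \<noteq> []" "length l = k" using assms by (auto simp: reduced_words_def)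
    show "cmod (sec.op_trace secB (rho_list l)) \<le> (if p0 ^ k < p1 then 0 else real (card V) * sqrt (real p0) ^ k)"
      using op_trace_rho_list_bound[OF l(1-3)] by (simp only: l(4))
  qed
  finally show ?thesis .
qed

text \<open>The interface to the limit argument: one pair \<open>(p1, p)\<close> is summarised by an
  index set with real eigenvalues, and the bounds involve \<open>p1\<close> and \<open>p\<close>
  only through \<open>p0 ^ k < p1\<close> and \<open>1 / (p + 1)\<close>.\<close>

theorem laplacian_eigenbasis:
  "\<exists>(B :: sym_section set) l. finite B \<and> B \<noteq> {} \<and> section_dim SEC = card B
    \<and> (\<forall>\<mu>. section_dim (laplacian_eigenspace p0 p1 \<beta> p \<mu>) = card {b \<in> B. l b = \<mu>})
    \<and> (\<forall>b\<in>B. \<bar>l b\<bar> \<le> real p0 + 1)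
    \<and> (\<forall>k>0. \<bar>set_average B l (nbp (real p0) k)\<bar> \<le>
       (if p0 ^ k < p1 then 0 else real (card (reduced_words p0 k)) * sqrt (real p0) ^ k / real (p + 1)))"
proof -
  let ?L = "laplacian p0 p1 \<beta>"
  interpret selfadjoint_operator section_scale SEC ?L sec_form secB
  proof
    show "SEC \<subseteq> sec.span secB" by (simp add: span_sec_basis[OF finite_V])
  qed (use laplacian_linear in \<open>auto simp: Vector_Spaces.linear_iff
      intro: section_space_subspace finite_sec_basis[OF finite_V] laplacian_section
      sec_form_diff sec_form_scale sec_form_cnj sec_form_definite laplacian_selfadjoint\<close>)
  obtain B l where B: "finite B" "sec.independent B" "sec.span B = SEC"
      "\<And>b. b \<in> B \<Longrightarrow> ?L b = section_scale (of_real (l b)) b"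
    by (rule exists_eigenbasis, rule that)
  have BS: "b \<in> SEC" if "b \<in> B" for b using sec.span_base[OF that] B(3) by simp
  have dimB: "section_dim SEC = card B"
    using sec.dim_span_eq_card_independent[OF B(2)] B(3) by simp
  then have cB: "card B = card V * (p + 1)" using section_dim_space[OF finite_V, of p] by simp
  have ne: "B \<noteq> {}" using cB card_V_pos by auto
  have ev: "section_dim (laplacian_eigenspace p0 p1 \<beta> p \<mu>) = card {b \<in> B. l b = \<mu>}" for \<mu>
    using sec.dim_eigenspace[OF B(2,1) laplacian_linear, of "\<lambda>b. of_real (l b)" "of_real \<mu>"] B(3,4)
    by (simp add: laplacian_eigenspace_def)
  have bd: "\<bar>l b\<bar> \<le> real p0 + 1" if b: "b \<in> B" for b
  proof -
    have "b \<noteq> 0" using B(2) b sec.dependent_zero by auto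
    then show ?thesis using eigenvalue_bound BS[OF b] B(4)[OF b] by blast
  qed
  have av: "\<bar>set_average B l (nbp (real p0) k)\<bar> \<le>
       (if p0 ^ k < p1 then 0 else real (card (reduced_words p0 k)) * sqrt (real p0) ^ k / real (p + 1))"
    if k: "k > 0" for k
  proof -
    have "sec.op_trace B (hecke k) = (\<Sum>b\<in>B. of_real (nbp (real p0) k (l b)))"
      by (rule sec.op_trace_eigenbasis[OF B(2)]) (use hecke_eigenvector BS B(4) in blast)
    then have tr: "sec.op_trace B (hecke k) = of_real (\<Sum>b\<in>B. nbp (real p0) k (l b))" by simp
    have "sec.op_trace B (hecke k) = sec.op_trace secB (hecke k)"
    proof (rule sec.op_trace_basis_independent[OF B(2,1) independent_sec_basis[OF finite_V] finite_sec_basis[OF finite_V]])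
      show "sec.span B = sec.span secB" by (simp add: B(3) span_sec_basis[OF finite_V])
      fix x assume "x \<in> sec.span B"
      then show "hecke k x \<in> sec.span B" unfolding B(3) hecke_def
        by (intro sec.subspace_sum[OF section_space_subspace] rho_list_section) (auto simp: reduced_words_def)
    qed (rule hecke_linear)
    then have "\<bar>\<Sum>b\<in>B. nbp (real p0) k (l b)\<bar> = cmod (sec.op_trace secB (hecke k))"
      using tr by (metis norm_of_real)
    also have "\<dots> \<le> real (card (reduced_words p0 k)) * (if p0 ^ k < p1 then 0 else real (card V) * sqrt (real p0) ^ k)"
      by (rule op_trace_hecke_bound[OF k])
    finally have "\<bar>set_average B l (nbp (real p0) k)\<bar>
        \<le> real (card (reduced_words p0 k)) * (if p0 ^ k < p1 then 0 else real (card V) * sqrt (real p0) ^ k) / real (card B)"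
      unfolding set_average_def by (simp add: divide_right_mono)
    \<comment> \<open>The dimension is \<open>card V * (p + 1)\<close>, so the number of vertices
      cancels and \<open>p + 1\<close> remains in the denominator.\<close>
    also have "\<dots> = (if p0 ^ k < p1 then 0 else real (card (reduced_words p0 k)) * sqrt (real p0) ^ k / real (p + 1))"
    proof -
      define P where "P = real (p + 1)"
      have "real (card B) = real (card V) * P" by (simp only: cB P_def of_nat_mult)
      then show ?thesis using card_V_pos unfolding P_def[symmetric] by simp
    qed
    finally show ?thesis .
  qed
  show ?thesis
  proof (rule exI[of _ B], rule exI[of _ l], intro conjI allI ballI impI)
    fix k :: nat
    assume "k > 0"
    then show "\<bar>set_average B l (nbp (real p0) k)\<bar> \<le>
       (if p0 ^ k < p1 then 0 else real (card (reduced_words p0 k)) * sqrt (real p0) ^ k / real (p + 1))"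
      by (rule av)
  qed (fact B(1) ne dimB ev bd)+
qed

end

section \<open>From eigenspaces to listed eigenvalues, and uniformity in the parameters\<close>

lemma card_sorted_list_of_multiset:
  assumes "size M = n"
  shows "card {i \<in> {1..n}. sorted_list_of_multiset M ! (i - 1) \<in> I} = size (filter_mset (\<lambda>x. x \<in> I) M)"
proof -
  define L where "L = sorted_list_of_multiset M"
  have mL: "mset L = M" by (simp add: L_def)
  then have len: "length L = n" using assms by (metis size_mset)
  \<comment> \<open>Eigenvalues are numbered from 1, list positions from 0, hence the shift by
    \<open>Suc\<close>.\<close>
  have "{i \<in> {1..n}. L ! (i - 1) \<in> I} = Suc ` {i. i < length L \<and> L ! i \<in> I}"
  proof (intro subset_antisym subsetI)
    fix i assume "i \<in> {i \<in> {1..n}. L ! (i - 1) \<in> I}"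
    then show "i \<in> Suc ` {i. i < length L \<and> L ! i \<in> I}"
      using len by (intro image_eqI[of _ _ "i - 1"]) auto
  qed (use len in auto)
  then have "card {i \<in> {1..n}. L ! (i - 1) \<in> I} = card {i. i < length L \<and> L ! i \<in> I}"
    by (simp add: card_image)
  also have "\<dots> = length (filter (\<lambda>x. x \<in> I) L)" by (simp add: length_filter_conv_card)
  also have "\<dots> = size (filter_mset (\<lambda>x. x \<in> I) M)" by (metis mL mset_filter size_mset)
  finally show ?thesis by (simp add: L_def)
qed

lemma size_filter_image_mset_set:
  assumes "finite B"
  shows "size (filter_mset (\<lambda>x. x \<in> I) (image_mset l (mset_set B))) = card {b \<in> B. l b \<in> I}"
  using assms by (simp add: filter_mset_image_mset)

lemma count_image_mset_set:
  assumes "finite B"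
  shows "count (image_mset l (mset_set B)) \<mu> = card {b \<in> B. l b = \<mu>}"
proof -
  have "count (image_mset l (mset_set B)) \<mu> = size (filter_mset (\<lambda>x. x \<in> {\<mu>}) (image_mset l (mset_set B)))"
    by (simp add: filter_eq_replicate_mset)
  then show ?thesis using size_filter_image_mset_set[OF assms, of "{\<mu>}" l] by simp
qed

text \<open>The multiplicity function is the count of a genuine multiset, the image of the finite
  eigenbasis, so \<open>Abs_multiset\<close> returns exactly that multiset.\<close>

lemma card_laplacian_eigenvalues:
  assumes B: "finite B" "section_dim (section_space p0 p1 p) = card B"
    and ev: "\<And>\<mu>. section_dim (laplacian_eigenspace p0 p1 \<beta> p \<mu>) = card {b \<in> B. l b = \<mu>}"
  shows "card {i \<in> {1..section_dim (section_space p0 p1 p)}. laplacian_eigenvalue p0 p1 \<beta> p i \<in> I}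
    = card {b \<in> B. l b \<in> I}"
proof -
  have "(\<lambda>\<mu>. card {b \<in> B. l b = \<mu>}) = count (image_mset l (mset_set B))"
    by (rule ext) (simp only: count_image_mset_set[OF B(1)])
  then have "laplacian_spectrum p0 p1 \<beta> p = image_mset l (mset_set B)"
    unfolding laplacian_spectrum_def ev by (simp only: count_inverse)
  then show ?thesis
    unfolding laplacian_eigenvalue_def B(2)
    using card_sorted_list_of_multiset[of "image_mset l (mset_set B)" "card B" I] size_filter_image_mset_set[OF B(1)]
    by simp
qed

text \<open>Choosing an element above a given level whenever one exists shows that a supremum
  failing to tend to 0 is witnessed by a single sequence. Nonempty index sets matter: the empty
  supremum in \<open>ereal\<close> is minus infinity.\<close>

lemma sup_tendsto_zero_if_sequences:
  fixes F :: "'a \<Rightarrow> real" and D :: "nat \<Rightarrow> 'a set"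
  assumes ne: "\<And>k. D k \<noteq> {}" and nonneg: "\<And>x k. x \<in> D k \<Longrightarrow> F x \<ge> 0"
    and seq: "\<And>x. (\<And>k. x k \<in> D k) \<Longrightarrow> (\<lambda>k. F (x k)) \<longlonglongrightarrow> 0"
  shows "(\<lambda>k. SUP x \<in> D k. ereal (F x)) \<longlonglongrightarrow> 0"
proof -
  show ?thesis
  proof (rule order_tendstoI)
    fix a :: ereal assume a: "a < 0"
    have "a < (SUP x \<in> D k. ereal (F x))" for k
    proof -
      obtain x where x: "x \<in> D k" using ne by blast
      have "a < ereal (F x)" using a nonneg[OF x] by (meson ereal_less_eq(5) less_le_trans)
      then show ?thesis using x by (meson SUP_upper less_le_trans)
    qed
    then show "\<forall>\<^sub>F k in sequentially. a < (SUP x \<in> D k. ereal (F x))" by simp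
  next
    fix a :: ereal assume "0 < a"
    then obtain e where e: "0 < ereal e" "ereal e < a" using ereal_dense2 by blast
    \<comment> \<open>The choice prefers an element with value above \<open>e\<close>, so a small
      value at \<open>x k\<close> bounds all of \<open>D k\<close>.\<close>
    define x where "x k = (SOME x. x \<in> D k \<and> ((\<exists>y\<in>D k. F y > e) \<longrightarrow> F x > e))" for k
    have x: "x k \<in> D k \<and> ((\<exists>y\<in>D k. F y > e) \<longrightarrow> F (x k) > e)" for k
      unfolding x_def by (rule someI_ex) (use ne in blast)
    then have "(\<lambda>k. F (x k)) \<longlonglongrightarrow> 0" by (intro seq) blast
    then have "\<forall>\<^sub>F k in sequentially. F (x k) < e" using e(1) by (intro order_tendstoD) simp_all
    then show "\<forall>\<^sub>F k in sequentially. (SUP x \<in> D k. ereal (F x)) < a"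
    proof eventually_elim
      case (elim k)
      then have "F y \<le> e" if "y \<in> D k" for y using x[of k] that by (meson not_less less_asym)
      then have "(SUP x \<in> D k. ereal (F x)) \<le> ereal e" by (intro SUP_least) simp
      then show ?case using e(2) by (rule le_less_trans)
    qed
  qed
qed

theorem theorem1p7:
  fixes p0 :: nat and b :: "nat \<Rightarrow> int" and I :: "real set"
  assumes "prime p0" and "[p0 = 1] (mod 4)"
    and "\<And>p1. prime p1 \<Longrightarrow> [p1 = 1] (mod 4) \<Longrightarrow> p1 \<noteq> p0 \<Longrightarrow> [(b p1)\<^sup>2 = - 1] (mod int p1)"
    and "is_interval I"
  shows "(\<lambda>k :: nat.
      SUP (p1, p) \<in> {(p1, p :: nat). prime p1 \<and> [p1 = 1] (mod 4) \<and> p1 \<noteq> p0 \<and> k \<le> max p1 p}.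
        ereal \<bar>real (card {i \<in> {1..section_dim (section_space p0 p1 p)}.
                         laplacian_eigenvalue p0 p1 (b p1) p i \<in> I})
                 / real (section_dim (section_space p0 p1 p))
               - (LBINT t:I. (real p0 + 1) * sqrt (4 * real p0 - t\<^sup>2)
                     / (2 * pi * ((real p0 + 1)\<^sup>2 - t\<^sup>2))
                   * indicator ({- 2 * sqrt (real p0)..2 * sqrt (real p0)} \<inter> I) t)\<bar>)
    \<longlonglongrightarrow> 0"
proof -
  define q where "q = real p0"
  have q: "q > 1" using assms(1) prime_gt_1_nat by (simp add: q_def)
  define km where "km = (LBINT t:I. km_density q t * indicator ({- 2 * sqrt q..2 * sqrt q} \<inter> I) t)"
  define D where "D k = {(p1, p :: nat). prime p1 \<and> [p1 = 1] (mod 4) \<and> p1 \<noteq> p0 \<and> k \<le> max p1 p}" for k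
  define F where "F = (\<lambda>(p1, p). \<bar>real (card {i \<in> {1..section_dim (section_space p0 p1 p)}.
       laplacian_eigenvalue p0 p1 (b p1) p i \<in> I}) / real (section_dim (section_space p0 p1 p)) - km\<bar>)"
  have "(\<lambda>k. SUP x \<in> D k. ereal (F x)) \<longlonglongrightarrow> 0"
  proof (rule sup_tendsto_zero_if_sequences)
    fix k
    \<comment> \<open>Two primes congruent to 1 modulo 4, at least one of which differs from
      \<open>p0\<close>.\<close>
    have "prime (5 :: nat)" "prime (13 :: nat)" by simp_all
    then have "(5, k) \<in> D k \<or> (13, k) \<in> D k" by (auto simp: D_def cong_def)
    then show "D k \<noteq> {}" by blast
  next
    fix x k assume "x \<in> D k"
    show "F x \<ge> 0" by (simp add: F_def split: prod.split)
  next
    fix x :: "nat \<Rightarrow> nat \<times> nat" assume x: "\<And>k. x k \<in> D k"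
    define p1 where "p1 k = fst (x k)" for k
    define p where "p k = snd (x k)" for k
    have D: "prime (p1 k)" "[p1 k = 1] (mod 4)" "p1 k \<noteq> p0" "k \<le> max (p1 k) (p k)" for k
      using x[of k] by (auto simp: D_def p1_def p_def)
    define P where "P k B l \<longleftrightarrow> finite B \<and> B \<noteq> {} \<and> section_dim (section_space p0 (p1 k) (p k)) = card B
      \<and> (\<forall>\<mu>. section_dim (laplacian_eigenspace p0 (p1 k) (b (p1 k)) (p k) \<mu>) = card {b \<in> B. l b = \<mu>})
      \<and> (\<forall>b\<in>B. \<bar>l b\<bar> \<le> q + 1)
      \<and> (\<forall>j>0. \<bar>set_average B l (nbp q j)\<bar> \<le>
         (if p0 ^ j < p1 k then 0 else real (card (reduced_words p0 j)) * sqrt q ^ j / real (p k + 1)))" for k and B :: "sym_section set" and l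
    have "\<exists>B l. P k B l" for k
    proof -
      interpret cayley_laplacian p0 "p1 k" "p k" "b (p1 k)"
        by unfold_locales (use assms D in auto)
      show ?thesis unfolding P_def q_def by (rule laplacian_eigenbasis)
    qed
    then obtain B l where P: "\<And>k. P k (B k) (l k)" by metis
    have B: "finite (B k)" "B k \<noteq> {}" "section_dim (section_space p0 (p1 k) (p k)) = card (B k)"
        "section_dim (laplacian_eigenspace p0 (p1 k) (b (p1 k)) (p k) \<mu>) = card {b \<in> B k. l k b = \<mu>}"
        "c \<in> B k \<Longrightarrow> \<bar>l k c\<bar> \<le> q + 1"
        "j > 0 \<Longrightarrow> \<bar>set_average (B k) (l k) (nbp q j)\<bar> \<le>
         (if p0 ^ j < p1 k then 0 else real (card (reduced_words p0 j)) * sqrt q ^ j / real (p k + 1))" for k \<mu> c j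
      using P[of k] unfolding P_def by blast+
    have lim: "(\<lambda>k. set_average (B k) (l k) (nbp q j)) \<longlonglongrightarrow> 0" if j: "j > 0" for j
    proof (rule Lim_null_comparison)
      define C where "C = real (card (reduced_words p0 j)) * sqrt q ^ j"
      have C: "C \<ge> 0" using q by (simp add: C_def)
      show "\<forall>\<^sub>F k in sequentially. norm (set_average (B k) (l k) (nbp q j)) \<le> C / real (k + 1)"
      \<comment> \<open>Beyond this threshold either \<open>p1 k\<close> exceeds
        \<open>p0 ^ j\<close> and the average is zero, or \<open>p1 k < k\<close>, so that
        \<open>p k\<close> attains the maximum and is at least \<open>k\<close>.\<close>
      proof (rule eventually_sequentiallyI[of "p0 ^ j + 1"])
        fix k assume k: "p0 ^ j + 1 \<le> k"
        have "\<bar>set_average (B k) (l k) (nbp q j)\<bar> \<le> C / real (k + 1)"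
        proof (cases "p0 ^ j < p1 k")
          case True
          then have "\<bar>set_average (B k) (l k) (nbp q j)\<bar> \<le> 0" using B(6)[OF j, of k] by simp
          also have "0 \<le> C / real (k + 1)" using C by simp
          finally show ?thesis .
        next
          case False
          then have "k \<le> p k" using D(4)[of k] k by (auto simp: max_def split: if_splits)
          then have "C / real (p k + 1) \<le> C / real (k + 1)" using C by (intro divide_left_mono) auto
          then show ?thesis using False B(6)[OF j, of k] by (simp add: C_def)
        qed
        then show "norm (set_average (B k) (l k) (nbp q j)) \<le> C / real (k + 1)" by simp
      qed
      show "(\<lambda>k. C / real (k + 1)) \<longlonglongrightarrow> 0"
        using tendsto_mult_right_zero[OF LIMSEQ_inverse_real_of_nat, of C] by (simp add: divide_inverse)
    qed
    have "(\<lambda>k. real (card {b \<in> B k. l k b \<in> I}) / real (card (B k))) \<longlonglongrightarrow> km"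
      unfolding km_def by (rule average_interval[OF q B(1,2,5) lim assms(4)])
    then have "(\<lambda>k. \<bar>real (card {b \<in> B k. l k b \<in> I}) / real (card (B k)) - km\<bar>) \<longlonglongrightarrow> 0"
      by (intro tendsto_rabs_zero) (simp add: LIM_zero_iff)
    moreover have "F (x k) = \<bar>real (card {b \<in> B k. l k b \<in> I}) / real (card (B k)) - km\<bar>" for k
    proof -
      have "x k = (p1 k, p k)" by (simp add: p1_def p_def)
      then show ?thesis
        using card_laplacian_eigenvalues[OF B(1,3,4), of k I] by (simp add: F_def B(3))
    qed
    ultimately show "(\<lambda>k. F (x k)) \<longlonglongrightarrow> 0" by simp
  qed
  then show ?thesis
    by (simp add: D_def F_def km_def q_def km_density_def case_prod_unfold)
qed

end
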